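(* Let $C_3$ be the ternary code of length $N=40$ and dimension $K=10$ whose generator matrix $G$ has as columns vectors representing the images of the $40$ points of $PG(3,3)$ under the quadratic Veronese map $(x_0,\dots,x_3)\mapsto(x_0^2,x_0x_1,x_1^2,x_0x_2,x_1x_2,x_2^2,x_0x_3,x_1x_3,x_2x_3,x_3^2)$. Its extended weight enumerator $W(X,Y,T)=\sum_{J\subseteq\{1,\dots,40\}} T^{10-r_J}(X-Y)^{|J|}Y^{40-|J|}$, where $r_J$ is the rank of the submatrix of $G$ on the columns indexed by $J$, equals \[W(X,Y,T)=X^{40}+(T-1)\sum_{i=1}^{40} a_i(T)X^{40-i}Y^i,\] where $a_i(T)=0$ for $i\notin\{18,24,26,27,28,30,31,32,33,34,35,36,37,38,39,40\}$ and \begin{align*} a_{18}(T)=& 780,\qquad a_{24}(T)= 1170(4 T - 3),\qquad a_{26}(T)=1080(T - 3)(T - 9),\\ a_{27}(T)=&40(T^3 - 26 T^2 + 442 T - 884),\qquad a_{28}(T)=189540(T - 3),\\ a_{30}(T)= &936(100 T^2 - 600 T + 909),\qquad a_{31}(T)=505440(T - 3)(T - 6),\\ a_{32}(T)= &5265(T - 3)( 17 T^2 - 160 T + 513),\\ a_{33}(T)= &3120(T - 3)(T^3 + 84 T^2 - 972 T + 3000),\\ a_{34}(T)= &63180(T - 3)( T^3 - 5 T^2 - 45 T + 249),\\ a_{35}(T)=& 936(T - 3)( 5 T^4 + 243 T^3 - 6408 T^2 + 51654 T - 142020),\\ a_{36}(T)= &130(T^6 + 523 T^5 - 15635 T^4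 + 199500 T^3 - 1349544 T^2 + 4639614 T - 6020826),\\ a_{37}(T)= &9360(T - 3)(T^5 - 30 T^4 + 405 T^3 - 3132 T^2 + 13932 T - 27864),\\ a_{38}(T)= &780(T - 3)(T^6 - 33 T^5 + 507 T^4 - 4698 T^3 + 28242 T^2 - 105678 T + 189054),\\ a_{39}(T)=& 40(T - 3)(T^7 - 35 T^6 + 585 T^5 - 6096 T^4 + 43320 T^3 - 214344 T^2 + 695448 T - 1128816),\\ a_{40}(T) =& (T - 3) ( T^8 - 36 T^7 + 633 T^6 - 7110 T^5 + 56241 T^4 - 325134 T^3 + 1371006 T^2 - 3936114 T + 5856786 ). \end{align*}
   Context: For every $m\ge 1$, $W(X,Y,3^m)$ is the (homogeneous) weight enumerator $\sum_{c} X^{40-\mathrm{wt}(c)}Y^{\mathrm{wt}(c)}$ of the extended code $C_3\otimes\mathbb{F}_{3^m}$. The column representatives in $G$ may be chosen arbitrarily; the ranks $r_J$ do not depend on this choice. *)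

theory Defs
  imports "HOL-Library.Cardinality" "Jordan_Normal_Form.DL_Rank" "Jordan_Normal_Form.DL_Submatrix"
begin

text \<open>Points of a projective space are the one-dimensional subspaces of the underlying vector
  space; \<^term>\<open>proj_point v\<close> is the point with homogeneous coordinates \<^term>\<open>v\<close> (if \<^term>\<open>v\<close> is
  not the zero vector).\<close>

definition proj_point :: "'f::field vec \<Rightarrow> 'f vec set" where
  "proj_point v = {c \<cdot>\<^sub>v v | c. True}"

definition PG :: "nat \<Rightarrow> 'f::field vec set set" where
  "PG d = proj_point ` (carrier_vec (d + 1) - {0\<^sub>v (d + 1)})"

definition veronese_vec :: "'f::field vec \<Rightarrow> 'f vec" where
  "veronese_vec x = vec_of_list
     [x $ 0 ^ 2, x $ 0 * x $ 1, x $ 1 ^ 2, x $ 0 * x $ 2, x $ 1 * x $ 2,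
      x $ 2 ^ 2, x $ 0 * x $ 3, x $ 1 * x $ 3, x $ 2 * x $ 3, x $ 3 ^ 2]"

text \<open>The Veronese map on the points of \<^term>\<open>PG 3\<close>. The choice of the representative is
  immaterial, see \<open>veronese_proj_point\<close> below.\<close>

definition veronese :: "'f::field vec set \<Rightarrow> 'f vec set" where
  "veronese P = proj_point (veronese_vec
     (SOME x. x \<in> carrier_vec 4 \<and> x \<noteq> 0\<^sub>v 4 \<and> proj_point x = P))"

lemma veronese_vec_smult:
  fixes x :: "'f::field vec"
  assumes "x \<in> carrier_vec 4"
  shows "veronese_vec (c \<cdot>\<^sub>v x) = c ^ 2 \<cdot>\<^sub>v veronese_vec x"
proof -
  have [simp]: "(c \<cdot>\<^sub>v x) $ i = c * x $ i" if "i < 4" for i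
    using assms that by auto
  have "d \<cdot>\<^sub>v vCons a v = vCons (d * a) (d \<cdot>\<^sub>v v)" for d a and v :: "'f vec"
    by (intro eq_vecI) (auto simp: vec_index_vCons)
  moreover have "d \<cdot>\<^sub>v vNil = vNil" for d :: 'f
    by auto
  ultimately show ?thesis
    by (simp add: veronese_vec_def power2_eq_square ac_simps)
qed

lemma proj_point_smult:
  fixes v :: "'f::field vec"
  assumes "c \<noteq> 0"
  shows "proj_point (c \<cdot>\<^sub>v v) = proj_point v"
proof -
  have "d \<cdot>\<^sub>v v = (d / c) \<cdot>\<^sub>v (c \<cdot>\<^sub>v v)" "d \<cdot>\<^sub>v (c \<cdot>\<^sub>v v) = (d * c) \<cdot>\<^sub>v v" for d
    using assms by (simp_all add: smult_smult_assoc)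
  thus ?thesis
    unfolding proj_point_def by blast
qed

lemma veronese_proj_point:
  fixes x :: "'f::field vec"
  assumes "x \<in> carrier_vec 4" "x \<noteq> 0\<^sub>v 4"
  shows "veronese (proj_point x) = proj_point (veronese_vec x)"
proof -
  define y where "y = (SOME y. y \<in> carrier_vec 4 \<and> y \<noteq> 0\<^sub>v 4 \<and> proj_point y = proj_point x)"
  have y: "y \<in> carrier_vec 4 \<and> y \<noteq> 0\<^sub>v 4 \<and> proj_point y = proj_point x"
    unfolding y_def by (rule someI[of _ x]) (use assms in auto)
  have "y \<in> proj_point y"
    unfolding proj_point_def by (auto intro!: exI[of _ 1])
  then obtain c where c: "y = c \<cdot>\<^sub>v x"
    using y unfolding proj_point_def by auto
  with y assms have "c \<noteq> 0"
    by auto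
  hence "proj_point (veronese_vec y) = proj_point (veronese_vec x)"
    using c assms by (simp add: veronese_vec_smult proj_point_smult)
  thus ?thesis
    unfolding veronese_def y_def .
qed

text \<open>The columns of \<^term>\<open>G\<close> are arbitrary representatives, in arbitrary order, of the images of
  all points of \<^term>\<open>PG 3\<close> under the Veronese map.\<close>

definition veronese_matrix :: "'f::field mat \<Rightarrow> bool" where
  "veronese_matrix G \<longleftrightarrow> dim_row G = 10 \<and>
     (\<exists>p. bij_betw p {..<dim_col G} (PG 3) \<and>
          (\<forall>j<dim_col G. proj_point (col G j) = veronese (p j)))"

definition code_of :: "'f::field mat \<Rightarrow> 'f vec set" where
  "code_of G = vec_space.row_space (dim_col G) G"

definition code_dim :: "nat \<Rightarrow> 'f::field vec set \<Rightarrow> nat" where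
  "code_dim N C = vectorspace.dim class_ring ((module_vec TYPE('f) N)\<lparr>carrier := C\<rparr>)"

definition column_rank :: "'f::field mat \<Rightarrow> nat set \<Rightarrow> nat" where
  "column_rank G J = vec_space.rank (dim_row G) (submatrix G {..<dim_row G} J)"

text \<open>The extended weight enumerator is a polynomial in \<open>X, Y, T\<close> with integer coefficients;
  it is given by its values at arbitrary elements of an arbitrary commutative ring. Taking for the
  ring a polynomial ring over the integers and for \<open>X, Y, T\<close> its indeterminates gives the
  polynomial itself. Column indices start at 0.\<close>

definition ext_weight_enumerator :: "'f::field mat \<Rightarrow> 'a::comm_ring_1 \<Rightarrow> 'a \<Rightarrow> 'a \<Rightarrow> 'a" where
  "ext_weight_enumerator G X Y T =
     (\<Sum>J\<in>Pow {..<dim_col G}.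
        T ^ (dim_row G - column_rank G J) * (X - Y) ^ card J * Y ^ (dim_col G - card J))"

definition veronese_a :: "nat \<Rightarrow> 'a::comm_ring_1 \<Rightarrow> 'a" where
  "veronese_a i T =
    (if i = 18 then 780
     else if i = 24 then 1170 * (4 * T - 3)
     else if i = 26 then 1080 * (T - 3) * (T - 9)
     else if i = 27 then 40 * (T ^ 3 - 26 * T ^ 2 + 442 * T - 884)
     else if i = 28 then 189540 * (T - 3)
     else if i = 30 then 936 * (100 * T ^ 2 - 600 * T + 909)
     else if i = 31 then 505440 * (T - 3) * (T - 6)
     else if i = 32 then 5265 * (T - 3) * (17 * T ^ 2 - 160 * T + 513)
     else if i = 33 then 3120 * (T - 3) * (T ^ 3 + 84 * T ^ 2 - 972 * T + 3000)
     else if i = 34 then 63180 * (T - 3) * (T ^ 3 - 5 * T ^ 2 - 45 * T + 249)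
     else if i = 35 then 936 * (T - 3) *
       (5 * T ^ 4 + 243 * T ^ 3 - 6408 * T ^ 2 + 51654 * T - 142020)
     else if i = 36 then 130 *
       (T ^ 6 + 523 * T ^ 5 - 15635 * T ^ 4 + 199500 * T ^ 3 - 1349544 * T ^ 2
         + 4639614 * T - 6020826)
     else if i = 37 then 9360 * (T - 3) *
       (T ^ 5 - 30 * T ^ 4 + 405 * T ^ 3 - 3132 * T ^ 2 + 13932 * T - 27864)
     else if i = 38 then 780 * (T - 3) *
       (T ^ 6 - 33 * T ^ 5 + 507 * T ^ 4 - 4698 * T ^ 3 + 28242 * T ^ 2 - 105678 * T + 189054)
     else if i = 39 then 40 * (T - 3) *
       (T ^ 7 - 35 * T ^ 6 + 585 * T ^ 5 - 6096 * T ^ 4 + 43320 * T ^ 3 - 214344 * T ^ 2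
         + 695448 * T - 1128816)
     else if i = 40 then (T - 3) *
       (T ^ 8 - 36 * T ^ 7 + 633 * T ^ 6 - 7110 * T ^ 5 + 56241 * T ^ 4 - 325134 * T ^ 3
         + 1371006 * T ^ 2 - 3936114 * T + 5856786)
     else 0)"

end

theory Submission
  imports Defs "HOL-Library.Function_Algebras"
begin

text \<open>
  At \<open>T = 3 ^ m\<close>, the sum defining the extended weight enumerator counts the \<open>m\<close>-tuples of
  quadratic forms by their number of common zeros in \<open>PG(3, 3)\<close>. Splitting off one form \<open>Q\<close> gives
  \<open>W(x, 1, 3 T) = (\<Sum>Q. \<Sum>c. x ^ |Z(Q) \<inter> Z(c)|)\<close>, where \<open>c\<close> runs over the quadratic maps into a group
  of order \<open>T\<close> and exponent 3. The inner sum only depends on the projective type of \<open>Q\<close>; completing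
  squares counts the nonzero forms as 80 double planes, 1560 pairs of planes, 780 lines, 18720 cones,
  21060 hyperbolic and 16848 elliptic quadrics. For each of them the quadratic maps restricted to
  \<open>Z(Q)\<close> fibre over three or four parameters, the fibre sums are computed by deletion and
  contraction, and they only depend on the linear dependences between the parameters. This yields a
  functional equation that determines \<open>W(x, 1, T)\<close> for all powers \<open>T\<close> of 3, hence as a polynomial.
\<close>

section \<open>Polynomial arithmetic on coefficient lists\<close>

text \<open>The ranks of 2 ^ 40 subsets cannot be listed, and the T ^ 10 quadratic maps cannot be
  enumerated for a symbolic T. What makes the sums computable is this: if each factor is x or 1
  according to whether a linear form with coefficients 0, 1, -1 vanishes, then summing the product
  over a group of exponent 3 and order T gives a polynomial in x and T that can be read off from the
  forms. So the contribution of all nonzero Q, which is W(x, 1, 3 T) - W(x, 1, T), is an explicit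
  integer polynomial. The coefficients claimed for W are not derived from it. They are a candidate,
  and one evaluation of integer coefficient lists shows that the candidate has the same difference.
  At T = 1 only the zero map exists; it vanishes at all 40 points, and both sides are x ^ 40.
  Setting X = y + 1 and Y = 1 turns W into the generating function of T ^ (10 - r_J) y ^ |J|.
  Comparing coefficients of y yields integer polynomial identities in T, one for each size of J, and
  these can be evaluated in every commutative ring.\<close>

fun eval1 :: "'r::comm_ring_1 \<Rightarrow> int list \<Rightarrow> 'r" where
  "eval1 t [] = 0"
| "eval1 t (c # cs) = of_int c + t * eval1 t cs"

fun add1 :: "int list \<Rightarrow> int list \<Rightarrow> int list" where
  "add1 [] q = q"
| "add1 (a # p) [] = a # p"
| "add1 (a # p) (b # q) = (a + b) # add1 p q"

fun smult1 :: "int \<Rightarrow> int list \<Rightarrow> int list" where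
  "smult1 c [] = []"
| "smult1 c (a # p) = (c * a) # smult1 c p"

fun mult1 :: "int list \<Rightarrow> int list \<Rightarrow> int list" where
  "mult1 [] q = []"
| "mult1 (a # p) q = add1 (smult1 a q) (0 # mult1 p q)"

text \<open>The outer list contains the coefficients, polynomials in \<open>x\<close>, of the powers of \<open>t\<close>.\<close>

fun eval2 :: "'r::comm_ring_1 \<Rightarrow> 'r \<Rightarrow> int list list \<Rightarrow> 'r" where
  "eval2 x t [] = 0"
| "eval2 x t (c # cs) = eval1 x c + t * eval2 x t cs"

fun add2 :: "int list list \<Rightarrow> int list list \<Rightarrow> int list list" where
  "add2 [] q = q"
| "add2 (a # p) [] = a # p"
| "add2 (a # p) (b # q) = add1 a b # add2 p q"

fun sum2 :: "int list list list \<Rightarrow> int list list" where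
  "sum2 [] = []"
| "sum2 (p # ps) = add2 p (sum2 ps)"

fun smult2 :: "int list \<Rightarrow> int list list \<Rightarrow> int list list" where
  "smult2 c [] = []"
| "smult2 c (a # p) = mult1 c a # smult2 c p"

fun mult2 :: "int list list \<Rightarrow> int list list \<Rightarrow> int list list" where
  "mult2 [] q = []"
| "mult2 (a # p) q = add2 (smult2 a q) ([] # mult2 p q)"

fun power1 :: "int list \<Rightarrow> nat \<Rightarrow> int list" where
  "power1 p 0 = [1]"
| "power1 p (Suc n) = mult1 p (power1 p n)"

lemma eval1_add1 [simp]: "eval1 t (add1 p q) = eval1 t p + eval1 t q"
  by (induction p q rule: add1.induct) (simp_all add: algebra_simps)

lemma eval1_smult1 [simp]: "eval1 t (smult1 c p) = of_int c * eval1 t p"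
  by (induction p) (simp_all add: algebra_simps)

lemma eval1_mult1 [simp]: "eval1 t (mult1 p q) = eval1 t p * eval1 t q"
  by (induction p) (simp_all add: algebra_simps)

lemma eval1_power1 [simp]: "eval1 t (power1 p n) = eval1 t p ^ n"
  by (induction n) simp_all

lemma eval2_add2 [simp]: "eval2 x t (add2 p q) = eval2 x t p + eval2 x t q"
  by (induction p q rule: add2.induct) (simp_all add: algebra_simps)

lemma eval2_smult2 [simp]: "eval2 x t (smult2 c p) = eval1 x c * eval2 x t p"
  by (induction p) (simp_all add: algebra_simps)

lemma eval2_mult2 [simp]: "eval2 x t (mult2 p q) = eval2 x t p * eval2 x t q"
  by (induction p) (simp_all add: algebra_simps)

lemma eval2_sum2: "eval2 x t (sum2 ps) = (\<Sum>p\<leftarrow>ps. eval2 x t p)"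
  by (induction ps) simp_all

text \<open>Coefficient lists of the same polynomial may differ by trailing zeros.\<close>

fun zero1 :: "int list \<Rightarrow> bool" where
  "zero1 [] = True"
| "zero1 (a # p) = (a = 0 \<and> zero1 p)"

fun zero2 :: "int list list \<Rightarrow> bool" where
  "zero2 [] = True"
| "zero2 (a # p) = (zero1 a \<and> zero2 p)"

lemma eval1_zero1: "zero1 p \<Longrightarrow> eval1 t p = 0"
  by (induction p) simp_all

lemma eval2_zero2: "zero2 p \<Longrightarrow> eval2 x t p = 0"
  by (induction p) (simp_all add: eval1_zero1)

text \<open>Dilation by 3 turns T = 3 ^ m into 3 ^ (m + 1). The left side of the functional equation
  needs the dilated coefficients explicitly.\<close>

fun dilate2 :: "int \<Rightarrow> int list list \<Rightarrow> int list list" where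
  "dilate2 k [] = []"
| "dilate2 k (a # p) = a # smult2 [k] (dilate2 k p)"

lemma eval2_dilate2 [simp]: "eval2 x t (dilate2 k p) = eval2 x (of_int k * t) p"
  by (induction p) (simp_all add: algebra_simps)


section \<open>Ternary linear forms\<close>

text \<open>The residues 0, 1, -1 modulo 3 as a datatype: they do not depend on the type of the
  field, they act on every abelian group of exponent 3, and they are evaluated by matching
  constructors.\<close>

datatype trit = Z | P | N

fun trit_add :: "trit \<Rightarrow> trit \<Rightarrow> trit" where
  "trit_add Z b = b"
| "trit_add P Z = P"
| "trit_add P P = N"
| "trit_add P N = Z"
| "trit_add N Z = N"
| "trit_add N P = Z"
| "trit_add N N = P"

fun trit_neg :: "trit \<Rightarrow> trit" where
  "trit_neg Z = Z"
| "trit_neg P = N"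
| "trit_neg N = P"

fun trit_mult :: "trit \<Rightarrow> trit \<Rightarrow> trit" where
  "trit_mult Z b = Z"
| "trit_mult P b = b"
| "trit_mult N b = trit_neg b"

fun trit_act :: "trit \<Rightarrow> 'v::ab_group_add \<Rightarrow> 'v" where
  "trit_act Z a = 0"
| "trit_act P a = a"
| "trit_act N a = - a"

fun form_add :: "trit list \<Rightarrow> trit list \<Rightarrow> trit list" where
  "form_add (a # f) (b # g) = trit_add a b # form_add f g"
| "form_add f g = []"

definition form_smult :: "trit \<Rightarrow> trit list \<Rightarrow> trit list" where
  "form_smult c f = map (trit_mult c) f"

fun form_val :: "trit list \<Rightarrow> 'v::ab_group_add list \<Rightarrow> 'v" where
  "form_val (a # f) (v # vs) = trit_act a v + form_val f vs"
| "form_val f vs = 0"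

fun form_zero :: "trit list \<Rightarrow> bool" where
  "form_zero [] = True"
| "form_zero (a # f) = (case a of Z \<Rightarrow> form_zero f | _ \<Rightarrow> False)"

fun tuples3 :: "nat \<Rightarrow> trit list list" where
  "tuples3 0 = [[]]"
| "tuples3 (Suc n) = (let r = tuples3 n in map ((#) Z) r @ map ((#) P) r @ map ((#) N) r)"

lemma form_zero_iff: "form_zero f \<longleftrightarrow> set f \<subseteq> {Z}"
  by (induction f) (auto split: trit.splits)

lemma set_tuples3: "set (tuples3 n) = {f. length f = n}"
proof (induction n)
  case (Suc n)
  have "f \<in> set (tuples3 (Suc n)) \<longleftrightarrow> length f = Suc n" for f
  proof (cases f)
    case (Cons a g)
    thus ?thesis using Suc by (cases a) (auto simp: Let_def)
  qed (auto simp: Let_def)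
  thus ?case by auto
qed simp

lemma distinct_tuples3: "distinct (tuples3 n)"
  by (induction n) (auto simp: Let_def distinct_map inj_on_def)

lemma length_tuples3: "length (tuples3 n) = 3 ^ n"
  by (induction n) (auto simp: Let_def)

lemma length_form_add [simp]: "length f = length g \<Longrightarrow> length (form_add f g) = length f"
  by (induction f g rule: list_induct2) auto

lemma length_form_smult [simp]: "length (form_smult c f) = length f"
  by (simp add: form_smult_def)

lemma form_val_append:
  "length f = length vs \<Longrightarrow> form_val (f @ g) (vs @ us) = form_val f vs + form_val g us"
  by (induction f vs rule: list_induct2) (auto simp: algebra_simps)

text \<open>The contribution of a single point to the power of x that counts common zeros, so that
  this power becomes a product over points.\<close>

definition weight :: "'r::comm_ring_1 \<Rightarrow> 'v::zero \<Rightarrow> 'r" where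
  "weight x a = (if a = 0 then x else 1)"

text \<open>Here \<open>card A\<close> plays the role of T. Exponent 3 is required on the whole
  type, so that the simplification rules below carry no membership premises.\<close>

locale ternary_group =
  fixes A :: "'v::ab_group_add set"
  assumes finite_A: "finite A"
    and zero_in: "0 \<in> A"
    and add_in: "a \<in> A \<Longrightarrow> b \<in> A \<Longrightarrow> a + b \<in> A"
    and minus_in: "a \<in> A \<Longrightarrow> - a \<in> A"
    and char3: "\<And>a::'v. a + a + a = 0"
begin

text \<open>Together with the next rules this brings sums in the group to a normal form with
  coefficients 0, 1, -1, by which the values at the points of a quadric are compared later.\<close>

lemma triple [simp]: "a + (a + a) = (0::'v)" "a + (a + (a + b)) = (b::'v)"
  using char3[of a] by (simp_all add: add.assoc[symmetric])

lemma double [simp]: "a + a = - (a::'v)"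
  using char3[of a] by (simp add: eq_neg_iff_add_eq_0)

lemma double_left [simp]: "a + (a + b) = b - (a::'v)"
  by (simp add: add.assoc[symmetric] del: add.assoc)

lemma eq_neg_self_iff [simp]: "- a = a \<longleftrightarrow> a = (0::'v)" "a = - a \<longleftrightarrow> a = (0::'v)"
proof -
  have "a = 0" if "- a = a" using char3[of a] that by (metis add.left_inverse add_0)
  thus "- a = a \<longleftrightarrow> a = 0" "a = - a \<longleftrightarrow> a = 0" by auto
qed

lemma trit_act_add: "trit_act (trit_add a b) v = trit_act a v + trit_act b (v::'v)"
  by (cases a; cases b) (simp_all add: algebra_simps)

lemma trit_act_neg: "trit_act (trit_neg a) v = - trit_act a (v::'v)"
  by (cases a) simp_all

lemma trit_act_mult: "trit_act (trit_mult a b) v = trit_act a (trit_act b (v::'v))"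
  by (cases a) (simp_all add: trit_act_neg)

lemma trit_act_add_right: "trit_act a (u + v) = trit_act a u + trit_act a (v::'v)"
  by (cases a) simp_all

lemma trit_act_in: "v \<in> A \<Longrightarrow> trit_act a v \<in> A"
  by (cases a) (auto simp: zero_in minus_in)

lemma form_val_add:
  assumes "length f = length g" "length vs = length g"
  shows "form_val (form_add f g) vs = form_val f vs + form_val g (vs :: 'v list)"
  using assms
proof (induction f g arbitrary: vs rule: list_induct2)
  case (Cons a f b g)
  thus ?case by (cases vs) (auto simp: trit_act_add algebra_simps)
qed simp

lemma form_val_smult:
  assumes "length vs = length f"
  shows "form_val (form_smult c f) vs = trit_act c (form_val f (vs :: 'v list))"
  using assms
proof (induction f arbitrary: vs)
  case (Cons a f)
  thus ?case
    by (cases vs) (auto simp: form_smult_def trit_act_mult trit_act_add_right)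
next
  case Nil
  thus ?case by (cases c) (auto simp: form_smult_def)
qed

lemma form_val_in: "set vs \<subseteq> A \<Longrightarrow> form_val f vs \<in> A"
  by (induction f vs rule: form_val.induct) (auto simp: zero_in intro!: add_in trit_act_in)

end

subsection \<open>Deletion and contraction\<close>

fun form_subst :: "trit list \<Rightarrow> trit list \<Rightarrow> trit list" where
  "form_subst h (a # g) = form_add g (form_smult a h)"
| "form_subst h [] = []"

text \<open>Summation over the value \<open>c\<close> of the first variable, by
  \<^term>\<open>weight x (c - h) = 1 + (if c = h then x - 1 else 0)\<close>: either a form that involves \<open>c\<close> is
  deleted, or \<open>c\<close> is eliminated from the forms that have not been deleted, which is flagged by
  \<^term>\<open>False\<close>. A factor \<open>card A\<close>, flagged by \<^term>\<open>True\<close>, remains if all forms involving \<open>c\<close>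
  have been deleted.\<close>

fun elim :: "trit list list \<Rightarrow> trit list list \<Rightarrow> (bool \<times> trit list list) list" where
  "elim [] zs = [(True, zs)]"
| "elim (f # L) zs = (case f of [] \<Rightarrow> [] | a # g \<Rightarrow>
     (case a of Z \<Rightarrow> elim L (g # zs)
      | P \<Rightarrow> (False, map (form_subst (form_smult N g)) L @ zs) # elim L zs
      | N \<Rightarrow> (False, map (form_subst g) L @ zs) # elim L zs))"

text \<open>The head of the list is summed innermost. This is the variable that \<open>elim\<close>
  removes, so an elimination happens under the remaining sums.\<close>

primrec iter_sum :: "'v set \<Rightarrow> nat \<Rightarrow> ('v list \<Rightarrow> 'r::comm_ring_1) \<Rightarrow> 'v list \<Rightarrow> 'r" where
  "iter_sum A 0 g vs = g vs"
| "iter_sum A (Suc k) g vs = iter_sum A k (\<lambda>us. \<Sum>c\<in>A. g (c # us)) vs"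

definition weight_prod :: "'r::comm_ring_1 \<Rightarrow> trit list list \<Rightarrow> 'v::ab_group_add list \<Rightarrow> 'r" where
  "weight_prod x L vs = (\<Prod>f\<leftarrow>L. weight x (form_val f vs))"

fun zero_count :: "trit list list \<Rightarrow> int list" where
  "zero_count [] = [1]"
| "zero_count (f # L) = (if form_zero f then 0 # zero_count L else zero_count L)"

fun combine_branches :: "(bool \<times> 'b) list \<Rightarrow> int list list list \<Rightarrow> int list list" where
  "combine_branches ((b, M) # r) (p # ps) = add2 (if b then [] # p else p) (combine_branches r ps)"
| "combine_branches r ps = []"

text \<open>The powers of x - 1 are left to \<open>homog\<close>, so the coefficients in these lists
  are nonnegative counts of branches, sorted by the power of t and by the number of forms that end
  up zero.\<close>

fun branch_counts :: "nat \<Rightarrow> trit list list \<Rightarrow> int list list" where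
  "branch_counts 0 L = [zero_count L]"
| "branch_counts (Suc k) L =
     (let es = elim L [] in combine_branches es (map (branch_counts k) (map snd es)))"

text \<open>Each of the \<open>k\<close> eliminations contributes a factor \<open>t\<close> or \<open>x - 1\<close>; the branches are
  counted by their powers of \<open>t\<close>, which determine the powers of \<open>x - 1\<close>.\<close>

fun homog :: "nat \<Rightarrow> int list list \<Rightarrow> int list list" where
  "homog k [] = []"
| "homog k (r # p) = mult1 (power1 [- 1, 1] k) r # homog (k - 1) p"

definition weight_poly :: "nat \<Rightarrow> trit list list \<Rightarrow> int list list" where
  "weight_poly k L = homog k (branch_counts k L)"

definition indep :: "'v::ab_group_add list \<Rightarrow> bool" where
  "indep vs \<longleftrightarrow> (\<forall>f. length f = length vs \<longrightarrow> form_val f vs = 0 \<longrightarrow> form_zero f)"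

lemma form_val_form_zero: "form_zero f \<Longrightarrow> form_val f vs = 0"
proof (induction f vs rule: form_val.induct)
  case (1 a f v vs)
  thus ?case by (cases a) auto
qed auto

lemma iter_sum_linear:
  "iter_sum A k (\<lambda>us. c * g us + h us) vs = c * iter_sum A k g vs + iter_sum A k h vs"
  by (induction k arbitrary: g h) (simp_all add: sum.distrib sum_distrib_left[symmetric])

lemma iter_sum_zero: "iter_sum A k (\<lambda>us. 0) vs = 0"
  by (induction k) auto

lemma iter_sum_sum_list:
  "iter_sum A k (\<lambda>us. \<Sum>p\<leftarrow>ps. a p * g p us) vs = (\<Sum>p\<leftarrow>ps. a p * iter_sum A k (g p) vs)"
  by (induction ps) (auto simp: iter_sum_zero iter_sum_linear)

lemma iter_sum_cong:
  assumes "\<And>us. length us = k + length vs \<Longrightarrow> set us \<subseteq> A \<Longrightarrow> g us = h us" "set vs \<subseteq> A"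
  shows "iter_sum A k g vs = iter_sum A k h vs"
  using assms
proof (induction k arbitrary: g h)
  case (Suc k)
  show ?case
    by (simp, rule Suc.IH) (auto intro!: sum.cong Suc.prems)
qed auto

context ternary_group
begin

lemma weight_split:
  "weight x a = 1 + (if a = 0 then x - 1 else 0)"
  by (simp add: weight_def)

lemma form_val_subst:
  assumes "length g = Suc (length us)" "length h = length us"
  shows "form_val (form_subst h g) us = form_val g (form_val h us # (us :: 'v list))"
  using assms
  by (cases g) (auto simp: form_val_add form_val_smult algebra_simps)

text \<open>The list \<open>zs\<close> collects the forms without c, whose weights factor out of the
  sum. Once no form is left, the empty product summed over A yields \<open>card A\<close>.
  Contracting a form fixes c at a single element of A and leaves the remaining forms with that value
  substituted.\<close>

lemma sum_weight_elim:
  assumes "\<And>f. f \<in> set L \<Longrightarrow> length f = Suc (length us)"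
    and "\<And>f. f \<in> set zs \<Longrightarrow> length f = length us" and "set us \<subseteq> A"
  shows "(\<Sum>c\<in>A. weight_prod x L (c # us)) * weight_prod x zs us =
    (\<Sum>p\<leftarrow>elim L zs. (if fst p then of_nat (card A) else x - 1) * weight_prod x (snd p) us)"
  using assms
proof (induction L arbitrary: zs)
  case Nil
  thus ?case by (simp add: weight_prod_def)
next
  case (Cons f L)
  obtain a g where f: "f = a # g" "length g = length us"
    using Cons.prems(1)[of f] by (cases f) auto
  have len: "length f = Suc (length us)" if "f \<in> set L" for f
    using Cons.prems(1) that by auto
  have wp: "weight_prod x (f # L) vs = weight x (form_val f vs) * weight_prod x L vs" for vs
    and f L by (simp add: weight_prod_def)
  have wpa: "weight_prod x (K @ L) vs = weight_prod x K vs * weight_prod x L vs" for vs K L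
    by (simp add: weight_prod_def)
  have IH: "(\<Sum>c\<in>A. weight_prod x L (c # us)) * weight_prod x zs us =
    (\<Sum>p\<leftarrow>elim L zs. (if fst p then of_nat (card A) else x - 1) * weight_prod x (snd p) us)"
    by (rule Cons.IH) (use Cons.prems in auto)
  have split: "(\<Sum>c\<in>A. weight_prod x (f # L) (c # us)) * weight_prod x zs us =
     (x - 1) * weight_prod x (map (form_subst h) L @ zs) us +
     (\<Sum>c\<in>A. weight_prod x L (c # us)) * weight_prod x zs us"
    if h: "length h = length us" "\<And>c. form_val f (c # us) = 0 \<longleftrightarrow> c = form_val h us" for h
  proof -
    have "weight_prod x (f # L) (c # us) =
        weight_prod x L (c # us) + (if c = form_val h us then (x - 1) * weight_prod x L (c # us) else 0)" for c
      unfolding wp weight_split h(2) by (simp add: algebra_simps)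
    hence "(\<Sum>c\<in>A. weight_prod x (f # L) (c # us)) =
        (\<Sum>c\<in>A. weight_prod x L (c # us)) + (x - 1) * weight_prod x L (form_val h us # us)"
      using form_val_in[of us h] Cons.prems(3) finite_A by (simp add: sum.distrib sum.delta)
    also have "weight_prod x L (form_val h us # us) = weight_prod x (map (form_subst h) L) us"
      unfolding weight_prod_def map_map
      by (intro arg_cong[where f = prod_list] map_cong) (auto simp: form_val_subst len h)
    finally show ?thesis by (simp only: wpa ring_distribs mult_ac add_ac)
  qed
  show ?case
  proof (cases a)
    case Z
    have "(\<Sum>c\<in>A. weight_prod x (f # L) (c # us)) * weight_prod x zs us =
        (\<Sum>c\<in>A. weight_prod x L (c # us)) * weight_prod x (g # zs) us"
      by (simp add: wp f Z sum_distrib_left[symmetric] mult_ac)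
    also have "\<dots> = (\<Sum>p\<leftarrow>elim L (g # zs). (if fst p then of_nat (card A) else x - 1) * weight_prod x (snd p) us)"
      by (rule Cons.IH) (use Cons.prems f in auto)
    finally show ?thesis using f Z by simp
  next
    case P
    have "form_val f (c # us) = 0 \<longleftrightarrow> c = form_val (form_smult N g) us" for c
      by (simp add: f P form_val_smult eq_neg_iff_add_eq_0)
    from split[OF _ this] f show ?thesis by (simp add: P IH)
  next
    case N
    have "form_val f (c # us) = 0 \<longleftrightarrow> c = form_val g us" for c
      by (simp add: f N) (metis add.left_inverse add_minus_cancel minus_unique add.inverse_inverse)
    from split[OF _ this] f show ?thesis by (simp add: N IH)
  qed
qed

lemma length_elim:
  assumes "\<And>f. f \<in> set L \<Longrightarrow> length f = Suc n" "\<And>f. f \<in> set zs \<Longrightarrow> length f = n"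
    and "p \<in> set (elim L zs)" "f \<in> set (snd p)"
  shows "length f = n"
  using assms
proof (induction L arbitrary: zs)
  case (Cons h L)
  obtain a g where h: "h = a # g" "length g = n"
    using Cons.prems(1)[of h] by (cases h) auto
  have subst: "length (form_subst k f) = n" if "f \<in> set L" "length k = n" for f k
    using Cons.prems(1)[of f] that by (cases f) auto
  have IH: "length f = n" if "p \<in> set (elim L zs)" "\<And>f. f \<in> set zs \<Longrightarrow> length f = n" for zs
    by (rule Cons.IH[OF _ _ that(1)]) (use Cons.prems that in auto)
  show ?case
  proof (cases a)
    case Z
    show ?thesis by (rule IH[of "g # zs"]) (use Cons.prems h Z in auto)
  qed (use Cons.prems h IH[of zs] subst in auto)
qed auto

text \<open>Independent parameters annihilate only the formally zero form, so the weights are known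
  without knowing the parameters.\<close>

lemma eval1_zero_count:
  assumes "indep vs" "\<And>f. f \<in> set L \<Longrightarrow> length f = length vs"
  shows "eval1 x (zero_count L) = weight_prod x L vs"
  using assms(2)
proof (induction L)
  case (Cons f L)
  have "form_val f vs = 0 \<longleftrightarrow> form_zero f"
    using Cons.prems[of f] assms(1) form_val_form_zero unfolding indep_def by auto
  thus ?case using Cons by (simp add: weight_prod_def weight_def)
qed (simp add: weight_prod_def)

lemma eval2_homog_add2:
  "eval2 x t (homog k (add2 p q)) = eval2 x t (homog k p) + eval2 x t (homog k q)"
  by (induction p q arbitrary: k rule: add2.induct) (simp_all add: algebra_simps)

text \<open>The bound on the length is essential: at position k + 1 the exponent would be 0 on both
  sides, by truncated subtraction on the right, and the factor x - 1 would be missing on the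
  left.\<close>

lemma eval2_homog_Suc:
  "length p \<le> Suc k \<Longrightarrow> eval2 x t (homog (Suc k) p) = (x - 1) * eval2 x t (homog k p)"
proof (induction k p rule: homog.induct)
  case (2 k r p)
  show ?case
  proof (cases k)
    case 0
    thus ?thesis using 2 by (simp add: algebra_simps)
  next
    case (Suc l)
    have "eval2 x t (homog (Suc l) p) = (x - 1) * eval2 x t (homog l p)"
      using 2 Suc by simp
    thus ?thesis using Suc by (simp del: homog.simps(1)) (simp add: ring_distribs mult_ac)
  qed
qed simp

lemma length_add2: "length (add2 p q) = max (length p) (length q)"
  by (induction p q rule: add2.induct) auto

lemma length_branch_counts: "length (branch_counts k L) \<le> Suc k"
proof (induction k arbitrary: L)
  case (Suc k)
  have "length (combine_branches es (map (branch_counts k) (map snd es))) \<le> Suc (Suc k)" for es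
    by (induction es) (auto simp: length_add2 Suc le_SucI)
  thus ?case by (simp add: Let_def)
qed simp

text \<open>After k eliminations only forms in the parameters \<open>vs\<close> remain, and
  \<open>eval1_zero_count\<close> applies. The result depends on A only through its order.\<close>

lemma eval2_weight_poly:
  assumes "indep vs" "set vs \<subseteq> A" "\<And>f. f \<in> set L \<Longrightarrow> length f = k + length vs"
  shows "eval2 x (of_nat (card A)) (weight_poly k L) = iter_sum A k (weight_prod x L) vs"
  unfolding weight_poly_def using assms(3)
proof (induction k arbitrary: L)
  case 0
  thus ?case using eval1_zero_count[OF assms(1), of L] by simp
next
  case (Suc k)
  define w where "w = (\<lambda>b. if b then of_nat (card A) else x - 1)"
  have "iter_sum A (Suc k) (weight_prod x L) vs =
      iter_sum A k (\<lambda>us. \<Sum>p\<leftarrow>elim L []. w (fst p) * weight_prod x (snd p) us) vs"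
    unfolding iter_sum.simps
  proof (rule iter_sum_cong[OF _ assms(2)])
    fix us assume us: "length us = k + length vs" "set us \<subseteq> A"
    show "(\<Sum>c\<in>A. weight_prod x L (c # us)) = (\<Sum>p\<leftarrow>elim L []. w (fst p) * weight_prod x (snd p) us)"
      using sum_weight_elim[of L us "[]" x] us Suc.prems unfolding w_def by (simp add: weight_prod_def)
  qed
  also have "\<dots> = (\<Sum>p\<leftarrow>elim L []. w (fst p) * iter_sum A k (weight_prod x (snd p)) vs)"
    by (rule iter_sum_sum_list)
  also have "\<dots> = (\<Sum>p\<leftarrow>elim L []. w (fst p) * eval2 x (of_nat (card A)) (homog k (branch_counts k (snd p))))"
  proof (intro arg_cong[where f = sum_list] map_cong refl arg_cong2[where f = "(*)"])
    fix p assume p: "p \<in> set (elim L [])"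
    show "iter_sum A k (weight_prod x (snd p)) vs =
        eval2 x (of_nat (card A)) (homog k (branch_counts k (snd p)))"
      by (rule Suc.IH[symmetric]) (rule length_elim[OF _ _ p], use Suc.prems in auto)
  qed
  also have "\<dots> = eval2 x (of_nat (card A))
      (homog (Suc k) (combine_branches ps (map (branch_counts k) (map snd ps))))"
    if "ps = elim L []" for ps
    unfolding that[symmetric]
    by (induction ps)
      (auto simp: w_def eval2_homog_add2 eval2_homog_Suc[OF length_branch_counts])
  finally show ?case by (simp add: Let_def)
qed

end

subsection \<open>Summation over linear dependence patterns\<close>

definition snoc :: "'b list \<Rightarrow> 'b \<Rightarrow> 'b list" where
  "snoc bs b = bs @ [b]"

text \<open>The sum over n further parameters, when those already chosen have coordinate vectors
  \<open>bs\<close> in a space of dimension k. The next parameter either lies in that space, with 3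
  ^ k possible coordinate vectors, or is one of the t - 3 ^ k elements outside and becomes a new
  basis vector, which pads the old coordinates by zero.\<close>

fun pattern_sum :: "(trit list list \<Rightarrow> int list list) \<Rightarrow> nat \<Rightarrow> nat \<Rightarrow> trit list list \<Rightarrow> int list list" where
  "pattern_sum \<phi> 0 k bs = \<phi> bs"
| "pattern_sum \<phi> (Suc n) k bs =
     add2 (sum2 (map (pattern_sum \<phi> n k) (map (snoc bs) (tuples3 k))))
       (mult2 [[- (3 ^ k)], [1]] (pattern_sum \<phi> n (Suc k) (map (\<lambda>b. b @ [Z]) bs @ [replicate k Z @ [P]])))"

primrec list_sum :: "'v set \<Rightarrow> nat \<Rightarrow> ('v list \<Rightarrow> 'r::comm_ring_1) \<Rightarrow> 'v list \<Rightarrow> 'r" where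
  "list_sum A 0 g vs = g vs"
| "list_sum A (Suc n) g vs = (\<Sum>b\<in>A. list_sum A n g (vs @ [b]))"

context ternary_group
begin

lemma indep_snoc:
  assumes vs: "indep vs" and b: "\<And>f. length f = length vs \<Longrightarrow> b \<noteq> form_val f (vs :: 'v list)"
  shows "indep (vs @ [b])"
  unfolding indep_def
proof (intro allI impI)
  fix f assume len: "length f = length (vs @ [b])" and 0: "form_val f (vs @ [b]) = 0"
  then obtain g a where f: "f = g @ [a]" "length g = length vs"
    by (metis length_append_singleton length_Suc_conv_rev)
  have 0: "form_val g vs + trit_act a b = 0"
    using 0 f by (simp add: form_val_append)
  show "form_zero f"
  proof (cases a)
    case Z
    thus ?thesis using 0 f vs by (auto simp: indep_def form_zero_iff)
  next
    case P
    hence "b = form_val (form_smult N g) vs"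
      using 0 f by (simp add: form_val_smult eq_neg_iff_add_eq_0 add.commute)
    thus ?thesis using b[of "form_smult N g"] f by simp
  next
    case N
    hence "b = form_val g vs" using 0 by simp
    thus ?thesis using b[of g] f by simp
  qed
qed

lemma indep_inj:
  assumes "indep (vs :: 'v list)" "length f = length vs" "length g = length vs"
    "form_val f vs = form_val g vs"
  shows "f = g"
proof -
  have "form_val (form_add f (form_smult N g)) vs = 0"
    using assms by (simp add: form_val_add form_val_smult)
  hence z: "form_zero (form_add f (form_smult N g))"
    using assms unfolding indep_def by simp
  have "length f = length g" using assms by simp
  thus ?thesis using z
  proof (induction f g rule: list_induct2)
    case (Cons a f b g)
    thus ?case by (cases a; cases b) (auto simp: form_smult_def)
  qed simp
qed

text \<open>If \<open>vs\<close> already spans A, no b satisfies the premise on c, but then the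
  factor of c is 0. Hence the identity also covers orders of A too small for further independent
  parameters.\<close>

lemma sum_span_split:
  assumes vs: "indep vs" "set vs \<subseteq> A"
    and c: "\<And>b. b \<in> A \<Longrightarrow> indep (vs @ [b]) \<Longrightarrow> g b = (c :: 'r::comm_ring_1)"
  shows "(\<Sum>b\<in>A. g b) = (\<Sum>f\<leftarrow>tuples3 (length vs). g (form_val f vs)) + (of_nat (card A) - 3 ^ length vs) * c"
proof -
  define S where "S = (\<lambda>f. form_val f vs) ` set (tuples3 (length vs))"
  have inj: "inj_on (\<lambda>f. form_val f vs) (set (tuples3 (length vs)))"
    using indep_inj[OF vs(1)] by (auto simp: inj_on_def set_tuples3)
  have S: "S \<subseteq> A" unfolding S_def using form_val_in vs(2) by auto
  have cardS: "card S = 3 ^ length vs"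
    unfolding S_def card_image[OF inj] using distinct_card[OF distinct_tuples3] length_tuples3 by simp
  have "(\<Sum>b\<in>A. g b) = (\<Sum>b\<in>S. g b) + (\<Sum>b\<in>A - S. g b)"
    using sum.subset_diff[OF S finite_A, of g] by (simp add: add.commute)
  also have "(\<Sum>b\<in>A - S. g b) = (\<Sum>b\<in>A - S. c)"
  proof (rule sum.cong[OF refl])
    fix b assume b: "b \<in> A - S"
    show "g b = c"
      by (rule c) (use b in \<open>auto intro!: indep_snoc vs simp: S_def set_tuples3\<close>)
  qed
  also have "\<dots> = (of_nat (card A) - 3 ^ length vs) * c"
    using card_Diff_subset[of S A] S finite_A cardS card_mono[OF finite_A S]
    by (simp add: finite_subset[OF S] of_nat_diff)
  also have "(\<Sum>b\<in>S. g b) = (\<Sum>f\<in>set (tuples3 (length vs)). g (form_val f vs))"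
    unfolding S_def by (rule sum.reindex_cong[OF inj]) auto
  also have "\<dots> = (\<Sum>f\<leftarrow>tuples3 (length vs). g (form_val f vs))"
    by (simp add: sum_list_distinct_conv_sum_set distinct_tuples3)
  finally show ?thesis .
qed

text \<open>By assumption the value of \<open>\<Phi>\<close> is computed from coordinates alone,
  whatever the independent vectors are. So all b outside the span contribute the same polynomial
  value.\<close>

lemma eval2_pattern_sum:
  assumes \<phi>: "\<And>vs bs. indep vs \<Longrightarrow> set vs \<subseteq> A \<Longrightarrow> length bs = m \<Longrightarrow>
      (\<forall>b\<in>set bs. length b = length vs) \<Longrightarrow>
      eval2 x (of_nat (card A)) (\<phi> bs) = \<Phi> (map (\<lambda>b. form_val b vs) bs)"
    and "indep vs" "set vs \<subseteq> A" "length bs + n = m" "\<forall>b\<in>set bs. length b = length vs"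
  shows "eval2 x (of_nat (card A)) (pattern_sum \<phi> n (length vs) bs) =
    list_sum A n \<Phi> (map (\<lambda>b. form_val b vs) bs)"
  using assms(2-)
proof (induction n arbitrary: vs bs)
  case 0
  thus ?case using \<phi>[of vs bs] by simp
next
  case (Suc n)
  let ?t = "of_nat (card A)" and ?k = "length vs"
  let ?bs' = "map (\<lambda>b. b @ [Z]) bs @ [replicate ?k Z @ [P]]"
  have span: "eval2 x ?t (pattern_sum \<phi> n ?k (bs @ [f])) =
      list_sum A n \<Phi> (map (\<lambda>b. form_val b vs) bs @ [form_val f vs])" if "length f = ?k" for f
    using Suc.IH[of vs "bs @ [f]"] Suc.prems that by simp
  have new: "list_sum A n \<Phi> (map (\<lambda>b. form_val b vs) bs @ [b]) =
      eval2 x ?t (pattern_sum \<phi> n (Suc ?k) ?bs')" if b: "b \<in> A" "indep (vs @ [b])" for b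
  proof -
    have "form_val (replicate ?k Z) vs = 0"
      by (rule form_val_form_zero) (auto simp: form_zero_iff)
    hence "map (\<lambda>c. form_val c (vs @ [b])) ?bs' = map (\<lambda>b. form_val b vs) bs @ [b]"
      using Suc.prems(4) by (simp add: form_val_append)
    moreover have "eval2 x ?t (pattern_sum \<phi> n (length (vs @ [b])) ?bs') =
        list_sum A n \<Phi> (map (\<lambda>c. form_val c (vs @ [b])) ?bs')"
      by (rule Suc.IH) (use Suc.prems b in auto)
    ultimately show ?thesis by (simp only: length_append_singleton)
  qed
  have "list_sum A (Suc n) \<Phi> (map (\<lambda>b. form_val b vs) bs) =
    (\<Sum>f\<leftarrow>tuples3 ?k. list_sum A n \<Phi> (map (\<lambda>b. form_val b vs) bs @ [form_val f vs]))
      + (?t - 3 ^ ?k) * eval2 x ?t (pattern_sum \<phi> n (Suc ?k) ?bs')"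
    unfolding list_sum.simps by (rule sum_span_split[OF Suc.prems(1,2) new])
  also have "(\<Sum>f\<leftarrow>tuples3 ?k. list_sum A n \<Phi> (map (\<lambda>b. form_val b vs) bs @ [form_val f vs])) =
      (\<Sum>f\<leftarrow>tuples3 ?k. eval2 x ?t (pattern_sum \<phi> n ?k (bs @ [f])))"
    by (intro arg_cong[where f = sum_list] map_cong refl span[symmetric]) (simp add: set_tuples3)
  also have "\<dots> = eval2 x ?t (sum2 (map (pattern_sum \<phi> n ?k) (map (snoc bs) (tuples3 ?k))))"
    by (simp add: eval2_sum2 snoc_def comp_def)
  finally show ?case by (simp add: algebra_simps)
qed

end

section \<open>Values of quadratic maps on the points of the standard quadrics\<close>

fun form_comb :: "trit list \<Rightarrow> trit list list \<Rightarrow> trit list" where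
  "form_comb (c # cs) (b # bs) =
     (case cs of [] \<Rightarrow> form_smult c b | _ \<Rightarrow> form_add (form_smult c b) (form_comb cs bs))"
| "form_comb cs bs = []"

text \<open>The binary form b0 s^2 + b1 s t + b2 t^2 at the four points (1, 0), (1, 1), (1, -1), (0,
  1) of a line.\<close>

definition line_forms :: "trit list list \<Rightarrow> trit list list" where
  "line_forms bs = map (\<lambda>co. form_comb co bs) [[P, Z, Z], [P, P, P], [P, N, P], [Z, Z, P]]"

text \<open>The nine points (1, y, z) of a plane off the line where the first coordinate is 0. The
  new variables are the constant and the two linear coefficients; the quadratic part in y and z is
  the binary form \<open>bs\<close> on that line.\<close>

definition plane_forms :: "trit list list \<Rightarrow> trit list list" where
  "plane_forms bs = map (\<lambda>(y, z). [P, y, z] @ form_comb [trit_mult y y, trit_mult y z, trit_mult z z] bs)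
     [(Z, Z), (Z, P), (Z, N), (P, Z), (P, P), (P, N), (N, Z), (N, P), (N, N)]"

text \<open>Two lines of four points each, one with the binary form m given by the new variables,
  the other with b - m, where b is given by \<open>bs\<close>.\<close>

definition grid_forms :: "trit list list \<Rightarrow> trit list list" where
  "grid_forms bs = concat (map (\<lambda>co. [co @ form_comb [Z, Z, Z] bs, form_smult N co @ form_comb co bs])
     [[P, Z, Z], [P, P, P], [P, N, P], [Z, Z, P]])"

text \<open>Up to a power of the cardinality of \<open>A\<close>, the sums over the quadratic maps that correspond to
  a line, a plane and a pair of planes, with the numbers of such quadrics.\<close>

definition plane_pattern :: "trit list list \<Rightarrow> int list list" where
  "plane_pattern bs = (let p = weight_poly 3 (plane_forms bs) in
     smult2 (zero_count (line_forms bs))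
       (add2 [[], [], [], [], [], [], [780]] (mult2 p (add2 [[], [], [], [80]] (smult2 [1560] p)))))"

definition grid_pattern :: "trit list list \<Rightarrow> int list list" where
  "grid_pattern bs = (let p = weight_poly 3 (grid_forms bs) in mult2 p p)"

text \<open>The three points other than the vertex on a generator of a cone. If the vertex has value
  v, a further point has value q and the mixed coefficient is l, then the remaining two points have
  values q + v + l and q + v - l. The list \<open>co\<close> expresses l by the last three
  parameters.\<close>

definition cone_forms :: "trit list \<Rightarrow> trit list list \<Rightarrow> trit list list" where
  "cone_forms co bs = [P # form_comb [Z, Z, Z, Z] bs, P # form_comb (P # co) bs,
     P # form_comb (P # form_smult N co) bs]"

definition cone_pattern :: "trit list list \<Rightarrow> int list list" where
  "cone_pattern bs = smult2 (zero_count [form_comb [P, Z, Z, Z] bs])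
     (mult2 (mult2 (weight_poly 1 (cone_forms [P, Z, Z] bs)) (weight_poly 1 (cone_forms [Z, P, Z] bs)))
       (mult2 (weight_poly 1 (cone_forms [P, P, P] bs)) (weight_poly 1 (cone_forms [P, P, N] bs))))"

text \<open>The elliptic quadric a b + c^2 + d^2 = 0 has the ten points (1, 0, 0, 0), (0, 1, 0, 0),
  (1, -1, c, 0), (1, -1, 0, d) and (1, 1, c, d) with c and d in {1, -1}. The points (1, -1, c, 0)
  and (1, -1, 0, d) form two pairs with values k + u and k - u; the last four points form the
  quadruple of the next definition.\<close>

definition pair_forms :: "trit list \<Rightarrow> trit list list \<Rightarrow> trit list list" where
  "pair_forms co bs = [P # form_comb co bs, N # form_comb co bs]"

definition quadruple_forms :: "trit list \<Rightarrow> trit list list \<Rightarrow> trit list list" where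
  "quadruple_forms co bs = map (\<lambda>u. u @ form_comb co bs) [[P, P, P], [P, N, N], [N, P, N], [N, N, P]]"

definition elliptic_pattern :: "trit list list \<Rightarrow> int list list" where
  "elliptic_pattern bs = smult2 (zero_count [form_comb [P, Z, Z, Z] bs, form_comb [Z, P, Z, Z] bs])
     (mult2 (mult2 (weight_poly 1 (pair_forms [Z, Z, P, Z] bs)) (weight_poly 1 (pair_forms [Z, Z, Z, P] bs)))
       (weight_poly 3 (quadruple_forms [N, N, P, P] bs)))"

definition plane_poly :: "int list list" where
  "plane_poly = pattern_sum plane_pattern 3 0 []"

definition grid_poly :: "int list list" where
  "grid_poly = pattern_sum grid_pattern 3 0 []"

definition cone_poly :: "int list list" where
  "cone_poly = pattern_sum cone_pattern 4 0 []"

definition elliptic_poly :: "int list list" where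
  "elliptic_poly = pattern_sum elliptic_pattern 4 0 []"

text \<open>The coefficients of \<open>x ^ j\<close> in \<open>W(x, 1, T)\<close>, as polynomials in \<open>T\<close>.\<close>

definition veronese_coeffs :: "(nat \<times> int list) list" where
  "veronese_coeffs =
    [(0, [17570358, - 35235486, 25714260, - 10395540, 2840265, - 571428, 86580, - 9750, 780, - 40, 1]),
     (1, [- 135457920, 264064320, - 182145600, 67311360, - 16236480, 2778360, - 341640, 29120, - 1560, 40]),
     (2, [442386360, - 837135000, 543263760, - 181537200, 37872900, - 5323500, 500760, - 28860, 780]),
     (3, [- 782421120, 1434438720, - 870367680, 259038000, - 45321120, 4942080, - 318240, 9360]),
     (4, [782707380, - 1385857200, 778590540, - 201375720, 27967550, - 2100540, 67860, 130]),
     (5, [- 398792160, 676767312, - 344316960, 73022040, - 6893640, 208728, 4680]),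
     (6, [47195460, - 71456580, 26156520, - 1389960, - 568620, 63180]),
     (7, [28080000, - 46537920, 22276800, - 4071600, 249600, 3120]),
     (8, [8102835, - 13330980, 6339060, - 1200420, 89505]),
     (9, [- 9097920, 13646880, - 5054400, 505440]),
     (10, [- 850824, 1412424, - 655200, 93600]),
     (12, [568620, - 758160, 189540]),
     (13, [35360, - 53040, 18720, - 1080, 40]),
     (14, [- 29160, 42120, - 14040, 1080]),
     (16, [3510, - 8190, 4680]),
     (22, [- 780, 780]),
     (40, [1])]"

definition veronese_term :: "nat \<times> int list \<Rightarrow> int list list" where
  "veronese_term jc = smult2 (replicate (fst jc) 0 @ [1]) (map (\<lambda>c. [c]) (snd jc))"

definition veronese_poly :: "int list list" where
  "veronese_poly = sum2 (map veronese_term veronese_coeffs)"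

text \<open>A leading \<open>[]\<close> multiplies by T. Each factor T stands for a coefficient that
  the sum does not depend on: two for the cone, and one for the other summands after the
  normalization in \<open>plane_pattern\<close>.\<close>

definition quadric_sum_poly :: "int list list" where
  "quadric_sum_poly = [] # add2 plane_poly
     (add2 ([] # smult2 [18720] cone_poly)
     (add2 (smult2 [21060] grid_poly) (smult2 [16848] elliptic_poly)))"

text \<open>The functional equation for the candidate: its value at 3 T minus its value at T is the
  total over all nonzero quadratic forms. Both sides are closed lists of integers, so evaluation
  decides the claim.\<close>

lemma veronese_poly_dilate:
  "zero2 (add2 (dilate2 3 veronese_poly) (smult2 [- 1] (add2 veronese_poly quadric_sum_poly)))"
  by code_simp

lemma list_sum_3: "list_sum B 3 \<Phi> [] = (\<Sum>a\<in>B. \<Sum>b\<in>B. \<Sum>c\<in>B. \<Phi> [a, b, c])"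
  by (simp only: numeral_3_eq_3 list_sum.simps append.simps)

lemma list_sum_4: "list_sum B 4 \<Phi> [] = (\<Sum>a\<in>B. \<Sum>b\<in>B. \<Sum>c\<in>B. \<Sum>d\<in>B. \<Phi> [a, b, c, d])"
proof -
  have "4 = Suc (Suc (Suc (Suc 0)))" by simp
  thus ?thesis by (simp only: list_sum.simps append.simps)
qed

section \<open>The pattern polynomials as sums over the group\<close>

context ternary_group
begin

text \<open>Since \<open>form_add\<close> cuts off at the shorter list, \<open>form_comb\<close>
  ends with the last summand itself rather than with an empty sum \<open>[]\<close>; this keeps the
  length.\<close>

lemma length_form_comb:
  assumes "length co = length bs" "bs \<noteq> []" "\<forall>b\<in>set bs. length b = k"
  shows "length (form_comb co bs) = k"
  using assms
proof (induction bs arbitrary: co)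
  case (Cons b bs)
  then obtain c cs where co: "co = c # cs" "length cs = length bs" by (cases co) auto
  show ?case
  proof (cases cs)
    case Nil
    thus ?thesis using Cons.prems co by simp
  next
    case (Cons d ds)
    hence "bs \<noteq> []" using co by auto
    hence "length (form_comb cs bs) = k"
      using co Cons.IH[of cs] Cons.prems by simp
    thus ?thesis using co Cons Cons.prems by simp
  qed
qed simp

lemma form_val_comb:
  assumes "length co = length bs" "bs \<noteq> []" "\<forall>b\<in>set bs. length b = length vs"
  shows "form_val (form_comb co bs) vs = form_val co (map (\<lambda>b. form_val b (vs :: 'v list)) bs)"
  using assms
proof (induction bs arbitrary: co)
  case (Cons b bs)
  then obtain c cs where co: "co = c # cs" "length cs = length bs" by (cases co) auto
  show ?case
  proof (cases cs)
    case Nil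
    thus ?thesis using Cons.prems co by (simp add: form_val_smult)
  next
    case (Cons d ds)
    hence "bs \<noteq> []" using co by auto
    hence "length (form_comb cs bs) = length vs"
      "form_val (form_comb cs bs) vs = form_val cs (map (\<lambda>b. form_val b vs) bs)"
      using co Cons.IH[of cs] Cons.prems length_form_comb[of cs bs] by simp_all
    thus ?thesis using co Cons Cons.prems by (simp add: form_val_add form_val_smult)
  qed
qed simp

lemma eval2_pattern_sum_Nil:
  assumes "\<And>vs bs. indep vs \<Longrightarrow> set vs \<subseteq> A \<Longrightarrow> length bs = n \<Longrightarrow> (\<forall>b\<in>set bs. length b = length vs) \<Longrightarrow>
      eval2 x (of_nat (card A)) (\<phi> bs) = \<Phi> (map (\<lambda>b. form_val b vs) bs)"
  shows "eval2 x (of_nat (card A)) (pattern_sum \<phi> n 0 []) = list_sum A n \<Phi> []"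
  using eval2_pattern_sum[of n x \<phi> \<Phi> "[]" "[]" n] assms by (simp add: indep_def)

definition line_weight :: "'r::comm_ring_1 \<Rightarrow> 'v \<Rightarrow> 'v \<Rightarrow> 'v \<Rightarrow> 'r" where
  "line_weight x b0 b1 b2 =
     weight x b0 * weight x (b0 + b1 + b2) * weight x (b0 - b1 + b2) * weight x b2"

definition plane_weight :: "'r::comm_ring_1 \<Rightarrow> 'v \<Rightarrow> 'v \<Rightarrow> 'v \<Rightarrow> 'v \<Rightarrow> 'v \<Rightarrow> 'v \<Rightarrow> 'r" where
  "plane_weight x b0 b1 b2 c l1 l2 =
     weight x c * weight x (c + l2 + b2) * weight x (c - l2 + b2) *
     weight x (c + l1 + b0) * weight x (c + l1 + l2 + (b0 + b1 + b2)) * weight x (c + l1 - l2 + (b0 - b1 + b2)) *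
     weight x (c - l1 + b0) * weight x (c - l1 + l2 + (b0 - b1 + b2)) * weight x (c - l1 - l2 + (b0 + b1 + b2))"

definition plane_sum :: "'r::comm_ring_1 \<Rightarrow> 'v \<Rightarrow> 'v \<Rightarrow> 'v \<Rightarrow> 'r" where
  "plane_sum x b0 b1 b2 = (\<Sum>l2\<in>A. \<Sum>l1\<in>A. \<Sum>c\<in>A. plane_weight x b0 b1 b2 c l1 l2)"

text \<open>A convolution of line weights: the total over two lines of a ruling whose binary forms
  add up to b.\<close>

definition grid_sum :: "'r::comm_ring_1 \<Rightarrow> 'v \<Rightarrow> 'v \<Rightarrow> 'v \<Rightarrow> 'r" where
  "grid_sum x b0 b1 b2 =
     (\<Sum>m2\<in>A. \<Sum>m1\<in>A. \<Sum>m0\<in>A. line_weight x m0 m1 m2 * line_weight x (b0 - m0) (b1 - m1) (b2 - m2))"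

definition cone_sum :: "'r::comm_ring_1 \<Rightarrow> 'v \<Rightarrow> 'v \<Rightarrow> 'r" where
  "cone_sum x v l = (\<Sum>q\<in>A. weight x q * weight x (q + (v + l)) * weight x (q + (v - l)))"

definition pair_sum :: "'r::comm_ring_1 \<Rightarrow> 'v \<Rightarrow> 'r" where
  "pair_sum x k = (\<Sum>u\<in>A. weight x (k + u) * weight x (k - u))"

definition quadruple_sum :: "'r::comm_ring_1 \<Rightarrow> 'v \<Rightarrow> 'r" where
  "quadruple_sum x r = (\<Sum>w\<in>A. \<Sum>v\<in>A. \<Sum>u\<in>A. weight x (r + u + v + w) * weight x (r + u - v - w) *
     weight x (r - u + v - w) * weight x (r - u - v + w))"

lemma length3E:
  assumes "length bs = 3"
  obtains b0 b1 b2 where "bs = [b0, b1, b2]"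
  using assms by (auto simp: numeral_eq_Suc length_Suc_conv)

lemma length4E:
  assumes "length bs = 4"
  obtains b0 b1 b2 b3 where "bs = [b0, b1, b2, b3]"
  using assms by (auto simp: numeral_eq_Suc length_Suc_conv)

lemma eval1_line_forms:
  assumes "indep vs" "length b0 = length vs" "length b1 = length vs" "length b2 = length vs"
  shows "eval1 x (zero_count (line_forms [b0, b1, b2])) =
    line_weight x (form_val b0 vs) (form_val b1 vs) (form_val b2 (vs :: 'v list))"
  by (subst eval1_zero_count[OF assms(1)])
    (use assms in \<open>auto simp: line_forms_def length_form_comb form_val_comb weight_prod_def
       line_weight_def mult_ac algebra_simps simp del: form_comb.simps\<close>)

lemma eval2_plane_forms:
  assumes "indep vs" "set vs \<subseteq> A" "length b0 = length vs" "length b1 = length vs" "length b2 = length vs"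
  shows "eval2 x (of_nat (card A)) (weight_poly 3 (plane_forms [b0, b1, b2])) =
    plane_sum x (form_val b0 vs) (form_val b1 vs) (form_val b2 vs)"
  by (subst eval2_weight_poly[OF assms(1,2)])
    (use assms in \<open>auto simp: plane_forms_def length_form_comb form_val_comb weight_prod_def
       plane_sum_def plane_weight_def numeral_3_eq_3 algebra_simps simp del: form_comb.simps\<close>)

lemma eval2_grid_forms:
  assumes "indep vs" "set vs \<subseteq> A" "length b0 = length vs" "length b1 = length vs" "length b2 = length vs"
  shows "eval2 x (of_nat (card A)) (weight_poly 3 (grid_forms [b0, b1, b2])) =
    grid_sum x (form_val b0 vs) (form_val b1 vs) (form_val b2 vs)"
  by (subst eval2_weight_poly[OF assms(1,2)])
    (use assms in \<open>auto simp: grid_forms_def length_form_comb form_val_comb weight_prod_def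
       grid_sum_def line_weight_def form_smult_def numeral_3_eq_3 algebra_simps simp del: form_comb.simps\<close>)

lemma eval2_plane_poly:
  "eval2 x (of_nat (card A)) plane_poly = (\<Sum>b0\<in>A. \<Sum>b1\<in>A. \<Sum>b2\<in>A. line_weight x b0 b1 b2 *
     (780 * of_nat (card A) ^ 6 + plane_sum x b0 b1 b2 * (80 * of_nat (card A) ^ 3 + 1560 * plane_sum x b0 b1 b2)))"
proof -
  define \<Phi> where "\<Phi> = (\<lambda>b. line_weight x (b ! 0) (b ! 1) (b ! 2) * (780 * of_nat (card A) ^ 6 +
      plane_sum x (b ! 0) (b ! 1) (b ! 2) * (80 * of_nat (card A) ^ 3 + 1560 * plane_sum x (b ! 0) (b ! 1) (b ! 2))))"
  have "eval2 x (of_nat (card A)) plane_poly = list_sum A 3 \<Phi> []"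
    unfolding plane_poly_def
  proof (intro eval2_pattern_sum_Nil)
    fix vs and bs :: "trit list list"
    assume *: "indep vs" "set vs \<subseteq> A" "length bs = 3" "\<forall>b\<in>set bs. length b = length vs"
    obtain b0 b1 b2 where bs: "bs = [b0, b1, b2]" using length3E[OF *(3)] .
    show "eval2 x (of_nat (card A)) (plane_pattern bs) = \<Phi> (map (\<lambda>b. form_val b vs) bs)"
      using * unfolding bs plane_pattern_def Let_def \<Phi>_def
      by (simp add: eval1_line_forms eval2_plane_forms) (simp add: power_numeral_reduce algebra_simps)
  qed
  thus ?thesis unfolding list_sum_3 by (simp add: \<Phi>_def)
qed

lemma eval2_grid_poly:
  "eval2 x (of_nat (card A)) grid_poly = (\<Sum>b0\<in>A. \<Sum>b1\<in>A. \<Sum>b2\<in>A. grid_sum x b0 b1 b2 * grid_sum x b0 b1 b2)"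
proof -
  define \<Phi> where "\<Phi> = (\<lambda>b. grid_sum x (b ! 0) (b ! 1) (b ! 2) * grid_sum x (b ! 0) (b ! 1) (b ! 2))"
  have "eval2 x (of_nat (card A)) grid_poly = list_sum A 3 \<Phi> []"
    unfolding grid_poly_def
  proof (intro eval2_pattern_sum_Nil)
    fix vs and bs :: "trit list list"
    assume *: "indep vs" "set vs \<subseteq> A" "length bs = 3" "\<forall>b\<in>set bs. length b = length vs"
    obtain b0 b1 b2 where bs: "bs = [b0, b1, b2]" using length3E[OF *(3)] .
    show "eval2 x (of_nat (card A)) (grid_pattern bs) = \<Phi> (map (\<lambda>b. form_val b vs) bs)"
      using * unfolding bs grid_pattern_def Let_def \<Phi>_def by (simp add: eval2_grid_forms)
  qed
  thus ?thesis unfolding list_sum_3 by (simp add: \<Phi>_def)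
qed

lemma eval2_cone_forms:
  assumes "indep vs" "set vs \<subseteq> A" "length co = 3" "length bs = 4" "\<forall>b\<in>set bs. length b = length vs"
  shows "eval2 x (of_nat (card A)) (weight_poly (Suc 0) (cone_forms co bs)) =
    cone_sum x (form_val (bs ! 0) vs) (form_val co (map (\<lambda>b. form_val b vs) (tl bs)))"
proof -
  obtain b0 b1 b2 b3 where bs: "bs = [b0, b1, b2, b3]" using assms length4E by blast
  show ?thesis unfolding bs
  by (subst eval2_weight_poly[OF assms(1,2)])
    (use assms bs in \<open>auto simp: cone_forms_def length_form_comb form_val_comb weight_prod_def
       cone_sum_def form_val_smult mult_ac simp del: form_comb.simps\<close>)
qed

lemma eval2_cone_poly:
  "eval2 x (of_nat (card A)) cone_poly = (\<Sum>v\<in>A. \<Sum>l0\<in>A. \<Sum>l1\<in>A. \<Sum>l2\<in>A. weight x v *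
     (cone_sum x v l0 * cone_sum x v l1 * (cone_sum x v (l0 + l1 + l2) * cone_sum x v (l0 + l1 - l2))))"
proof -
  define \<Phi> where "\<Phi> = (\<lambda>b. weight x (b ! 0) *
     (cone_sum x (b ! 0) (b ! 1) * cone_sum x (b ! 0) (b ! 2) *
      (cone_sum x (b ! 0) (b ! 1 + b ! 2 + b ! 3) * cone_sum x (b ! 0) (b ! 1 + b ! 2 - b ! 3))))"
  have "eval2 x (of_nat (card A)) cone_poly = list_sum A 4 \<Phi> []"
    unfolding cone_poly_def
  proof (intro eval2_pattern_sum_Nil)
    fix vs and bs :: "trit list list"
    assume *: "indep vs" "set vs \<subseteq> A" "length bs = 4" "\<forall>b\<in>set bs. length b = length vs"
    obtain b0 b1 b2 b3 where bs: "bs = [b0, b1, b2, b3]" using length4E[OF *(3)] .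
    have "eval1 x (zero_count [form_comb [P, Z, Z, Z] bs]) = weight x (form_val (bs ! 0) vs)"
      by (subst eval1_zero_count[OF *(1)])
        (use * bs in \<open>auto simp: length_form_comb form_val_comb weight_prod_def simp del: form_comb.simps\<close>)
    thus "eval2 x (of_nat (card A)) (cone_pattern bs) = \<Phi> (map (\<lambda>b. form_val b vs) bs)"
      using * unfolding cone_pattern_def \<Phi>_def
      by (simp add: eval2_cone_forms bs algebra_simps del: zero_count.simps form_comb.simps)
  qed
  thus ?thesis unfolding list_sum_4 by (simp add: \<Phi>_def)
qed

lemma eval2_pair_forms:
  assumes "indep vs" "set vs \<subseteq> A" "length co = length bs" "bs \<noteq> []" "\<forall>b\<in>set bs. length b = length vs"
  shows "eval2 x (of_nat (card A)) (weight_poly (Suc 0) (pair_forms co bs)) =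
    pair_sum x (form_val co (map (\<lambda>b. form_val b vs) bs))"
  by (subst eval2_weight_poly[OF assms(1,2)])
    (use assms in \<open>auto simp: pair_forms_def length_form_comb form_val_comb weight_prod_def
       pair_sum_def algebra_simps simp del: form_comb.simps\<close>)

lemma eval2_quadruple_forms:
  assumes "indep vs" "set vs \<subseteq> A" "length co = length bs" "bs \<noteq> []" "\<forall>b\<in>set bs. length b = length vs"
  shows "eval2 x (of_nat (card A)) (weight_poly 3 (quadruple_forms co bs)) =
    quadruple_sum x (form_val co (map (\<lambda>b. form_val b vs) bs))"
  by (subst eval2_weight_poly[OF assms(1,2)])
    (use assms in \<open>auto simp: quadruple_forms_def length_form_comb form_val_comb weight_prod_def
       quadruple_sum_def numeral_3_eq_3 algebra_simps simp del: form_comb.simps\<close>)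

lemma eval2_elliptic_poly:
  "eval2 x (of_nat (card A)) elliptic_poly = (\<Sum>p\<in>A. \<Sum>q\<in>A. \<Sum>k\<in>A. \<Sum>l\<in>A. weight x p * weight x q *
     (pair_sum x k * pair_sum x l * quadruple_sum x (k + l - p - q)))"
proof -
  define \<Phi> where "\<Phi> = (\<lambda>b. weight x (b ! 0) * weight x (b ! 1) *
     (pair_sum x (b ! 2) * pair_sum x (b ! 3) * quadruple_sum x (b ! 2 + b ! 3 - b ! 0 - b ! 1)))"
  have "eval2 x (of_nat (card A)) elliptic_poly = list_sum A 4 \<Phi> []"
    unfolding elliptic_poly_def
  proof (intro eval2_pattern_sum_Nil)
    fix vs and bs :: "trit list list"
    assume *: "indep vs" "set vs \<subseteq> A" "length bs = 4" "\<forall>b\<in>set bs. length b = length vs"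
    obtain b0 b1 b2 b3 where bs: "bs = [b0, b1, b2, b3]" using length4E[OF *(3)] .
    have ne: "bs \<noteq> []" using * by auto
    have "eval1 x (zero_count [form_comb [P, Z, Z, Z] bs, form_comb [Z, P, Z, Z] bs]) =
        weight x (form_val (bs ! 0) vs) * weight x (form_val (bs ! 1) vs)"
      by (subst eval1_zero_count[OF *(1)])
        (use * bs in \<open>auto simp: length_form_comb form_val_comb weight_prod_def simp del: form_comb.simps\<close>)
    thus "eval2 x (of_nat (card A)) (elliptic_pattern bs) = \<Phi> (map (\<lambda>b. form_val b vs) bs)"
      using * ne unfolding elliptic_pattern_def \<Phi>_def
      by (simp add: eval2_pair_forms eval2_quadruple_forms bs algebra_simps del: zero_count.simps form_comb.simps)
  qed
  thus ?thesis unfolding list_sum_4 by (simp add: \<Phi>_def)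
qed

end

hide_const (open) Z P N

section \<open>Quadratic maps on the four-dimensional ternary space\<close>

lemma three_element_field:
  assumes "CARD('f::field) = 3"
  shows "(UNIV :: 'f set) = {0, 1, - 1}" "(2 :: 'f) = - 1" "(1 :: 'f) \<noteq> - 1"
proof -
  have fin: "finite (UNIV :: 'f set)" using assms by (metis card.infinite zero_neq_numeral)
  have "card (UNIV - {0, 1 :: 'f}) = 1"
    using assms fin by (subst card_Diff_subset) auto
  then obtain a :: 'f where a: "UNIV - {0, 1} = {a}" by (rule card_1_singletonE)
  hence a': "a \<noteq> 0" "a \<noteq> 1" and U: "UNIV = {0, 1, a}" by auto
  have "a + 1 \<in> {0, 1, a}" using U by blast
  hence "a + 1 = 0" using a' by auto
  hence am: "a = - 1" by (simp add: eq_neg_iff_add_eq_0)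
  show U: "(UNIV :: 'f set) = {0, 1, - 1}" and ne: "(1 :: 'f) \<noteq> - 1" using U a' am by auto
  have "(2 :: 'f) \<in> {0, 1, - 1}" using U by blast
  moreover have "(2 :: 'f) \<noteq> 1" by (metis add_cancel_right_right one_add_one zero_neq_one)
  moreover have "(2 :: 'f) \<noteq> 0" using ne by (metis eq_neg_iff_add_eq_0 one_add_one)
  ultimately show "(2 :: 'f) = - 1" by blast
qed

definition qform :: "'f::field \<Rightarrow> 'f \<Rightarrow> 'f \<Rightarrow> 'f \<Rightarrow> 'f \<Rightarrow> 'f \<Rightarrow> 'f \<Rightarrow> 'f \<Rightarrow> 'f \<Rightarrow> 'f \<Rightarrow> 'f \<times> 'f \<times> 'f \<times> 'f \<Rightarrow> 'f" where
  "qform c0 c1 c2 c3 c4 c5 c6 c7 c8 c9 = (\<lambda>(a, b, c, d).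
     a * a * c0 + a * b * c1 + b * b * c2 + a * c * c3 + b * c * c4 + c * c * c5
     + a * d * c6 + b * d * c7 + c * d * c8 + d * d * c9)"

text \<open>Every point of the projective space is counted twice among its nonzero vectors.\<close>

definition zero_points :: "('f::field \<times> 'f \<times> 'f \<times> 'f \<Rightarrow> bool) \<Rightarrow> nat" where
  "zero_points P = card {v. v \<noteq> (0, 0, 0, 0) \<and> P v} div 2"

text \<open>Quadratic maps take values in A. The locale is interpreted with the m-tuples over the
  field as A, and with the field itself, where quadratic maps are quadratic forms.\<close>

locale ternary_space = vector_space scale
  for scale :: "'f::field \<Rightarrow> 'v::ab_group_add \<Rightarrow> 'v" (infixr \<open>*s\<close> 75) +
  fixes A :: "'v set"
  assumes card_field: "CARD('f) = 3" and finite_space: "finite A" and subspace_A: "subspace A"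
begin

lemma two_eq [simp]: "(2 :: 'f) = - 1"
  and one_neq [simp]: "(1 :: 'f) \<noteq> - 1" "- 1 \<noteq> (1 :: 'f)"
  and UNIV_field: "(UNIV :: 'f set) = {0, 1, - 1}"
  using three_element_field[OF card_field] by auto

lemma finite_field [simp]: "finite (UNIV :: 'f set)"
  unfolding UNIV_field by simp

lemma field_cases: obtains "k = (0::'f)" | "k = 1" | "k = - 1"
  using UNIV_field by blast

lemma double_field [simp]: "k + k = - (k :: 'f)" "k + (k + l) = l - (k :: 'f)"
  and three_field: "(3 :: 'f) = 0"
proof -
  show *: "k + k = - k" for k :: 'f
    using mult_2[of k] by simp
  show "k + (k + l) = l - k" using *[of k] by (simp add: add.assoc[symmetric] del: add.assoc)
  have "(3 :: 'f) = 2 + 1" by (simp del: two_eq)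
  thus "(3 :: 'f) = 0" by (simp only: two_eq add.left_inverse)
qed

lemma sum_field: "(\<Sum>k\<in>(UNIV :: 'f set). g k) = g 0 + g 1 + (g (- 1) :: 'r::comm_monoid_add)"
  unfolding UNIV_field by (simp add: add_ac)

lemma prod_field: "(\<Prod>k\<in>(UNIV :: 'f set). g k) = g 0 * g 1 * (g (- 1) :: 'r::comm_monoid_mult)"
  unfolding UNIV_field by (simp add: mult_ac)

sublocale ternary_group A
proof
  show "a + a + a = 0" for a :: 'v
  proof -
    have "(1 + 1 + 1 :: 'f) *s a = 0" using three_field by simp
    thus ?thesis by (simp only: scale_left_distrib scale_one)
  qed
qed (use finite_space subspace_A in \<open>auto intro: subspace_0 subspace_add subspace_neg\<close>)

definition qmap :: "'v \<Rightarrow> 'v \<Rightarrow> 'v \<Rightarrow> 'v \<Rightarrow> 'v \<Rightarrow> 'v \<Rightarrow> 'v \<Rightarrow> 'v \<Rightarrow> 'v \<Rightarrow> 'v \<Rightarrow> 'f \<times> 'f \<times> 'f \<times> 'f \<Rightarrow> 'v" where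
  "qmap c0 c1 c2 c3 c4 c5 c6 c7 c8 c9 = (\<lambda>(a, b, c, d).
     (a * a) *s c0 + (a * b) *s c1 + (b * b) *s c2 + (a * c) *s c3 + (b * c) *s c4 + (c * c) *s c5
     + (a * d) *s c6 + (b * d) *s c7 + (c * d) *s c8 + (d * d) *s c9)"

text \<open>The order of the coefficients is adapted to the planes a = 0 and b = 0: the binary form
  on their common line comes first, then the coefficient of a b, which vanishes on both, then the
  coefficients belonging to each plane alone.\<close>

definition qmaps :: "('f \<times> 'f \<times> 'f \<times> 'f \<Rightarrow> 'v) set" where
  "qmaps = (\<lambda>(c5, c8, c9, c1, c7, c4, c2, c6, c3, c0). qmap c0 c1 c2 c3 c4 c5 c6 c7 c8 c9) `
     (A \<times> A \<times> A \<times> A \<times> A \<times> A \<times> A \<times> A \<times> A \<times> A)"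

lemma qmap_in_qmaps:
  "\<lbrakk>c0 \<in> A; c1 \<in> A; c2 \<in> A; c3 \<in> A; c4 \<in> A; c5 \<in> A; c6 \<in> A; c7 \<in> A; c8 \<in> A; c9 \<in> A\<rbrakk>
    \<Longrightarrow> qmap c0 c1 c2 c3 c4 c5 c6 c7 c8 c9 \<in> qmaps"
  unfolding qmaps_def by (rule image_eqI[of _ _ "(c5, c8, c9, c1, c7, c4, c2, c6, c3, c0)"]) auto

lemma qmapsE:
  assumes "f \<in> qmaps"
  obtains c0 c1 c2 c3 c4 c5 c6 c7 c8 c9 where "f = qmap c0 c1 c2 c3 c4 c5 c6 c7 c8 c9"
    "c0 \<in> A" "c1 \<in> A" "c2 \<in> A" "c3 \<in> A" "c4 \<in> A" "c5 \<in> A" "c6 \<in> A" "c7 \<in> A" "c8 \<in> A" "c9 \<in> A"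
  using assms unfolding qmaps_def by auto

lemma finite_qmaps: "finite qmaps"
  unfolding qmaps_def by (intro finite_imageI finite_cartesian_product finite_A)

text \<open>The unit vectors give the coefficients of the squares, and the sums of two unit vectors
  then give the mixed ones.\<close>

lemma qmap_inject:
  assumes "qmap c0 c1 c2 c3 c4 c5 c6 c7 c8 c9 = qmap d0 d1 d2 d3 d4 d5 d6 d7 d8 d9"
  shows "c0 = d0" "c1 = d1" "c2 = d2" "c3 = d3" "c4 = d4" "c5 = d5" "c6 = d6" "c7 = d7" "c8 = d8" "c9 = d9"
proof -
  note ev = fun_cong[OF assms]
  show *: "c0 = d0" "c2 = d2" "c5 = d5" "c9 = d9"
    using ev[of "(1, 0, 0, 0)"] ev[of "(0, 1, 0, 0)"] ev[of "(0, 0, 1, 0)"] ev[of "(0, 0, 0, 1)"]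
    by (simp_all add: qmap_def)
  show "c1 = d1" "c3 = d3" "c4 = d4" "c6 = d6" "c7 = d7" "c8 = d8"
    using ev[of "(1, 1, 0, 0)"] ev[of "(1, 0, 1, 0)"] ev[of "(0, 1, 1, 0)"]
      ev[of "(1, 0, 0, 1)"] ev[of "(0, 1, 0, 1)"] ev[of "(0, 0, 1, 1)"]
    by (simp_all add: qmap_def *)
qed

lemma sum_qmaps:
  "(\<Sum>f\<in>qmaps. g f :: 'r::comm_monoid_add) =
    (\<Sum>c5\<in>A. \<Sum>c8\<in>A. \<Sum>c9\<in>A. \<Sum>c1\<in>A. \<Sum>c7\<in>A. \<Sum>c4\<in>A. \<Sum>c2\<in>A. \<Sum>c6\<in>A. \<Sum>c3\<in>A. \<Sum>c0\<in>A.
       g (qmap c0 c1 c2 c3 c4 c5 c6 c7 c8 c9))"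
proof -
  have "inj_on (\<lambda>(c5, c8, c9, c1, c7, c4, c2, c6, c3, c0). qmap c0 c1 c2 c3 c4 c5 c6 c7 c8 c9)
      (A \<times> A \<times> A \<times> A \<times> A \<times> A \<times> A \<times> A \<times> A \<times> A)"
    unfolding inj_on_def by (auto dest: qmap_inject)
  thus ?thesis
    unfolding qmaps_def by (simp add: sum.reindex sum.cartesian_product case_prod_unfold)
qed

definition wt :: "'r::comm_ring_1 \<Rightarrow> ('f \<times> 'f \<times> 'f \<times> 'f \<Rightarrow> 'f) \<Rightarrow> 'r" where
  "wt x Q = (\<Sum>f\<in>qmaps. x ^ zero_points (\<lambda>v. Q v = 0 \<and> f v = 0))"

subsection \<open>Invariance under linear substitutions\<close>

text \<open>Linearity enters only through the closure of \<open>qmaps\<close> under composition. An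
  inclusion is enough, because \<open>qmaps\<close> is finite and composition with a bijection is
  injective.\<close>

definition substitution :: "('f \<times> 'f \<times> 'f \<times> 'f \<Rightarrow> 'f \<times> 'f \<times> 'f \<times> 'f) \<Rightarrow> bool" where
  "substitution g \<longleftrightarrow> bij g \<and> g (0, 0, 0, 0) = (0, 0, 0, 0) \<and> (\<forall>f\<in>qmaps. f \<circ> g \<in> qmaps)"

lemma substitution_comp: "substitution g \<Longrightarrow> substitution h \<Longrightarrow> substitution (g \<circ> h)"
  unfolding substitution_def by (auto simp: bij_comp comp_assoc[symmetric])

lemma wt_substitution:
  assumes "substitution g"
  shows "wt x (Q \<circ> g) = wt x Q"
proof -
  have bij: "bij g" and g0: "g (0, 0, 0, 0) = (0, 0, 0, 0)" and cl: "\<And>f. f \<in> qmaps \<Longrightarrow> f \<circ> g \<in> qmaps"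
    using assms unfolding substitution_def by auto
  have inj: "inj_on (\<lambda>f. f \<circ> g) qmaps"
  proof (rule inj_onI)
    fix f h assume "f \<circ> g = h \<circ> g"
    hence "f \<circ> (g \<circ> inv_into UNIV g) = h \<circ> (g \<circ> inv_into UNIV g)" by (simp only: o_assoc)
    moreover have "g \<circ> inv_into UNIV g = id" using bij_is_surj[OF bij] by (simp only: surj_iff)
    ultimately show "f = h" by (simp only: o_id)
  qed
  have im: "(\<lambda>f. f \<circ> g) ` qmaps = qmaps"
    by (rule endo_inj_surj[OF finite_qmaps _ inj]) (use cl in auto)
  have zp: "zero_points (\<lambda>v. P (g v)) = zero_points P" for P
  proof -
    have "g ` {v. v \<noteq> (0, 0, 0, 0) \<and> P (g v)} = {v. v \<noteq> (0, 0, 0, 0) \<and> P v}"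
    proof (intro equalityI subsetI)
      fix v assume "v \<in> g ` {v. v \<noteq> (0, 0, 0, 0) \<and> P (g v)}"
      then obtain u where u: "v = g u" "u \<noteq> (0, 0, 0, 0)" "P (g u)" by blast
      hence "g u \<noteq> g (0, 0, 0, 0)" using injD[OF bij_is_inj[OF bij]] by blast
      thus "v \<in> {v. v \<noteq> (0, 0, 0, 0) \<and> P v}" using u g0 by simp
    next
      fix v assume v: "v \<in> {v. v \<noteq> (0, 0, 0, 0) \<and> P v}"
      obtain u where "v = g u" using bij by (metis bij_pointE)
      moreover from this have "u \<noteq> (0, 0, 0, 0)" using v g0 by blast
      ultimately show "v \<in> g ` {v. v \<noteq> (0, 0, 0, 0) \<and> P (g v)}" using v by blast
    qed
    from card_image[OF inj_on_subset[OF bij_is_inj[OF bij] subset_UNIV], of "{v. v \<noteq> (0, 0, 0, 0) \<and> P (g v)}",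
        unfolded this]
    show ?thesis unfolding zero_points_def by (simp only:)
  qed
  have "wt x (Q \<circ> g) = (\<Sum>f\<in>(\<lambda>f. f \<circ> g) ` qmaps. x ^ zero_points (\<lambda>v. (Q \<circ> g) v = 0 \<and> f v = 0))"
    unfolding wt_def im ..
  also have "\<dots> = (\<Sum>f\<in>qmaps. x ^ zero_points (\<lambda>v. Q (g v) = 0 \<and> f (g v) = 0))"
    by (subst sum.reindex[OF inj]) simp
  also have "\<dots> = wt x Q"
    unfolding wt_def by (intro sum.cong refl arg_cong2[where f = power] zp)
  finally show ?thesis .
qed

lemma substitutionI:
  assumes "inj g" "g (0, 0, 0, 0) = (0, 0, 0, 0)"
    and "\<And>c0 c1 c2 c3 c4 c5 c6 c7 c8 c9. \<lbrakk>c0 \<in> A; c1 \<in> A; c2 \<in> A; c3 \<in> A; c4 \<in> A; c5 \<in> A; c6 \<in> A; c7 \<in> A;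
      c8 \<in> A; c9 \<in> A\<rbrakk> \<Longrightarrow> qmap c0 c1 c2 c3 c4 c5 c6 c7 c8 c9 \<circ> g \<in> qmaps"
  shows "substitution g"
proof -
  have "finite (UNIV :: ('f \<times> 'f \<times> 'f \<times> 'f) set)"
    unfolding UNIV_Times_UNIV[symmetric] by (intro finite_cartesian_product finite_field)
  hence "bij g" using assms(1) finite_UNIV_inj_surj bijI by blast
  thus ?thesis unfolding substitution_def using assms(2,3) by (auto elim!: qmapsE)
qed

lemmas in_A = zero_in add_in minus_in subspace_scale[OF subspace_A]

lemma substitution_row:
  assumes "p \<noteq> 0"
  shows "substitution (\<lambda>(a, b, c, d). (p * a + k * b + l * c + m * d, b, c, d))" (is "substitution ?g")
proof (rule substitutionI)
  show "inj ?g" using assms by (auto simp: inj_on_def)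
  fix c0 c1 c2 c3 c4 c5 c6 c7 c8 c9
  assume c: "c0 \<in> A" "c1 \<in> A" "c2 \<in> A" "c3 \<in> A" "c4 \<in> A" "c5 \<in> A" "c6 \<in> A" "c7 \<in> A" "c8 \<in> A" "c9 \<in> A"
  have "qmap c0 c1 c2 c3 c4 c5 c6 c7 c8 c9 \<circ> ?g =
    qmap ((p * p) *s c0) (p *s c1 + (p * k + p * k) *s c0) (c2 + (k * k) *s c0 + k *s c1)
      (p *s c3 + (p * l + p * l) *s c0) (c4 + (k * l + k * l) *s c0 + k *s c3 + l *s c1)
      (c5 + (l * l) *s c0 + l *s c3)
      (p *s c6 + (p * m + p * m) *s c0) (c7 + (k * m + k * m) *s c0 + k *s c6 + m *s c1)
      (c8 + (l * m + l * m) *s c0 + l *s c6 + m *s c3) (c9 + (m * m) *s c0 + m *s c6)"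
    by (rule ext) (simp only: qmap_def o_def split_paired_all split scale_scale scale_left_distrib
      scale_right_distrib distrib_left distrib_right add_ac mult_ac)
  also have "\<dots> \<in> qmaps" by (intro qmap_in_qmaps in_A c)
  finally show "qmap c0 c1 c2 c3 c4 c5 c6 c7 c8 c9 \<circ> ?g \<in> qmaps" .
qed simp

lemma substitution_swap:
  "substitution (\<lambda>(a, b, c, d). (b, a, c, d))" "substitution (\<lambda>(a, b, c, d). (a, c, b, d))"
  "substitution (\<lambda>(a, b, c, d). (a, b, d, c))"
proof -
  have "qmap c0 c1 c2 c3 c4 c5 c6 c7 c8 c9 \<circ> (\<lambda>(a, b, c, d). (b, a, c, d)) = qmap c2 c1 c0 c4 c3 c5 c7 c6 c8 c9"
    "qmap c0 c1 c2 c3 c4 c5 c6 c7 c8 c9 \<circ> (\<lambda>(a, b, c, d). (a, c, b, d)) = qmap c0 c3 c5 c1 c4 c2 c6 c8 c7 c9"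
    "qmap c0 c1 c2 c3 c4 c5 c6 c7 c8 c9 \<circ> (\<lambda>(a, b, c, d). (a, b, d, c)) = qmap c0 c1 c2 c6 c7 c9 c3 c4 c8 c5"
    for c0 c1 c2 c3 c4 c5 c6 c7 c8 c9 by (auto simp: qmap_def fun_eq_iff algebra_simps)
  thus "substitution (\<lambda>(a, b, c, d). (b, a, c, d))" "substitution (\<lambda>(a, b, c, d). (a, c, b, d))"
    "substitution (\<lambda>(a, b, c, d). (a, b, d, c))"
    by (auto intro!: substitutionI qmap_in_qmaps simp: inj_on_def)
qed

lemma substitution_row2:
  assumes "p \<noteq> 0"
  shows "substitution (\<lambda>(a, b, c, d). (a, p * b + k * a + l * c + m * d, c, d))"
proof -
  have "(\<lambda>(a, b, c, d). (a, p * b + k * a + l * c + m * d, c, d)) =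
     (\<lambda>(a, b, c, d). (b, a, c, d)) \<circ> (\<lambda>(a, b, c, d). (p * a + k * b + l * c + m * d, b, c, d)) \<circ> (\<lambda>(a, b, c, d). (b, a, c, d))"
    by (auto simp: fun_eq_iff)
  thus ?thesis using substitution_comp[OF substitution_comp[OF substitution_swap(1) substitution_row[OF assms]] substitution_swap(1)]
    by simp
qed

lemma substitution_row3:
  assumes "p \<noteq> 0"
  shows "substitution (\<lambda>(a, b, c, d). (a, b, p * c + m * d, d))"
proof -
  have "(\<lambda>(a, b, c, d). (a, b, p * c + m * d, d)) =
     (\<lambda>(a, b, c, d). (a, c, b, d)) \<circ> (\<lambda>(a, b, c, d). (a, p * b + 0 * a + 0 * c + m * d, c, d)) \<circ> (\<lambda>(a, b, c, d). (a, c, b, d))"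
    by (auto simp: fun_eq_iff)
  thus ?thesis using substitution_comp[OF substitution_comp[OF substitution_swap(2) substitution_row2[OF assms, of 0 0 m]] substitution_swap(2)]
    by simp
qed

end

context ternary_space
begin

subsection \<open>Classification of quadratic forms\<close>

definition wq :: "'r::comm_ring_1 \<Rightarrow> 'f \<Rightarrow> 'f \<Rightarrow> 'f \<Rightarrow> 'f \<Rightarrow> 'f \<Rightarrow> 'f \<Rightarrow> 'f \<Rightarrow> 'f \<Rightarrow> 'f \<Rightarrow> 'f \<Rightarrow> 'r" where
  "wq x c0 c1 c2 c3 c4 c5 c6 c7 c8 c9 = wt x (qform c0 c1 c2 c3 c4 c5 c6 c7 c8 c9)"

lemma wq_eqI:
  assumes "substitution g" "\<And>a b c d. qform c0 c1 c2 c3 c4 c5 c6 c7 c8 c9 (a, b, c, d) =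
    qform d0 d1 d2 d3 d4 d5 d6 d7 d8 d9 (g (a, b, c, d))"
  shows "wq x c0 c1 c2 c3 c4 c5 c6 c7 c8 c9 = wq x d0 d1 d2 d3 d4 d5 d6 d7 d8 d9"
proof -
  have "qform c0 c1 c2 c3 c4 c5 c6 c7 c8 c9 = qform d0 d1 d2 d3 d4 d5 d6 d7 d8 d9 \<circ> g"
    using assms(2) by (auto simp: fun_eq_iff)
  thus ?thesis unfolding wq_def using wt_substitution[OF assms(1)] by simp
qed

text \<open>Completing the square in the first variable. In this field 1 / 2 = -1 and 1 / k = k, so
  the shift belonging to a mixed coefficient l is - k l.\<close>

lemma wq_square:
  assumes "k \<noteq> 0"
  shows "wq x k l1 c2 l2 c4 c5 l3 c7 c8 c9 =
    wq x k 0 (c2 - k * l1 * l1) 0 (c4 + k * l1 * l2) (c5 - k * l2 * l2) 0 (c7 + k * l1 * l3)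
      (c8 + k * l2 * l3) (c9 - k * l3 * l3)"
proof (rule wq_eqI[OF substitution_row[of 1 "- k * l1" "- k * l2" "- k * l3"]])
  show "qform k l1 c2 l2 c4 c5 l3 c7 c8 c9 (a, b, c, d) =
    qform k 0 (c2 - k * l1 * l1) 0 (c4 + k * l1 * l2) (c5 - k * l2 * l2) 0 (c7 + k * l1 * l3)
      (c8 + k * l2 * l3) (c9 - k * l3 * l3)
      (case (a, b, c, d) of (a, b, c, d) \<Rightarrow> (1 * a + (- k * l1) * b + (- k * l2) * c + (- k * l3) * d, b, c, d))"
    for a b c d using assms by (cases k rule: field_cases) (simp_all add: qform_def algebra_simps)
qed simp

lemma wq_square2:
  assumes "k \<noteq> 0"
  shows "wq x c0 0 k 0 l2 c5 0 l3 c8 c9 = wq x c0 0 k 0 0 (c5 - k * l2 * l2) 0 0 (c8 + k * l2 * l3) (c9 - k * l3 * l3)"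
proof (rule wq_eqI[OF substitution_row2[of 1 0 "- k * l2" "- k * l3"]])
  show "qform c0 0 k 0 l2 c5 0 l3 c8 c9 (a, b, c, d) =
    qform c0 0 k 0 0 (c5 - k * l2 * l2) 0 0 (c8 + k * l2 * l3) (c9 - k * l3 * l3)
      (case (a, b, c, d) of (a, b, c, d) \<Rightarrow> (a, 1 * b + 0 * a + (- k * l2) * c + (- k * l3) * d, c, d))"
    for a b c d using assms by (cases k rule: field_cases) (simp_all add: qform_def algebra_simps)
qed simp

lemma wq_square3:
  assumes "k \<noteq> 0"
  shows "wq x c0 c1 c2 0 0 k 0 0 l c9 = wq x c0 c1 c2 0 0 k 0 0 0 (c9 - k * l * l)"
proof (rule wq_eqI[OF substitution_row3[of 1 "- k * l"]])
  show "qform c0 c1 c2 0 0 k 0 0 l c9 (a, b, c, d) = qform c0 c1 c2 0 0 k 0 0 0 (c9 - k * l * l)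
      (case (a, b, c, d) of (a, b, c, d) \<Rightarrow> (a, b, 1 * c + (- k * l) * d, d))"
    for a b c d using assms by (cases k rule: field_cases) (simp_all add: qform_def algebra_simps)
qed simp

text \<open>All terms divisible by b are b times one linear form, which is taken as the new first
  variable.\<close>

lemma wq_hyperbolic: "wq x 0 1 c2 0 c4 c5 0 c7 c8 c9 = wq x 0 1 0 0 0 c5 0 0 c8 c9"
  by (rule wq_eqI[OF substitution_row[of 1 c2 c4 c7]]) (simp_all add: qform_def algebra_simps)

lemma wq_hyperbolic2: "wq x c0 0 0 0 1 c5 0 0 c8 c9 = wq x c0 0 0 0 1 0 0 0 0 c9"
  by (rule wq_eqI[OF substitution_row2[of 1 0 c5 c8]]) (simp_all add: qform_def algebra_simps)

lemma wq_hyperbolic3: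
  assumes "k \<noteq> 0"
  shows "wq x c0 c1 c2 0 0 0 0 0 k c9 = wq x c0 c1 c2 0 0 0 0 0 1 0"
  by (rule wq_eqI[OF substitution_row3[of k c9]]) (use assms in \<open>simp_all add: qform_def algebra_simps\<close>)

text \<open>From right to left this turns the cofactor k b + l c + m d of a into b. The substitution
  k b - k l c - k m d for b inverts that linear form, because k k = 1.\<close>

lemma wq_row2:
  assumes "k \<noteq> 0"
  shows "wq x 0 1 c2 0 c4 c5 0 c7 c8 c9 = wq x 0 k c2 l (k * c4 + k * l * c2 + k * l * c2) (c5 + l * l * c2 + l * c4)
      m (k * c7 + k * m * c2 + k * m * c2) (c8 + l * m * c2 + l * m * c2 + m * c4 + l * c7) (c9 + m * m * c2 + m * c7)"
    (is "?l = ?r")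
proof -
  have "?r = ?l"
  proof (rule sym, rule wq_eqI)
    show "substitution (\<lambda>(a, b, c, d). (a, k * b + 0 * a + (- k * l) * c + (- k * m) * d, c, d))"
      by (rule substitution_row2[OF assms])
    show "qform 0 1 c2 0 c4 c5 0 c7 c8 c9 (a, b, c, d) =
      qform 0 k c2 l (k * c4 + k * l * c2 + k * l * c2) (c5 + l * l * c2 + l * c4)
      m (k * c7 + k * m * c2 + k * m * c2) (c8 + l * m * c2 + l * m * c2 + m * c4 + l * c7) (c9 + m * m * c2 + m * c7)
      (case (a, b, c, d) of (a, b, c, d) \<Rightarrow> (a, k * b + 0 * a + (- k * l) * c + (- k * m) * d, c, d))" for a b c d
      using assms by (cases k rule: field_cases) (simp_all add: qform_def algebra_simps)
  qed
  thus ?thesis by simp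
qed

lemma wq_row3:
  assumes "k \<noteq> 0"
  shows "wq x c0 0 0 0 1 c5 0 0 c8 c9 = wq x c0 0 0 0 k c5 0 m (k * c8 + k * m * c5 + k * m * c5) (c9 + m * m * c5 + m * c8)"
    (is "?l = ?r")
proof (rule wq_eqI)
  show "substitution (\<lambda>(a, b, c, d). (a, b, k * c + (- k * m) * d, d))"
    by (rule substitution_row3[OF assms])
  show "qform c0 0 0 0 1 c5 0 0 c8 c9 (a, b, c, d) =
    qform c0 0 0 0 k c5 0 m (k * c8 + k * m * c5 + k * m * c5) (c9 + m * m * c5 + m * c8)
    (case (a, b, c, d) of (a, b, c, d) \<Rightarrow> (a, b, k * c + (- k * m) * d, d))" for a b c d
    using assms by (cases k rule: field_cases) (simp_all add: qform_def algebra_simps)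
qed

lemma wq_swap:
  "wq x c0 c1 c2 c3 c4 c5 c6 c7 c8 c9 = wq x c2 c1 c0 c4 c3 c5 c7 c6 c8 c9"
  "wq x c0 c1 c2 c3 c4 c5 c6 c7 c8 c9 = wq x c0 c3 c5 c1 c4 c2 c6 c8 c7 c9"
  "wq x c0 c1 c2 c3 c4 c5 c6 c7 c8 c9 = wq x c0 c1 c2 c6 c7 c9 c3 c4 c8 c5"
  by (rule wq_eqI, rule substitution_swap, simp add: qform_def algebra_simps)+

lemma wq_neg: "wq x (- c0) (- c1) (- c2) (- c3) (- c4) (- c5) (- c6) (- c7) (- c8) (- c9) =
    wq x c0 c1 c2 c3 c4 c5 c6 c7 c8 c9"
proof -
  have "qform (- c0) (- c1) (- c2) (- c3) (- c4) (- c5) (- c6) (- c7) (- c8) (- c9) v =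
      - qform c0 c1 c2 c3 c4 c5 c6 c7 c8 c9 v" for v
    by (cases v) (simp add: qform_def)
  thus ?thesis unfolding wq_def wt_def by simp
qed

text \<open>Used for two identities: (a + b)^2 + (a - b)^2 = - (a^2 + b^2), which swaps two signs in
  a diagonal form, and (a + b) (a - b) = a^2 - b^2, which makes a hyperbolic pair diagonal.\<close>

lemma substitution_rotate: "substitution (\<lambda>(a, b, c, d). (a + b, a - b, c, d))"
proof -
  have "(\<lambda>(a :: 'f, b, c :: 'f, d :: 'f). (a + b, a - b, c, d)) =
      (\<lambda>(a, b, c, d). (a, 1 * b + 1 * a + 0 * c + 0 * d, c, d)) \<circ> (\<lambda>(a, b, c, d). (1 * a + 1 * b + 0 * c + 0 * d, b, c, d))"
    by (auto simp: fun_eq_iff algebra_simps)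
  thus ?thesis using substitution_comp[OF substitution_row2[of 1 1 0 0] substitution_row[of 1 1 0 0]] by simp
qed

lemma wq_diag_neg: "wq x 1 0 1 0 0 c5 0 0 c8 c9 = wq x (- 1) 0 (- 1) 0 0 c5 0 0 c8 c9"
proof (rule wq_eqI[OF substitution_rotate])
  show "qform 1 0 1 0 0 c5 0 0 c8 c9 (a, b, c, d) = qform (- 1) 0 (- 1) 0 0 c5 0 0 c8 c9
    (case (a, b, c, d) of (a, b, c, d) \<Rightarrow> (a + b, a - b, c, d))" for a b c d
    by (simp add: qform_def algebra_simps)
qed

lemma wq_hyperbolic_diag: "wq x 0 1 0 0 0 c5 0 0 c8 c9 = wq x 1 0 (- 1) 0 0 c5 0 0 c8 c9"
  by (rule sym, rule wq_eqI[OF substitution_rotate]) (simp add: qform_def algebra_simps)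


section \<open>Summation over all quadratic forms, one variable at a time\<close>

lemma card_triples: "card (UNIV :: ('f \<times> 'f \<times> 'f) set) = 27"
  and card_pairs: "card (UNIV :: ('f \<times> 'f) set) = 9"
  by (simp_all add: card_prod card_field)

lemma finite_triples [simp]: "finite (UNIV :: ('f \<times> 'f \<times> 'f) set)" "finite (UNIV :: ('f \<times> 'f) set)"
  by (simp_all add: finite_prod)

lemma sum_triples: "(\<Sum>(k, p, q)\<in>UNIV. f k p q) = (\<Sum>k\<in>UNIV. \<Sum>p\<in>UNIV. \<Sum>q\<in>UNIV. f k p q)"
  by (simp only: sum.cartesian_product UNIV_Times_UNIV)

text \<open>The digit is the number of variables in which the quadratic form still varies. In the
  versions with \<open>line\<close> the mixed coefficients of the variable just before them are
  prescribed as well.\<close>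

definition forms2 :: "'r::comm_ring_1 \<Rightarrow> 'f \<Rightarrow> 'f \<Rightarrow> 'f \<Rightarrow> 'r" where
  "forms2 x c0 c1 c2 = (\<Sum>(c5, c8, c9)\<in>UNIV. wq x c0 c1 c2 0 0 c5 0 0 c8 c9)"

definition forms3 :: "'r::comm_ring_1 \<Rightarrow> 'f \<Rightarrow> 'r" where
  "forms3 x k = (\<Sum>(c2, c4, c5, c7, c8, c9)\<in>UNIV. wq x k 0 c2 0 c4 c5 0 c7 c8 c9)"

definition forms3_line :: "'r::comm_ring_1 \<Rightarrow> 'f \<Rightarrow> 'f \<Rightarrow> 'f \<Rightarrow> 'f \<Rightarrow> 'r" where
  "forms3_line x k l1 l2 l3 = (\<Sum>(c2, c4, c5, c7, c8, c9)\<in>UNIV. wq x k l1 c2 l2 c4 c5 l3 c7 c8 c9)"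

text \<open>Completing the square only translates the form in the last three variables, and the sum
  runs over all of these.\<close>

lemma forms3_line_square:
  assumes "k \<noteq> 0"
  shows "forms3_line x k l1 l2 l3 = forms3 x k"
  unfolding forms3_line_def forms3_def
  by (rule sum.reindex_bij_witness[of _
      "\<lambda>(c2, c4, c5, c7, c8, c9). (c2 + k * l1 * l1, c4 - k * l1 * l2, c5 + k * l2 * l2, c7 - k * l1 * l3,
        c8 - k * l2 * l3, c9 + k * l3 * l3)"
      "\<lambda>(c2, c4, c5, c7, c8, c9). (c2 - k * l1 * l1, c4 + k * l1 * l2, c5 - k * l2 * l2, c7 + k * l1 * l3,
        c8 + k * l2 * l3, c9 - k * l3 * l3)"]) (auto intro: wq_square[OF assms, symmetric])

text \<open>The substitution of \<open>wq_row2\<close> permutes the forms in the last three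
  variables. The witness inverts that permutation, with doubled terms rewritten by 2 = -1.\<close>

lemma forms3_line_unit:
  assumes "k \<noteq> 0"
  shows "forms3_line x 0 k l m = forms3_line x 0 1 0 0"
  unfolding forms3_line_def
proof (rule sum.reindex_bij_witness[of _
      "\<lambda>(c2, c4, c5, c7, c8, c9). (c2, k * c4 + k * l * c2 + k * l * c2, c5 + l * l * c2 + l * c4,
         k * c7 + k * m * c2 + k * m * c2, c8 + l * m * c2 + l * m * c2 + m * c4 + l * c7, c9 + m * m * c2 + m * c7)"
      "\<lambda>(c2, c4, c5, c7, c8, c9). (c2, k * c4 + l * c2, c5 + l * l * c2 - k * l * c4,
         k * c7 + m * c2, c8 - l * m * c2 - k * m * c4 - k * l * c7, c9 + m * m * c2 - k * m * c7)"])
  fix p :: "'f \<times> 'f \<times> 'f \<times> 'f \<times> 'f \<times> 'f"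
  obtain c2 c4 c5 c7 c8 c9 where p: "p = (c2, c4, c5, c7, c8, c9)" by (cases p)
  show 1: "(case case p of (c2, c4, c5, c7, c8, c9) \<Rightarrow> (c2, k * c4 + l * c2, c5 + l * l * c2 - k * l * c4,
         k * c7 + m * c2, c8 - l * m * c2 - k * m * c4 - k * l * c7, c9 + m * m * c2 - k * m * c7) of
      (c2, c4, c5, c7, c8, c9) \<Rightarrow> (c2, k * c4 + k * l * c2 + k * l * c2, c5 + l * l * c2 + l * c4,
         k * c7 + k * m * c2 + k * m * c2, c8 + l * m * c2 + l * m * c2 + m * c4 + l * c7, c9 + m * m * c2 + m * c7)) = p"
    using assms by (cases k rule: field_cases) (simp_all add: p algebra_simps)
  show "(case case p of (c2, c4, c5, c7, c8, c9) \<Rightarrow> (c2, k * c4 + k * l * c2 + k * l * c2, c5 + l * l * c2 + l * c4,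
         k * c7 + k * m * c2 + k * m * c2, c8 + l * m * c2 + l * m * c2 + m * c4 + l * c7, c9 + m * m * c2 + m * c7) of
      (c2, c4, c5, c7, c8, c9) \<Rightarrow> (c2, k * c4 + l * c2, c5 + l * l * c2 - k * l * c4,
         k * c7 + m * c2, c8 - l * m * c2 - k * m * c4 - k * l * c7, c9 + m * m * c2 - k * m * c7)) = p"
    using assms by (cases k rule: field_cases) (simp_all add: p algebra_simps)
  have "wq x 0 k e2 l e4 e5 m e7 e8 e9 = wq x 0 1 c2 0 c4 c5 0 c7 c8 c9"
    if "(e2, e4, e5, e7, e8, e9) = (c2, k * c4 + k * l * c2 + k * l * c2, c5 + l * l * c2 + l * c4,
         k * c7 + k * m * c2 + k * m * c2, c8 + l * m * c2 + l * m * c2 + m * c4 + l * c7, c9 + m * m * c2 + m * c7)"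
    for e2 e4 e5 e7 e8 e9 c2 c4 c5 c7 c8 c9
    using that wq_row2[OF assms, of x c2 c4 c5 c7 c8 c9 l m] by simp
  from this[of c2 c4 c5 c7 c8 c9 c2 "k * c4 + l * c2" "c5 + l * l * c2 - k * l * c4"
         "k * c7 + m * c2" "c8 - l * m * c2 - k * m * c4 - k * l * c7" "c9 + m * m * c2 - k * m * c7"]
  show "(case case p of (c2, c4, c5, c7, c8, c9) \<Rightarrow> (c2, k * c4 + l * c2, c5 + l * l * c2 - k * l * c4,
         k * c7 + m * c2, c8 - l * m * c2 - k * m * c4 - k * l * c7, c9 + m * m * c2 - k * m * c7) of
      (c2, c4, c5, c7, c8, c9) \<Rightarrow> wq x 0 1 c2 0 c4 c5 0 c7 c8 c9) =
      (case p of (c2, c4, c5, c7, c8, c9) \<Rightarrow> wq x 0 k c2 l c4 c5 m c7 c8 c9)"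
    using 1 unfolding p split by simp
qed auto

lemma forms3_line_swap:
  "forms3_line x 0 l1 l2 l3 = forms3_line x 0 l2 l1 l3" "forms3_line x 0 l1 l2 l3 = forms3_line x 0 l1 l3 l2"
  unfolding forms3_line_def
  by (rule sum.reindex_bij_witness[of _ "\<lambda>(c2, c4, c5, c7, c8, c9). (c5, c4, c2, c8, c7, c9)"
      "\<lambda>(c2, c4, c5, c7, c8, c9). (c5, c4, c2, c8, c7, c9)"], auto intro: wq_swap)
    (rule sum.reindex_bij_witness[of _ "\<lambda>(c2, c4, c5, c7, c8, c9). (c2, c7, c9, c4, c8, c5)"
      "\<lambda>(c2, c4, c5, c7, c8, c9). (c2, c7, c9, c4, c8, c5)"], auto intro: wq_swap)

text \<open>A nonzero cofactor of a may be taken to be b. The three coefficients of the other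
  multiples of b are then absorbed, whence 27.\<close>

lemma forms3_line_hyperbolic:
  assumes "(l1, l2, l3) \<noteq> (0, 0, 0)"
  shows "forms3_line x 0 l1 l2 l3 = 27 * forms2 x 0 1 0"
proof -
  have "forms3_line x 0 l1 l2 l3 = forms3_line x 0 1 0 0"
  proof (cases "l1 = 0")
    case False
    thus ?thesis by (rule forms3_line_unit)
  next
    case l1: True
    show ?thesis
    proof (cases "l2 = 0")
      case False
      thus ?thesis using forms3_line_unit[of l2 x l1 l3] by (subst forms3_line_swap(1))
    next
      case True
      with l1 assms have "l3 \<noteq> 0" by simp
      have "forms3_line x 0 l1 l2 l3 = forms3_line x 0 l1 l3 l2" by (rule forms3_line_swap)
      also have "\<dots> = forms3_line x 0 l3 l1 l2" by (rule forms3_line_swap)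
      also have "\<dots> = forms3_line x 0 1 0 0" by (rule forms3_line_unit) fact
      finally show ?thesis .
    qed
  qed
  also have "\<dots> = (\<Sum>((c2, c4, c7), (c5, c8, c9))\<in>(UNIV :: ('f \<times> 'f \<times> 'f) set) \<times> UNIV. wq x 0 1 0 0 0 c5 0 0 c8 c9)"
    unfolding forms3_line_def
    by (rule sum.reindex_bij_witness[of _ "\<lambda>((c2, c4, c7), (c5, c8, c9)). (c2, c4, c5, c7, c8, c9)"
        "\<lambda>(c2, c4, c5, c7, c8, c9). ((c2, c4, c7), (c5, c8, c9))"]) (auto intro: wq_hyperbolic[symmetric])
  also have "\<dots> = (\<Sum>p\<in>(UNIV :: ('f \<times> 'f \<times> 'f) set). forms2 x 0 1 0)"
    unfolding forms2_def sum.cartesian_product by (simp add: case_prod_unfold)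
  also have "\<dots> = 27 * forms2 x 0 1 0" by (simp only: sum_constant card_triples) simp
  finally show ?thesis .
qed


definition forms2_line :: "'r::comm_ring_1 \<Rightarrow> 'f \<Rightarrow> 'f \<Rightarrow> 'f \<Rightarrow> 'f \<Rightarrow> 'r" where
  "forms2_line x c0 k l m = (\<Sum>(c5, c8, c9)\<in>UNIV. wq x c0 0 k 0 l c5 0 m c8 c9)"

lemma forms2_line_square:
  assumes "k \<noteq> 0"
  shows "forms2_line x c0 k l m = forms2 x c0 0 k"
  unfolding forms2_line_def forms2_def
  by (rule sum.reindex_bij_witness[of _
      "\<lambda>(c5, c8, c9). (c5 + k * l * l, c8 - k * l * m, c9 + k * m * m)"
      "\<lambda>(c5, c8, c9). (c5 - k * l * l, c8 + k * l * m, c9 - k * m * m)"])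
    (auto intro: wq_square2[OF assms, symmetric])

lemma forms2_line_unit:
  assumes "k \<noteq> 0"
  shows "forms2_line x c0 0 k m = forms2_line x c0 0 1 0"
  unfolding forms2_line_def
proof (rule sum.reindex_bij_witness[of _
      "\<lambda>(c5, c8, c9). (c5, k * c8 + k * m * c5 + k * m * c5, c9 + m * m * c5 + m * c8)"
      "\<lambda>(c5, c8, c9). (c5, k * c8 + m * c5, c9 + m * m * c5 - k * m * c8)"])
  fix p :: "'f \<times> 'f \<times> 'f"
  obtain c5 c8 c9 where p: "p = (c5, c8, c9)" by (cases p)
  show 1: "(case case p of (c5, c8, c9) \<Rightarrow> (c5, k * c8 + m * c5, c9 + m * m * c5 - k * m * c8) of
      (c5, c8, c9) \<Rightarrow> (c5, k * c8 + k * m * c5 + k * m * c5, c9 + m * m * c5 + m * c8)) = p"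
    using assms by (cases k rule: field_cases) (simp_all add: p algebra_simps)
  show "(case case p of (c5, c8, c9) \<Rightarrow> (c5, k * c8 + k * m * c5 + k * m * c5, c9 + m * m * c5 + m * c8) of
      (c5, c8, c9) \<Rightarrow> (c5, k * c8 + m * c5, c9 + m * m * c5 - k * m * c8)) = p"
    using assms by (cases k rule: field_cases) (simp_all add: p algebra_simps)
  have "wq x c0 0 0 0 k e5 0 m e8 e9 = wq x c0 0 0 0 1 c5 0 0 c8 c9"
    if "(e5, e8, e9) = (c5, k * c8 + k * m * c5 + k * m * c5, c9 + m * m * c5 + m * c8)" for e5 e8 e9 c5 c8 c9
    using that wq_row3[OF assms, of x c0 c5 c8 c9 m] by simp
  from this[of c5 c8 c9 c5 "k * c8 + m * c5" "c9 + m * m * c5 - k * m * c8"]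
  show "(case case p of (c5, c8, c9) \<Rightarrow> (c5, k * c8 + m * c5, c9 + m * m * c5 - k * m * c8) of
      (c5, c8, c9) \<Rightarrow> wq x c0 0 0 0 1 c5 0 0 c8 c9) = (case p of (c5, c8, c9) \<Rightarrow> wq x c0 0 0 0 k c5 0 m c8 c9)"
    using 1 unfolding p split by simp
qed auto

lemma forms2_line_swap: "forms2_line x c0 0 l m = forms2_line x c0 0 m l"
  unfolding forms2_line_def
  by (rule sum.reindex_bij_witness[of _ "\<lambda>(c5, c8, c9). (c9, c8, c5)" "\<lambda>(c5, c8, c9). (c9, c8, c5)"])
    (auto intro: wq_swap)

lemma forms2_line_hyperbolic:
  assumes "(l, m) \<noteq> (0, 0)"
  shows "forms2_line x c0 0 l m = 9 * (\<Sum>e\<in>UNIV. wq x c0 0 0 0 1 0 0 0 0 e)"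
proof -
  have "forms2_line x c0 0 l m = forms2_line x c0 0 1 0"
  proof (cases "l = 0")
    case False
    thus ?thesis by (rule forms2_line_unit)
  next
    case True
    have "forms2_line x c0 0 l m = forms2_line x c0 0 m l" by (rule forms2_line_swap)
    also have "\<dots> = forms2_line x c0 0 1 0" by (rule forms2_line_unit) (use True assms in auto)
    finally show ?thesis .
  qed
  also have "\<dots> = (\<Sum>(p, e)\<in>(UNIV :: ('f \<times> 'f) set) \<times> UNIV. wq x c0 0 0 0 1 0 0 0 0 e)"
    unfolding forms2_line_def
    by (rule sum.reindex_bij_witness[of _ "\<lambda>((c5, c8), c9). (c5, c8, c9)" "\<lambda>(c5, c8, c9). ((c5, c8), c9)"])
      (auto intro: wq_hyperbolic2[symmetric])
  also have "\<dots> = (\<Sum>p\<in>(UNIV :: ('f \<times> 'f) set). \<Sum>e\<in>UNIV. wq x c0 0 0 0 1 0 0 0 0 e)"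
    unfolding sum.cartesian_product ..
  also have "\<dots> = 9 * (\<Sum>e\<in>UNIV. wq x c0 0 0 0 1 0 0 0 0 e)" by (simp only: sum_constant card_pairs) simp
  finally show ?thesis .
qed

text \<open>In k c^2 + l c d + e d^2 with k nonzero, the square absorbs the three values of l. For k
  = 0 the two nonzero values of l and the three values of e all give a product of two linear forms,
  which makes 6.\<close>

lemma forms2_eq:
  "forms2 x c0 c1 c2 = (\<Sum>e\<in>UNIV. wq x c0 c1 c2 0 0 0 0 0 0 e) +
     3 * (\<Sum>e\<in>UNIV. wq x c0 c1 c2 0 0 1 0 0 0 e) + 3 * (\<Sum>e\<in>UNIV. wq x c0 c1 c2 0 0 (- 1) 0 0 0 e) +
     6 * wq x c0 c1 c2 0 0 0 0 0 1 0"
proof -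
  have "forms2 x c0 c1 c2 = (\<Sum>k\<in>UNIV. \<Sum>l\<in>UNIV. \<Sum>e\<in>UNIV. wq x c0 c1 c2 0 0 k 0 0 l e)"
    unfolding forms2_def sum.cartesian_product UNIV_Times_UNIV ..
  moreover have "(\<Sum>l\<in>UNIV. \<Sum>e\<in>UNIV. wq x c0 c1 c2 0 0 k 0 0 l e) =
      3 * (\<Sum>e\<in>UNIV. wq x c0 c1 c2 0 0 k 0 0 0 e)" if "k \<noteq> 0" for k
  proof -
    have "(\<Sum>e\<in>UNIV. wq x c0 c1 c2 0 0 k 0 0 l e) = (\<Sum>e\<in>UNIV. wq x c0 c1 c2 0 0 k 0 0 0 e)" for l
      by (rule sum.reindex_bij_witness[of _ "\<lambda>e. e + k * l * l" "\<lambda>e. e - k * l * l"])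
        (auto intro: wq_square3[OF that, symmetric])
    hence "(\<Sum>l\<in>UNIV. \<Sum>e\<in>UNIV. wq x c0 c1 c2 0 0 k 0 0 l e) =
        (\<Sum>l\<in>(UNIV :: 'f set). \<Sum>e\<in>UNIV. wq x c0 c1 c2 0 0 k 0 0 0 e)" by (rule sum.cong[OF refl])
    thus ?thesis by (simp only: sum_constant card_field) simp
  qed
  moreover have "(\<Sum>l\<in>UNIV. \<Sum>e\<in>UNIV. wq x c0 c1 c2 0 0 0 0 0 l e) =
      (\<Sum>e\<in>UNIV. wq x c0 c1 c2 0 0 0 0 0 0 e) + 6 * wq x c0 c1 c2 0 0 0 0 0 1 0"
  proof -
    have "(\<Sum>e\<in>UNIV. wq x c0 c1 c2 0 0 0 0 0 l e) = 3 * wq x c0 c1 c2 0 0 0 0 0 1 0" if "l \<noteq> 0" for l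
    proof -
      have "(\<Sum>e\<in>UNIV. wq x c0 c1 c2 0 0 0 0 0 l e) = (\<Sum>e\<in>(UNIV :: 'f set). wq x c0 c1 c2 0 0 0 0 0 1 0)"
        by (intro sum.cong refl wq_hyperbolic3 that)
      thus ?thesis by (simp only: sum_constant card_field) simp
    qed
    from this[of 1] this[of "- 1"] show ?thesis
      by (simp add: sum_field[of "\<lambda>l. \<Sum>e\<in>UNIV. wq x c0 c1 c2 0 0 0 0 0 l e"])
  qed
  ultimately show ?thesis
    by (simp add: sum_field[of "\<lambda>k. \<Sum>l\<in>UNIV. \<Sum>e\<in>UNIV. wq x c0 c1 c2 0 0 k 0 0 l e"])
qed

text \<open>There are 9 pairs of mixed coefficients for each square coefficient 1 or -1; if it is 0,
  the 8 nonzero pairs account for 8 * 9 = 72.\<close>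

lemma forms3_eq:
  "forms3 x c0 = forms2 x c0 0 0 + 9 * forms2 x c0 0 1 + 9 * forms2 x c0 0 (- 1) +
     72 * (\<Sum>e\<in>UNIV. wq x c0 0 0 0 1 0 0 0 0 e)"
proof -
  let ?h = "\<Sum>e\<in>UNIV. wq x c0 0 0 0 1 0 0 0 0 e"
  have sq: "(\<Sum>(l, m)\<in>UNIV. forms2_line x c0 k l m) = 9 * forms2 x c0 0 k" if "k \<noteq> 0" for k
    by (simp add: forms2_line_square[OF that] case_prod_unfold card_field)
  have "forms3 x c0 = (\<Sum>(k, (l, m), (c5, c8, c9))\<in>UNIV \<times> UNIV \<times> UNIV. wq x c0 0 k 0 l c5 0 m c8 c9)"
    unfolding forms3_def
    by (rule sum.reindex_bij_witness[of _ "\<lambda>(c2, (c4, c7), (c5, c8, c9)). (c2, c4, c5, c7, c8, c9)"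
        "\<lambda>(c2, c4, c5, c7, c8, c9). (c2, (c4, c7), (c5, c8, c9))"]) auto
  also have "\<dots> = (\<Sum>k\<in>UNIV. \<Sum>(l, m)\<in>UNIV. forms2_line x c0 k l m)"
    unfolding forms2_line_def UNIV_Times_UNIV
    by (subst sum_triples, intro sum.cong refl) (simp add: case_prod_unfold)
  also have "\<dots> = (\<Sum>(l, m)\<in>UNIV. forms2_line x c0 0 l m) + (\<Sum>(l, m)\<in>UNIV. forms2_line x c0 1 l m)
      + (\<Sum>(l, m)\<in>UNIV. forms2_line x c0 (- 1) l m)"
    by (rule sum_field)
  also have "(\<Sum>(l, m)\<in>UNIV. forms2_line x c0 0 l m) =
      forms2_line x c0 0 0 0 + (\<Sum>(l, m)\<in>UNIV - {(0, 0)}. forms2_line x c0 0 l m)"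
    by (subst sum.remove[of _ "(0, 0)"]) auto
  also have "(\<Sum>(l, m)\<in>UNIV - {(0, 0)}. forms2_line x c0 0 l m) = (\<Sum>p\<in>UNIV - {(0 :: 'f, 0 :: 'f)}. 9 * ?h)"
    by (rule sum.cong) (auto intro!: forms2_line_hyperbolic)
  also have "\<dots> = 72 * ?h" by (simp add: card_Diff_singleton card_field)
  also have "forms2_line x c0 0 0 0 = forms2 x c0 0 0" unfolding forms2_line_def forms2_def ..
  finally show ?thesis using sq[of 1] sq[of "- 1"] by simp
qed

text \<open>As before with one more variable: 27 triples of mixed coefficients, and 26 * 27 = 702
  for the nonzero ones without a square.\<close>

lemma sum_wq_eq:
  "(\<Sum>(k, (l1, l2, l3), (c2, c4, c5, c7, c8, c9))\<in>UNIV. wq x k l1 c2 l2 c4 c5 l3 c7 c8 c9) =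
    forms3 x 0 + 27 * forms3 x 1 + 27 * forms3 x (- 1) + 702 * forms2 x 0 1 0"
proof -
  have sq: "(\<Sum>(l1, l2, l3)\<in>UNIV. forms3_line x k l1 l2 l3) = 27 * forms3 x k" if "k \<noteq> 0" for k
    by (simp add: forms3_line_square[OF that] case_prod_unfold card_field)
  have "(\<Sum>(k, (l1, l2, l3), (c2, c4, c5, c7, c8, c9))\<in>UNIV. wq x k l1 c2 l2 c4 c5 l3 c7 c8 c9) =
      (\<Sum>k\<in>UNIV. \<Sum>(l1, l2, l3)\<in>UNIV. forms3_line x k l1 l2 l3)"
    unfolding forms3_line_def
    by (subst sum_triples, intro sum.cong refl) (simp add: case_prod_unfold)
  also have "\<dots> = (\<Sum>(l1, l2, l3)\<in>UNIV. forms3_line x 0 l1 l2 l3) + (\<Sum>(l1, l2, l3)\<in>UNIV. forms3_line x 1 l1 l2 l3)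
      + (\<Sum>(l1, l2, l3)\<in>UNIV. forms3_line x (- 1) l1 l2 l3)"
    by (rule sum_field)
  also have "(\<Sum>(l1, l2, l3)\<in>UNIV. forms3_line x 0 l1 l2 l3) =
      forms3_line x 0 0 0 0 + (\<Sum>(l1, l2, l3)\<in>UNIV - {(0, 0, 0)}. forms3_line x 0 l1 l2 l3)"
    by (subst sum.remove[of _ "(0, 0, 0)"]) auto
  also have "(\<Sum>(l1, l2, l3)\<in>UNIV - {(0, 0, 0)}. forms3_line x 0 l1 l2 l3) =
      (\<Sum>p\<in>UNIV - {(0 :: 'f, 0 :: 'f, 0 :: 'f)}. 27 * forms2 x 0 1 0)"
    by (rule sum.cong) (auto intro!: forms3_line_hyperbolic)
  also have "\<dots> = 702 * forms2 x 0 1 0" by (simp add: card_Diff_singleton card_field)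
  also have "forms3_line x 0 0 0 0 = forms3 x 0" unfolding forms3_line_def forms3_def ..
  finally show ?thesis using sq[of 1] sq[of "- 1"] by simp
qed

end

section \<open>Diagonal forms and the sizes of the types\<close>

context ternary_space
begin

definition dg :: "'r::comm_ring_1 \<Rightarrow> 'f \<Rightarrow> 'f \<Rightarrow> 'f \<Rightarrow> 'f \<Rightarrow> 'r" where
  "dg x k0 k1 k2 k3 = wq x k0 0 k1 0 0 k2 0 0 0 k3"

lemma dg_swap: "dg x a b c d = dg x b a c d" "dg x a b c d = dg x a c b d" "dg x a b c d = dg x a b d c"
  unfolding dg_def by (rule wq_swap)+

lemma dg_neg: "dg x (- a) (- b) (- c) (- d) = dg x a b c d"
  unfolding dg_def using wq_neg[of x a 0 b 0 0 c 0 0 0 d] by simp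

lemma dg_pair1: "dg x (- 1) (- 1) c d = dg x 1 1 c d"
  unfolding dg_def by (rule wq_diag_neg[symmetric])

lemma dg_pair2: "dg x a (- 1) (- 1) d = dg x a 1 1 d"
proof -
  have "dg x a (- 1) (- 1) d = dg x (- 1) (- 1) a d" by (subst dg_swap(2), subst dg_swap(1), subst dg_swap(2)) (rule refl)
  also have "\<dots> = dg x 1 1 a d" by (rule dg_pair1)
  also have "\<dots> = dg x a 1 1 d" by (subst dg_swap(2), subst dg_swap(1)) (rule refl)
  finally show ?thesis .
qed

lemma dg_pair3: "dg x a b (- 1) (- 1) = dg x a b 1 1"
proof -
  have "dg x a b (- 1) (- 1) = dg x a (- 1) (- 1) b" by (subst dg_swap(3), subst dg_swap(2), subst dg_swap(3)) (rule refl)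
  also have "\<dots> = dg x a 1 1 b" by (rule dg_pair2)
  also have "\<dots> = dg x a b 1 1" by (subst dg_swap(3), subst dg_swap(2)) (rule refl)
  finally show ?thesis .
qed

text \<open>A terminating normalization: 1 before -1 before 0, and two adjacent entries -1 become 1.
  What remains is determined by the rank and by whether a single -1 is left, that is, by the
  discriminant.\<close>

lemmas dg_sort =
  dg_swap(1)[of x 0 1 c d for x c d] dg_swap(1)[of x 0 "- 1" c d for x c d] dg_swap(1)[of x "- 1" 1 c d for x c d]
  dg_swap(2)[of x a 0 1 d for x a d] dg_swap(2)[of x a 0 "- 1" d for x a d] dg_swap(2)[of x a "- 1" 1 d for x a d]
  dg_swap(3)[of x a b 0 1 for x a b] dg_swap(3)[of x a b 0 "- 1" for x a b] dg_swap(3)[of x a b "- 1" 1 for x a b]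
  dg_pair1 dg_pair2 dg_pair3

text \<open>In odd rank the negated form has the same zeros but the other discriminant, so rank and
  zeros alone fix the type.\<close>

lemma dg_odd: "dg x (- 1) 0 0 0 = dg x 1 0 0 0" "dg x 1 1 (- 1) 0 = dg x 1 1 1 0"
  using dg_neg[of x 1 0 0 0] dg_neg[of x 1 1 "- 1" 0] by (simp_all add: dg_sort)

lemma wq_exchange: "wq x c0 c1 c2 0 0 c5 0 0 c8 c9 = wq x c5 c8 c9 0 0 c0 0 0 c1 c2"
proof (rule wq_eqI)
  have "(\<lambda>(a :: 'f, b :: 'f, c :: 'f, d :: 'f). (c, d, a, b)) = (\<lambda>(a, b, c, d). (a, c, b, d)) \<circ> (\<lambda>(a, b, c, d). (b, a, c, d))
     \<circ> (\<lambda>(a, b, c, d). (a, b, d, c)) \<circ> (\<lambda>(a, b, c, d). (a, c, b, d))"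
    by (auto simp: fun_eq_iff)
  thus "substitution (\<lambda>(a, b, c, d). (c, d, a, b))"
    by (simp only: substitution_comp substitution_swap)
qed (simp add: qform_def algebra_simps)

lemma wq_to_dg:
  "wq x a 0 b 0 0 c 0 0 0 d = dg x a b c d"
  "wq x 0 1 0 0 0 c 0 0 0 d = dg x 1 (- 1) c d"
  "wq x a 0 0 0 1 0 0 0 0 d = dg x 1 (- 1) a d"
  "wq x a 0 b 0 0 0 0 0 1 0 = dg x 1 (- 1) a b"
  "wq x 0 1 0 0 0 0 0 0 1 0 = dg x 1 (- 1) 1 (- 1)"
proof -
  show 1: "wq x a 0 b 0 0 c 0 0 0 d = dg x a b c d" for a b c d by (simp add: dg_def)
  show 2: "wq x 0 1 0 0 0 c 0 0 0 d = dg x 1 (- 1) c d" for c d by (simp add: wq_hyperbolic_diag 1)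
  have "wq x a 0 0 0 1 0 0 0 0 d = wq x 0 0 a 1 0 0 0 0 0 d" by (rule wq_swap)
  also have "\<dots> = wq x 0 1 0 0 0 a 0 0 0 d" by (rule wq_swap)
  finally show "wq x a 0 0 0 1 0 0 0 0 d = dg x 1 (- 1) a d" by (simp add: 2)
  show 3: "wq x a 0 b 0 0 0 0 0 1 0 = dg x 1 (- 1) a b" for a b by (subst wq_exchange) (rule 2)
  show "wq x 0 1 0 0 0 0 0 0 1 0 = dg x 1 (- 1) 1 (- 1)" by (simp add: wq_hyperbolic_diag 3)
qed

text \<open>Both sides reduce to the same combination of normalized diagonal forms. As a check, with
  a factor 2 for scalars: 40 planes, 780 pairs of planes, 390 pairs of conjugate planes meeting in a
  line, and 40 * 234 cones over conics; all multiplicities, with 1 for the zero form, add up to 3 ^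
  10.\<close>

lemma sum_wq_types:
  "(\<Sum>(k, (l1, l2, l3), (c2, c4, c5, c7, c8, c9))\<in>UNIV. wq x k l1 c2 l2 c4 c5 l3 c7 c8 c9) =
    wq x 0 0 0 0 0 0 0 0 0 0 + 80 * wq x 1 0 0 0 0 0 0 0 0 0 + 1560 * wq x 0 1 0 0 0 0 0 0 0 0 +
    780 * wq x 1 0 1 0 0 0 0 0 0 0 + 18720 * wq x 0 1 0 0 0 (- 1) 0 0 0 0 +
    21060 * wq x 0 1 0 0 0 0 0 0 (- 1) 0 + 16848 * wq x 0 1 0 0 0 1 0 0 0 1"
proof -
  have "wq x 0 1 0 0 0 0 0 0 (- 1) 0 = wq x 0 1 0 0 0 0 0 0 1 0" by (rule wq_hyperbolic3) simp
  thus ?thesis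
    by (simp only: sum_wq_eq forms3_eq forms2_eq sum_field wq_to_dg) (simp add: dg_sort dg_odd)
qed

subsection \<open>Reduction to projective points\<close>

text \<open>The 27 + 9 + 3 + 1 points are represented by the vectors whose first nonzero coordinate
  is 1.\<close>

definition points_prod :: "('f \<times> 'f \<times> 'f \<times> 'f \<Rightarrow> 'r::comm_ring_1) \<Rightarrow> 'r" where
  "points_prod h = (\<Prod>b\<in>UNIV. \<Prod>c\<in>UNIV. \<Prod>d\<in>UNIV. h (1, b, c, d)) * (\<Prod>c\<in>UNIV. \<Prod>d\<in>UNIV. h (0, 1, c, d)) *
     (\<Prod>d\<in>UNIV. h (0, 0, 1, d)) * h (0, 0, 0, 1)"

text \<open>The set is closed under sign change, and each pair v, -v of nonzero vectors has exactly
  one member among the representatives. So the division by 2 in \<open>zero_points\<close> is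
  exact.\<close>

lemma power_zero_points:
  assumes even: "\<And>a b c d. S (- a, - b, - c, - d) = S (a, b, c, d)"
  shows "x ^ zero_points S = points_prod (\<lambda>v. if S v then x else 1)"
proof -
  define R :: "('f \<times> 'f \<times> 'f \<times> 'f) set" where
    "R = {1} \<times> UNIV \<times> UNIV \<times> UNIV \<union> ({0} \<times> {1} \<times> UNIV \<times> UNIV \<union> ({0} \<times> {0} \<times> {1} \<times> UNIV \<union> {(0, 0, 0, 1)}))"
  define neg :: "'f \<times> 'f \<times> 'f \<times> 'f \<Rightarrow> 'f \<times> 'f \<times> 'f \<times> 'f" where "neg = (\<lambda>(a, b, c, d). (- a, - b, - c, - d))"
  have fin: "finite R" unfolding R_def by (intro finite_UnI finite_cartesian_product) auto
  have mem: "v \<noteq> (0, 0, 0, 0) \<longleftrightarrow> v \<in> R \<or> neg v \<in> R" and disj: "\<not> (v \<in> R \<and> neg v \<in> R)" for v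
  proof -
    obtain a b c d where v: "v = (a, b, c, d)" by (cases v)
    show "v \<noteq> (0, 0, 0, 0) \<longleftrightarrow> v \<in> R \<or> neg v \<in> R" "\<not> (v \<in> R \<and> neg v \<in> R)"
      unfolding v neg_def R_def
      by (cases a rule: field_cases; cases b rule: field_cases; cases c rule: field_cases;
          cases d rule: field_cases; simp)+
  qed
  have nn: "neg (neg v) = v" for v by (cases v) (simp add: neg_def)
  have S_neg: "S (neg v) = S v" for v by (cases v) (simp add: neg_def even)
  have "{v. v \<noteq> (0, 0, 0, 0) \<and> S v} = {v \<in> R. S v} \<union> neg ` {v \<in> R. S v}"
  proof (intro equalityI subsetI)
    fix v assume v: "v \<in> {v. v \<noteq> (0, 0, 0, 0) \<and> S v}"
    hence "v \<in> R \<or> neg v \<in> R" using mem by blast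
    thus "v \<in> {v \<in> R. S v} \<union> neg ` {v \<in> R. S v}"
      using v nn[of v] S_neg[of v] by (metis (mono_tags, lifting) UnCI imageI mem_Collect_eq)
  next
    fix v assume "v \<in> {v \<in> R. S v} \<union> neg ` {v \<in> R. S v}"
    then obtain u where "u \<in> R" "S u" "v = u \<or> v = neg u" by blast
    hence "v \<in> R \<or> neg v \<in> R" "S v" by (auto simp only: nn S_neg)
    thus "v \<in> {v. v \<noteq> (0, 0, 0, 0) \<and> S v}" using mem[of v] by blast
  qed
  moreover have "{v \<in> R. S v} \<inter> neg ` {v \<in> R. S v} = {}" using disj nn by auto
  moreover have "card (neg ` {v \<in> R. S v}) = card {v \<in> R. S v}"
    by (rule card_image) (metis inj_onI nn)
  ultimately have "zero_points S = card {v \<in> R. S v}"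
    unfolding zero_points_def using fin by (simp add: card_Un_disjoint)
  hence "x ^ zero_points S = (\<Prod>v\<in>R. if S v then x else 1)"
    using fin by (simp add: prod.If_cases Int_def)
  also have "\<dots> = points_prod (\<lambda>v. if S v then x else 1)"
  proof -
    have "(\<Prod>v\<in>R. h v) = (\<Prod>v\<in>{1} \<times> UNIV \<times> UNIV \<times> UNIV. h v) * ((\<Prod>v\<in>{0} \<times> {1} \<times> UNIV \<times> UNIV. h v) *
        ((\<Prod>v\<in>{0} \<times> {0} \<times> {1} \<times> UNIV. h v) * (\<Prod>v\<in>{(0, 0, 0, 1)}. h v)))" for h :: "_ \<Rightarrow> 'a"
      unfolding R_def
      by (subst prod.union_disjoint; (intro finite_UnI finite_cartesian_product)?; auto)+
    moreover have "(\<Prod>v\<in>{1} \<times> UNIV \<times> UNIV \<times> UNIV. h v) = (\<Prod>b\<in>UNIV. \<Prod>c\<in>UNIV. \<Prod>d\<in>UNIV. h (1, b, c, d))"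
      for h :: "'f \<times> 'f \<times> 'f \<times> 'f \<Rightarrow> 'a"
      unfolding prod.cartesian_product by (rule prod.reindex_bij_witness[of _ "Pair 1" snd]) auto
    moreover have "(\<Prod>v\<in>{0} \<times> {1} \<times> UNIV \<times> UNIV. h v) = (\<Prod>c\<in>UNIV. \<Prod>d\<in>UNIV. h (0, 1, c, d))"
      for h :: "'f \<times> 'f \<times> 'f \<times> 'f \<Rightarrow> 'a"
      unfolding prod.cartesian_product
      by (rule prod.reindex_bij_witness[of _ "\<lambda>p. (0, 1, p)" "\<lambda>(a, b, p). p"]) auto
    moreover have "(\<Prod>v\<in>{0} \<times> {0} \<times> {1} \<times> UNIV. h v) = (\<Prod>d\<in>UNIV. h (0, 0, 1, d))"
      for h :: "'f \<times> 'f \<times> 'f \<times> 'f \<Rightarrow> 'a"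
      by (rule prod.reindex_bij_witness[of _ "\<lambda>d. (0, 0, 1, d)" "\<lambda>(a, b, c, d). d"]) auto
    ultimately show ?thesis unfolding points_prod_def by (simp only: prod.insert prod.empty finite.emptyI empty_iff not_False_eq_True mult_1_right mult.assoc)
  qed
  finally show ?thesis .
qed


lemma wt_eq:
  assumes "Q = qform d0 d1 d2 d3 d4 d5 d6 d7 d8 d9"
  shows "wt x Q = (\<Sum>f\<in>qmaps. points_prod (\<lambda>v. if Q v = 0 then weight x (f v) else 1))"
  unfolding wt_def
proof (rule sum.cong[OF refl])
  fix f assume "f \<in> qmaps"
  then obtain c0 c1 c2 c3 c4 c5 c6 c7 c8 c9 where f: "f = qmap c0 c1 c2 c3 c4 c5 c6 c7 c8 c9" by (rule qmapsE)
  have "x ^ zero_points (\<lambda>v. Q v = 0 \<and> f v = 0) = points_prod (\<lambda>v. if Q v = 0 \<and> f v = 0 then x else 1)"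
    by (rule power_zero_points) (simp add: assms f qform_def qmap_def)
  also have "(\<lambda>v. if Q v = 0 \<and> f v = 0 then x else 1) = (\<lambda>v. if Q v = 0 then weight x (f v) else 1)"
    by (auto simp: weight_def fun_eq_iff)
  finally show "x ^ zero_points (\<lambda>v. Q v = 0 \<and> f v = 0) = points_prod (\<lambda>v. if Q v = 0 then weight x (f v) else 1)" .
qed

section \<open>The weights of the six standard quadrics\<close>

definition quadric_weight :: "'r::comm_ring_1 \<Rightarrow> ('f \<times> 'f \<times> 'f \<times> 'f \<Rightarrow> 'f) \<Rightarrow> ('f \<times> 'f \<times> 'f \<times> 'f \<Rightarrow> 'v) \<Rightarrow> 'r" where
  "quadric_weight x Q f = points_prod (\<lambda>v. if Q v = 0 then weight x (f v) else 1)"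

lemma wq_eq:
  "wq x d0 d1 d2 d3 d4 d5 d6 d7 d8 d9 = (\<Sum>c5\<in>A. \<Sum>c8\<in>A. \<Sum>c9\<in>A. \<Sum>c1\<in>A. \<Sum>c7\<in>A. \<Sum>c4\<in>A. \<Sum>c2\<in>A. \<Sum>c6\<in>A. \<Sum>c3\<in>A. \<Sum>c0\<in>A.
     quadric_weight x (qform d0 d1 d2 d3 d4 d5 d6 d7 d8 d9) (qmap c0 c1 c2 c3 c4 c5 c6 c7 c8 c9))"
  unfolding wq_def quadric_weight_def by (subst wt_eq[OF refl]) (rule sum_qmaps)

lemmas quadric_weight_simps = quadric_weight_def points_prod_def prod_field qform_def qmap_def

lemma weight_minus: "weight x (- a) = weight x (a :: 'v)"
  by (simp add: weight_def)

lemma quadric_weight_plane: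
  "quadric_weight x (qform 1 0 0 0 0 0 0 0 0 0) (qmap c0 c1 c2 c3 c4 c5 c6 c7 c8 c9) =
    line_weight x c5 c8 c9 * plane_weight x c5 c8 c9 c2 c4 c7"
  by (simp add: quadric_weight_simps line_weight_def plane_weight_def algebra_simps)

lemma quadric_weight_plane_pair:
  "quadric_weight x (qform 0 1 0 0 0 0 0 0 0 0) (qmap c0 c1 c2 c3 c4 c5 c6 c7 c8 c9) =
    line_weight x c5 c8 c9 * (plane_weight x c5 c8 c9 c2 c4 c7 * plane_weight x c5 c8 c9 c0 c3 c6)"
  by (simp add: quadric_weight_simps line_weight_def plane_weight_def algebra_simps)

text \<open>Since -1 is not a square, a^2 + b^2 = 0 only for a = b = 0, which leaves one
  line.\<close>

lemma quadric_weight_line: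
  "quadric_weight x (qform 1 0 1 0 0 0 0 0 0 0) (qmap c0 c1 c2 c3 c4 c5 c6 c7 c8 c9) = line_weight x c5 c8 c9"
  by (simp add: quadric_weight_simps line_weight_def algebra_simps)

definition generator_weight :: "'r::comm_ring_1 \<Rightarrow> 'v \<Rightarrow> 'v \<Rightarrow> 'v \<Rightarrow> 'r" where
  "generator_weight x v l q = weight x q * weight x (q + (v + l)) * weight x (q + (v - l))"

text \<open>The vertex is (0, 0, 0, 1). The conic a b = c^2 has the points (1, 0, 0), (0, 1, 0), (1,
  1, 1), (1, 1, -1), which give the four generators.\<close>

lemma quadric_weight_cone:
  "quadric_weight x (qform 0 1 0 0 0 (- 1) 0 0 0 0) (qmap c0 c1 c2 c3 c4 c5 c6 c7 c8 c9) =
    weight x c9 * (generator_weight x c9 c6 c0 * generator_weight x c9 c7 c2 *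
      (generator_weight x c9 (c6 + c7 + c8) ((c0 + c2 + c5 + c1) + (c4 + c3)) *
       generator_weight x c9 (c6 + c7 - c8) ((c0 + c2 + c5 + c1) - (c4 + c3))))"
  by (simp add: quadric_weight_simps generator_weight_def algebra_simps)

text \<open>One ruling of a b = c d consists of the lines (s, 0, t, 0), (0, t, 0, s), (s, t, t, s)
  and (s, -t, t, -s). The binary forms on the last two are the sum of those on the first two, plus
  and minus a third one.\<close>

lemma quadric_weight_grid:
  "quadric_weight x (qform 0 1 0 0 0 0 0 0 (- 1) 0) (qmap c0 c1 c2 c3 c4 c5 c6 c7 c8 c9) =
    line_weight x c0 c3 c5 * line_weight x c9 c7 c2 *
    (line_weight x (c0 + c9 + c6) (c3 + c7 + (c8 + c1)) (c5 + c2 + c4) *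
     line_weight x (c0 + c9 - c6) (c3 + c7 - (c8 + c1)) (c5 + c2 - c4))"
  by (simp add: quadric_weight_simps line_weight_def algebra_simps)

lemma quadric_weight_elliptic:
  "quadric_weight x (qform 0 1 0 0 0 1 0 0 0 1) (qmap c0 c1 c2 c3 c4 c5 c6 c7 c8 c9) =
    weight x c0 * weight x c2 *
     (weight x ((c0 - c1 + c2 + c5) + (c3 - c4)) * weight x ((c0 - c1 + c2 + c5) - (c3 - c4)) *
      (weight x ((c0 - c1 + c2 + c9) + (c6 - c7)) * weight x ((c0 - c1 + c2 + c9) - (c6 - c7))) *
      (weight x ((c0 + c1 + c2 + c5 + c9) + (c3 + c4) + (c6 + c7) + c8) *
       weight x ((c0 + c1 + c2 + c5 + c9) + (c3 + c4) - (c6 + c7) - c8) *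
       weight x ((c0 + c1 + c2 + c5 + c9) - (c3 + c4) + (c6 + c7) - c8) *
       weight x ((c0 + c1 + c2 + c5 + c9) - (c3 + c4) - (c6 + c7) + c8)))"
  by (simp add: quadric_weight_simps algebra_simps)


section \<open>Sums over all quadratic maps for each type\<close>

lemma sum_shift: "t \<in> A \<Longrightarrow> (\<Sum>c\<in>A. f (t + c)) = (\<Sum>c\<in>A. f c)"
  by (rule sum.reindex_bij_witness[of _ "\<lambda>c. c - t" "\<lambda>c. t + c"])
    (auto intro: add_in subspace_diff[OF subspace_A])

text \<open>Inverse of the map to sum and difference: p + q = 2 u = - u and p - q = 2 w = -
  w.\<close>

lemma sum_rotate: "(\<Sum>u\<in>A. \<Sum>w\<in>A. f (u + w) (u - w)) = (\<Sum>p\<in>A. \<Sum>q\<in>A. f p q)"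
  unfolding sum.cartesian_product
  by (rule sum.reindex_bij_witness[of _ "\<lambda>(p, q). (- (p + q), q - p)" "\<lambda>(u, w). (u + w, u - w)"])
    (auto intro!: in_A subspace_diff[OF subspace_A] simp: algebra_simps)

abbreviation T :: "'r::comm_ring_1" where "T \<equiv> of_nat (card A)"

text \<open>The four coefficients of the multiples of a do not matter on the plane a = 0, whence T ^
  4. For a pair of planes only the coefficient of a b is irrelevant, and for a line all but three
  are.\<close>

lemma wq_plane: "wq x 1 0 0 0 0 0 0 0 0 0 = T ^ 4 * (\<Sum>b0\<in>A. \<Sum>b1\<in>A. \<Sum>b2\<in>A. line_weight x b0 b1 b2 * plane_sum x b0 b1 b2)"
  unfolding wq_eq quadric_weight_plane plane_sum_def
  by (simp add: sum_distrib_left power4_eq_xxxx mult_ac)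

lemma wq_plane_pair:
  "wq x 0 1 0 0 0 0 0 0 0 0 = T * (\<Sum>b0\<in>A. \<Sum>b1\<in>A. \<Sum>b2\<in>A. line_weight x b0 b1 b2 * (plane_sum x b0 b1 b2 * plane_sum x b0 b1 b2))"
proof -
  have "(\<Sum>c7\<in>A. \<Sum>c4\<in>A. \<Sum>c2\<in>A. \<Sum>c6\<in>A. \<Sum>c3\<in>A. \<Sum>c0\<in>A. line_weight x b0 b1 b2 *
       (plane_weight x b0 b1 b2 c2 c4 c7 * plane_weight x b0 b1 b2 c0 c3 c6)) =
     line_weight x b0 b1 b2 * (plane_sum x b0 b1 b2 * plane_sum x b0 b1 b2)" for b0 b1 b2
    unfolding plane_sum_def by (simp only: sum_distrib_left[symmetric] sum_distrib_right[symmetric])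
  thus ?thesis
    unfolding wq_eq quadric_weight_plane_pair by (simp only: sum_constant) (simp only: sum_distrib_left)
qed

lemma wq_line: "wq x 1 0 1 0 0 0 0 0 0 0 = T ^ 7 * (\<Sum>b0\<in>A. \<Sum>b1\<in>A. \<Sum>b2\<in>A. line_weight x b0 b1 b2)"
  unfolding wq_eq quadric_weight_line
  by (simp add: sum_distrib_left power_numeral_reduce mult_ac)

lemma eval2_plane_poly_eq:
  "T * eval2 x T plane_poly = 80 * wq x 1 0 0 0 0 0 0 0 0 0 + 1560 * wq x 0 1 0 0 0 0 0 0 0 0 + 780 * wq x 1 0 1 0 0 0 0 0 0 0"
  unfolding eval2_plane_poly wq_plane wq_plane_pair wq_line
  by (simp add: sum_distrib_left sum.distrib ring_distribs power_numeral_reduce mult_ac)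


text \<open>The values at the four points of the conic are independent: for fixed c5 and c4 they run
  through A ^ 4 together with c0, c2, c1, c3. So the sum factors over the generators, and c5 and c4
  contribute T ^ 2.\<close>

lemma wq_cone: "wq x 0 1 0 0 0 (- 1) 0 0 0 0 = T ^ 2 * eval2 x T cone_poly"
proof -
  let ?g = "generator_weight x"
  have "wq x 0 1 0 0 0 (- 1) 0 0 0 0 = (\<Sum>c9\<in>A. \<Sum>c6\<in>A. \<Sum>c7\<in>A. \<Sum>c8\<in>A. \<Sum>c5\<in>A. \<Sum>c4\<in>A. \<Sum>c0\<in>A. \<Sum>c2\<in>A. \<Sum>c1\<in>A. \<Sum>c3\<in>A.
      weight x c9 * (?g c9 c6 c0 * ?g c9 c7 c2 *
      (?g c9 (c6 + c7 + c8) ((c0 + c2 + c5 + c1) + (c4 + c3)) *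
       ?g c9 (c6 + c7 - c8) ((c0 + c2 + c5 + c1) - (c4 + c3)))))"
    unfolding wq_eq quadric_weight_cone sum.cartesian_product
    by (rule sum.reindex_bij_witness[of _
       "\<lambda>(c9, c6, c7, c8, c5, c4, c0, c2, c1, c3). (c5, c8, c9, c1, c7, c4, c2, c6, c3, c0)"
       "\<lambda>(c5, c8, c9, c1, c7, c4, c2, c6, c3, c0). (c9, c6, c7, c8, c5, c4, c0, c2, c1, c3)"]) auto
  also have "\<dots> = (\<Sum>c9\<in>A. \<Sum>c6\<in>A. \<Sum>c7\<in>A. \<Sum>c8\<in>A. \<Sum>c5\<in>A. \<Sum>c4\<in>A.
      weight x c9 * (cone_sum x c9 c6 * cone_sum x c9 c7 * (cone_sum x c9 (c6 + c7 + c8) * cone_sum x c9 (c6 + c7 - c8))))"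
  proof (intro sum.cong refl)
    fix c9 c6 c7 c8 c5 c4
    assume in_As: "c9 \<in> A" "c6 \<in> A" "c7 \<in> A" "c8 \<in> A" "c5 \<in> A" "c4 \<in> A"
    \<comment> \<open>Shifts by elements of A do not change the sums over c1 and c3; then sum and
      difference are independent and the double sum becomes a product.\<close>
    have rot: "(\<Sum>c1\<in>A. \<Sum>c3\<in>A. g (t + c1 + (c4 + c3)) * h (t + c1 - (c4 + c3))) = (\<Sum>p\<in>A. g p) * (\<Sum>q\<in>A. h q)"
      if "t \<in> A" for t and g h :: "'v \<Rightarrow> 'a"
    proof -
      have "(\<Sum>c1\<in>A. \<Sum>c3\<in>A. g (t + c1 + (c4 + c3)) * h (t + c1 - (c4 + c3))) =
          (\<Sum>c1\<in>A. \<Sum>w\<in>A. g (t + c1 + w) * h (t + c1 - w))"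
        by (rule sum.cong[OF refl]) (rule sum_shift[OF in_As(6)])
      also have "\<dots> = (\<Sum>u\<in>A. \<Sum>w\<in>A. g (u + w) * h (u - w))"
        by (rule sum_shift[OF that])
      also have "\<dots> = (\<Sum>p\<in>A. \<Sum>q\<in>A. g p * h q)" by (rule sum_rotate)
      finally show ?thesis by (simp only: sum_product)
    qed
    have "(\<Sum>c0\<in>A. \<Sum>c2\<in>A. \<Sum>c1\<in>A. \<Sum>c3\<in>A. weight x c9 * (?g c9 c6 c0 * ?g c9 c7 c2 *
      (?g c9 (c6 + c7 + c8) ((c0 + c2 + c5 + c1) + (c4 + c3)) * ?g c9 (c6 + c7 - c8) ((c0 + c2 + c5 + c1) - (c4 + c3))))) =
      (\<Sum>c0\<in>A. \<Sum>c2\<in>A. weight x c9 * (?g c9 c6 c0 * ?g c9 c7 c2 *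
      (cone_sum x c9 (c6 + c7 + c8) * cone_sum x c9 (c6 + c7 - c8))))"
      unfolding sum_distrib_left[symmetric] cone_sum_def generator_weight_def[symmetric]
      by (intro sum.cong refl arg_cong2[where f = "(*)"] rot in_A in_As)
    also have "\<dots> = weight x c9 * (cone_sum x c9 c6 * cone_sum x c9 c7 * (cone_sum x c9 (c6 + c7 + c8) * cone_sum x c9 (c6 + c7 - c8)))"
      unfolding sum_distrib_left[symmetric] sum_distrib_right[symmetric]
      unfolding cone_sum_def generator_weight_def[symmetric] ..
    finally show "(\<Sum>c0\<in>A. \<Sum>c2\<in>A. \<Sum>c1\<in>A. \<Sum>c3\<in>A. weight x c9 * (?g c9 c6 c0 * ?g c9 c7 c2 *
      (?g c9 (c6 + c7 + c8) ((c0 + c2 + c5 + c1) + (c4 + c3)) * ?g c9 (c6 + c7 - c8) ((c0 + c2 + c5 + c1) - (c4 + c3))))) =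
      weight x c9 * (cone_sum x c9 c6 * cone_sum x c9 c7 * (cone_sum x c9 (c6 + c7 + c8) * cone_sum x c9 (c6 + c7 - c8)))" .
  qed
  also have "\<dots> = T ^ 2 * eval2 x T cone_poly"
    unfolding eval2_cone_poly by (simp only: sum_constant power2_eq_square mult.assoc sum_distrib_left)
  finally show ?thesis .
qed

lemma sum_reflect: "t \<in> A \<Longrightarrow> (\<Sum>c\<in>A. f c) = (\<Sum>c\<in>A. f (- (c + t)))"
  by (rule sum.reindex_bij_witness[of _ "\<lambda>c. - (c + t)" "\<lambda>c. - (c + t)"]) (auto intro: in_A subspace_diff[OF subspace_A])

lemma sum_translate: "t \<in> A \<Longrightarrow> (\<Sum>c\<in>A. f c) = (\<Sum>c\<in>A. f (c - t))"
  by (rule sum.reindex_bij_witness[of _ "\<lambda>c. c - t" "\<lambda>c. c + t"]) (auto intro!: in_A subspace_diff[OF subspace_A])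

lemma line_weight_minus: "line_weight x (- a) (- b) (- c) = line_weight x a b c"
proof -
  have "- a + - b + - c = - (a + b + c)" "- a - - b + - c = - (a - b + c)" by simp_all
  thus ?thesis unfolding line_weight_def by (simp only: weight_minus)
qed

text \<open>Replacing m by - (m + b) turns b + m into - m and b - m into - (b - m), by exponent 3;
  line weights ignore signs. So both pairs of lines of the ruling give the same sum.\<close>

lemma grid_sum_reflect:
  assumes "b0 \<in> A" "b1 \<in> A" "b2 \<in> A"
  shows "(\<Sum>m2\<in>A. \<Sum>m1\<in>A. \<Sum>m0\<in>A. line_weight x (b0 + m0) (b1 + m1) (b2 + m2) * line_weight x (b0 - m0) (b1 - m1) (b2 - m2)) =
    grid_sum x b0 b1 b2"
proof -
  have "line_weight x (b0 + - (m0 + b0)) (b1 + - (m1 + b1)) (b2 + - (m2 + b2)) *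
      line_weight x (b0 - - (m0 + b0)) (b1 - - (m1 + b1)) (b2 - - (m2 + b2)) =
    line_weight x m0 m1 m2 * line_weight x (b0 - m0) (b1 - m1) (b2 - m2)" for m0 m1 m2
  proof -
    have "b + - (m + b) = - m" "b - - (m + b) = - (b - m)" for b m :: 'v
      by (simp_all add: algebra_simps)
    thus ?thesis by (simp only: line_weight_minus)
  qed
  thus ?thesis
    unfolding grid_sum_def
    by (subst sum_reflect[OF assms(3)], subst sum_reflect[OF assms(2)], subst sum_reflect[OF assms(1)]) (simp only:)
qed

text \<open>For a fixed sum b of the binary forms on the first two lines, the other two lines carry
  b + m and b - m with m independent of the rest. The total is therefore a sum of squares of
  \<open>grid_sum\<close>. Only c8 + c1 matters, which gives the factor T.\<close>

lemma wq_grid: "wq x 0 1 0 0 0 0 0 0 (- 1) 0 = T * eval2 x T grid_poly"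
proof -
  let ?l = "line_weight x"
  have "wq x 0 1 0 0 0 0 0 0 (- 1) 0 = (\<Sum>c8\<in>A. \<Sum>c5\<in>A. \<Sum>c3\<in>A. \<Sum>c0\<in>A. \<Sum>c9\<in>A. \<Sum>c7\<in>A. \<Sum>c2\<in>A. \<Sum>c4\<in>A. \<Sum>c1\<in>A. \<Sum>c6\<in>A.
      ?l c0 c3 c5 * ?l c9 c7 c2 * (?l (c0 + c9 + c6) (c3 + c7 + (c8 + c1)) (c5 + c2 + c4) *
        ?l (c0 + c9 - c6) (c3 + c7 - (c8 + c1)) (c5 + c2 - c4)))"
    unfolding wq_eq quadric_weight_grid sum.cartesian_product
    by (rule sum.reindex_bij_witness[of _
       "\<lambda>(c8, c5, c3, c0, c9, c7, c2, c4, c1, c6). (c5, c8, c9, c1, c7, c4, c2, c6, c3, c0)"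
       "\<lambda>(c5, c8, c9, c1, c7, c4, c2, c6, c3, c0). (c8, c5, c3, c0, c9, c7, c2, c4, c1, c6)"]) auto
  also have "\<dots> = (\<Sum>c8\<in>A. \<Sum>c5\<in>A. \<Sum>c3\<in>A. \<Sum>c0\<in>A. \<Sum>c9\<in>A. \<Sum>c7\<in>A. \<Sum>c2\<in>A.
      ?l c0 c3 c5 * ?l c9 c7 c2 * grid_sum x (c0 + c9) (c3 + c7) (c5 + c2))"
  proof (intro sum.cong refl)
    fix c8 c5 c3 c0 c9 c7 c2
    assume in_As: "c8 \<in> A" "c5 \<in> A" "c3 \<in> A" "c0 \<in> A" "c9 \<in> A" "c7 \<in> A" "c2 \<in> A"
    have "(\<Sum>c4\<in>A. \<Sum>c1\<in>A. \<Sum>c6\<in>A. ?l (c0 + c9 + c6) (c3 + c7 + (c8 + c1)) (c5 + c2 + c4) *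
        ?l (c0 + c9 - c6) (c3 + c7 - (c8 + c1)) (c5 + c2 - c4)) =
      (\<Sum>c4\<in>A. \<Sum>c1\<in>A. \<Sum>c6\<in>A. ?l (c0 + c9 + c6) (c3 + c7 + c1) (c5 + c2 + c4) *
        ?l (c0 + c9 - c6) (c3 + c7 - c1) (c5 + c2 - c4))"
      by (rule sum.cong[OF refl], rule sum_shift[OF in_As(1), of "\<lambda>m. \<Sum>c6\<in>A. ?l (c0 + c9 + c6) (c3 + c7 + m) (c5 + c2 + _) *
        ?l (c0 + c9 - c6) (c3 + c7 - m) (c5 + c2 - _)"])
    also have "\<dots> = grid_sum x (c0 + c9) (c3 + c7) (c5 + c2)"
      by (intro grid_sum_reflect in_A in_As)
    finally show "(\<Sum>c4\<in>A. \<Sum>c1\<in>A. \<Sum>c6\<in>A. ?l c0 c3 c5 * ?l c9 c7 c2 * (?l (c0 + c9 + c6) (c3 + c7 + (c8 + c1)) (c5 + c2 + c4) *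
        ?l (c0 + c9 - c6) (c3 + c7 - (c8 + c1)) (c5 + c2 - c4))) =
      ?l c0 c3 c5 * ?l c9 c7 c2 * grid_sum x (c0 + c9) (c3 + c7) (c5 + c2)"
      by (simp only: sum_distrib_left[symmetric])
  qed
  also have "\<dots> = T * (\<Sum>c5\<in>A. \<Sum>c3\<in>A. \<Sum>c0\<in>A. \<Sum>c9\<in>A. \<Sum>c7\<in>A. \<Sum>c2\<in>A.
      ?l c0 c3 c5 * ?l c9 c7 c2 * grid_sum x (c0 + c9) (c3 + c7) (c5 + c2))"
    by (simp only: sum_constant)
  also have "(\<Sum>c5\<in>A. \<Sum>c3\<in>A. \<Sum>c0\<in>A. \<Sum>c9\<in>A. \<Sum>c7\<in>A. \<Sum>c2\<in>A.
      ?l c0 c3 c5 * ?l c9 c7 c2 * grid_sum x (c0 + c9) (c3 + c7) (c5 + c2)) =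
    (\<Sum>c5\<in>A. \<Sum>c3\<in>A. \<Sum>c0\<in>A. \<Sum>b0\<in>A. \<Sum>b1\<in>A. \<Sum>b2\<in>A.
      ?l c0 c3 c5 * ?l (b0 - c0) (b1 - c3) (b2 - c5) * grid_sum x b0 b1 b2)"
  proof (rule sum.cong[OF refl], rule sum.cong[OF refl], rule sum.cong[OF refl])
    fix c5 c3 c0 assume c: "c5 \<in> A" "c3 \<in> A" "c0 \<in> A"
    show "(\<Sum>c9\<in>A. \<Sum>c7\<in>A. \<Sum>c2\<in>A. ?l c0 c3 c5 * ?l c9 c7 c2 * grid_sum x (c0 + c9) (c3 + c7) (c5 + c2)) =
      (\<Sum>b0\<in>A. \<Sum>b1\<in>A. \<Sum>b2\<in>A. ?l c0 c3 c5 * ?l (b0 - c0) (b1 - c3) (b2 - c5) * grid_sum x b0 b1 b2)"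
      by (subst sum_translate[OF c(3)], subst sum_translate[OF c(2)], subst sum_translate[OF c(1)])
        (simp only: add.commute[of _ "_ - _"] diff_add_cancel)
  qed
  also have "\<dots> = (\<Sum>b0\<in>A. \<Sum>b1\<in>A. \<Sum>b2\<in>A. \<Sum>c5\<in>A. \<Sum>c3\<in>A. \<Sum>c0\<in>A.
      ?l c0 c3 c5 * ?l (b0 - c0) (b1 - c3) (b2 - c5) * grid_sum x b0 b1 b2)"
    unfolding sum.cartesian_product
    by (rule sum.reindex_bij_witness[of _ "\<lambda>(b0, b1, b2, c5, c3, c0). (c5, c3, c0, b0, b1, b2)"
        "\<lambda>(c5, c3, c0, b0, b1, b2). (b0, b1, b2, c5, c3, c0)"]) auto
  also have "\<dots> = eval2 x T grid_poly"
    unfolding eval2_grid_poly sum_distrib_right[symmetric] grid_sum_def ..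
  finally show ?thesis .
qed

text \<open>Sums and differences of c3, c4 and of c6, c7 separate the two pairs from the quadruple,
  whose offset is k + l - c0 - c2 in terms of the values c0, c2 and the offsets k, l of the pairs.
  Then c1 no longer occurs and gives the factor T.\<close>

lemma wq_elliptic: "wq x 0 1 0 0 0 1 0 0 0 1 = T * eval2 x T elliptic_poly"
proof -
  let ?w = "weight x"
  define q where "q = (\<lambda>r u v w :: 'v. ?w (r + u + v + w) * ?w (r + u - v - w) * ?w (r - u + v - w) * ?w (r - u - v + w))"
  define p where "p = (\<lambda>k u :: 'v. ?w (k + u) * ?w (k - u))"
  have "wq x 0 1 0 0 0 1 0 0 0 1 = (\<Sum>c0\<in>A. \<Sum>c2\<in>A. \<Sum>c1\<in>A. \<Sum>c5\<in>A. \<Sum>c9\<in>A. \<Sum>c8\<in>A. \<Sum>c6\<in>A. \<Sum>c7\<in>A. \<Sum>c3\<in>A. \<Sum>c4\<in>A.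
      ?w c0 * ?w c2 * (p (c0 - c1 + c2 + c5) (c3 - c4) * p (c0 - c1 + c2 + c9) (c6 - c7) *
        q (c0 + c1 + c2 + c5 + c9) (c3 + c4) (c6 + c7) c8))"
    unfolding wq_eq quadric_weight_elliptic sum.cartesian_product p_def q_def
    by (rule sum.reindex_bij_witness[of _
       "\<lambda>(c0, c2, c1, c5, c9, c8, c6, c7, c3, c4). (c5, c8, c9, c1, c7, c4, c2, c6, c3, c0)"
       "\<lambda>(c5, c8, c9, c1, c7, c4, c2, c6, c3, c0). (c0, c2, c1, c5, c9, c8, c6, c7, c3, c4)"]) auto
  also have "\<dots> = (\<Sum>c0\<in>A. \<Sum>c2\<in>A. \<Sum>c1\<in>A. \<Sum>c5\<in>A. \<Sum>c9\<in>A.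
      ?w c0 * ?w c2 * (pair_sum x (c0 - c1 + c2 + c5) * pair_sum x (c0 - c1 + c2 + c9) *
        quadruple_sum x (c0 + c1 + c2 + c5 + c9)))"
  proof (intro sum.cong refl)
    fix c0 c2 c1 c5 c9 :: 'v
    let ?k = "c0 - c1 + c2 + c5" and ?l = "c0 - c1 + c2 + c9" and ?r = "c0 + c1 + c2 + c5 + c9"
    have "(\<Sum>c8\<in>A. \<Sum>c6\<in>A. \<Sum>c7\<in>A. \<Sum>c3\<in>A. \<Sum>c4\<in>A. ?w c0 * ?w c2 * (p ?k (c3 - c4) * p ?l (c6 - c7) * q ?r (c3 + c4) (c6 + c7) c8)) =
      (\<Sum>c8\<in>A. \<Sum>c6\<in>A. \<Sum>c7\<in>A. \<Sum>u\<in>A. \<Sum>u'\<in>A. ?w c0 * ?w c2 * (p ?k u' * p ?l (c6 - c7) * q ?r u (c6 + c7) c8))"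
      by (rule sum.cong[OF refl], rule sum.cong[OF refl], rule sum.cong[OF refl], rule sum_rotate)
    also have "\<dots> = (\<Sum>c8\<in>A. \<Sum>v\<in>A. \<Sum>v'\<in>A. \<Sum>u\<in>A. \<Sum>u'\<in>A. ?w c0 * ?w c2 * (p ?k u' * p ?l v' * q ?r u v c8))"
      by (rule sum.cong[OF refl]) (rule sum_rotate)
    also have "\<dots> = (\<Sum>u'\<in>A. \<Sum>v'\<in>A. \<Sum>c8\<in>A. \<Sum>v\<in>A. \<Sum>u\<in>A. ?w c0 * ?w c2 * (p ?k u' * p ?l v' * q ?r u v c8))"
      unfolding sum.cartesian_product
      by (rule sum.reindex_bij_witness[of _ "\<lambda>(u', v', c8, v, u). (c8, v, v', u, u')" "\<lambda>(c8, v, v', u, u'). (u', v', c8, v, u)"]) auto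
    also have "\<dots> = ?w c0 * ?w c2 * (pair_sum x ?k * pair_sum x ?l * quadruple_sum x ?r)"
      unfolding pair_sum_def quadruple_sum_def p_def q_def
      by (simp only: sum_distrib_left[symmetric] sum_distrib_right[symmetric])
    finally show "(\<Sum>c8\<in>A. \<Sum>c6\<in>A. \<Sum>c7\<in>A. \<Sum>c3\<in>A. \<Sum>c4\<in>A. ?w c0 * ?w c2 * (p ?k (c3 - c4) * p ?l (c6 - c7) * q ?r (c3 + c4) (c6 + c7) c8)) =
      ?w c0 * ?w c2 * (pair_sum x ?k * pair_sum x ?l * quadruple_sum x ?r)" .
  qed
  also have "\<dots> = (\<Sum>c0\<in>A. \<Sum>c2\<in>A. \<Sum>c1\<in>A. \<Sum>k\<in>A. \<Sum>l\<in>A.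
      ?w c0 * ?w c2 * (pair_sum x k * pair_sum x l * quadruple_sum x (k + l - c0 - c2)))"
  proof (rule sum.cong[OF refl], rule sum.cong[OF refl], rule sum.cong[OF refl])
    fix c0 c2 c1 assume c: "c0 \<in> A" "c2 \<in> A" "c1 \<in> A"
    let ?t = "c0 - c1 + c2"
    have t: "?t \<in> A" using c by (intro in_A subspace_diff[OF subspace_A])
    \<comment> \<open>Here c1 is eliminated: by exponent 3, twice \<open>?t\<close> is -
      \<open>?t\<close>.\<close>
    have "c0 + c1 + c2 + c5 + c9 = (?t + c5) + (?t + c9) - c0 - c2" for c5 c9
      by (simp add: algebra_simps)
    hence "(\<Sum>c5\<in>A. \<Sum>c9\<in>A. ?w c0 * ?w c2 * (pair_sum x (?t + c5) * pair_sum x (?t + c9) * quadruple_sum x (c0 + c1 + c2 + c5 + c9))) =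
        (\<Sum>c5\<in>A. \<Sum>c9\<in>A. ?w c0 * ?w c2 * (pair_sum x (?t + c5) * pair_sum x (?t + c9) * quadruple_sum x ((?t + c5) + (?t + c9) - c0 - c2)))"
      by (simp only:)
    also have "\<dots> = (\<Sum>c5\<in>A. \<Sum>l\<in>A. ?w c0 * ?w c2 * (pair_sum x (?t + c5) * pair_sum x l * quadruple_sum x ((?t + c5) + l - c0 - c2)))"
      by (rule sum.cong[OF refl], rule sum_shift[OF t])
    also have "\<dots> = (\<Sum>k\<in>A. \<Sum>l\<in>A. ?w c0 * ?w c2 * (pair_sum x k * pair_sum x l * quadruple_sum x (k + l - c0 - c2)))"
      by (rule sum_shift[OF t])
    finally show "(\<Sum>c5\<in>A. \<Sum>c9\<in>A. ?w c0 * ?w c2 * (pair_sum x (?t + c5) * pair_sum x (?t + c9) * quadruple_sum x (c0 + c1 + c2 + c5 + c9))) =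
        (\<Sum>k\<in>A. \<Sum>l\<in>A. ?w c0 * ?w c2 * (pair_sum x k * pair_sum x l * quadruple_sum x (k + l - c0 - c2)))" .
  qed
  also have "\<dots> = T * eval2 x T elliptic_poly"
    unfolding eval2_elliptic_poly by (simp only: sum_constant sum_distrib_left)
  finally show ?thesis .
qed

lemma sum_wq_poly:
  "(\<Sum>(k, (l1, l2, l3), (c2, c4, c5, c7, c8, c9))\<in>UNIV. wq x k l1 c2 l2 c4 c5 l3 c7 c8 c9) =
    wq x 0 0 0 0 0 0 0 0 0 0 + eval2 x T quadric_sum_poly"
  unfolding sum_wq_types quadric_sum_poly_def
  by (simp add: ring_distribs eval2_plane_poly_eq wq_cone wq_grid wq_elliptic power2_eq_square mult_ac)

end

section \<open>Ranks and annihilators\<close>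

lemma card_vec_prefix_zero:
  assumes "finite (UNIV :: 'f::field set)" "r \<le> n"
  shows "card {y \<in> carrier_vec n. \<forall>i<r. y $ i = (0 :: 'f)} = CARD('f) ^ (n - r)"
proof -
  have "bij_betw (\<lambda>f. vec n (\<lambda>i. if i < r then 0 else f i)) ({r..<n} \<rightarrow>\<^sub>E (UNIV :: 'f set))
      {y \<in> carrier_vec n. \<forall>i<r. y $ i = 0}"
  proof (rule bij_betw_byWitness[where f' = "\<lambda>y. restrict (($) y) {r..<n}"], goal_cases)
    case 1
    thus ?case by (auto simp: fun_eq_iff restrict_def PiE_def extensional_def)
  next
    case 2
    thus ?case by (auto intro!: eq_vecI)
  qed (use assms in auto)
  thus ?thesis using bij_betw_same_card card_PiE[of "{r..<n}" "\<lambda>_. UNIV :: 'f set"] by fastforce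
qed

text \<open>A maximal independent set of columns, extended to a basis, gives an invertible matrix.
  Its transpose maps the annihilator bijectively onto the vectors whose first \<open>rank M\<close>
  entries vanish.\<close>

lemma (in vec_space) card_annihilator:
  assumes fin: "finite (UNIV :: 'a set)" and M: "M \<in> carrier_mat n nc"
  shows "card {c \<in> carrier_vec n. \<forall>v\<in>set (cols M). c \<bullet> v = 0} = CARD('a) ^ (n - rank M)" "rank M \<le> n"
proof -
  have cols: "set (cols M) \<subseteq> carrier_vec n" using cols_dim M by blast
  have finV: "finite (carrier_vec n :: 'a vec set)"
  proof -
    have "{y \<in> carrier_vec n. \<forall>i<0. y $ i = (0::'a)} = carrier_vec n" by auto
    moreover have "0 < CARD('a) ^ (n - 0)" using fin by (simp add: card_gt_0_iff)
    ultimately show ?thesis using card_vec_prefix_zero[OF fin, of 0 n] by (metis card.infinite less_numeral_extra(3) zero_le)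
  qed
  obtain S where S: "maximal S (\<lambda>T. T \<subseteq> set (cols M) \<and> lin_indpt T)"
  proof -
    have "lin_indpt {}" using lindep_span[of "{}"] by (auto simp: lin_dep_def)
    thus ?thesis using maximal_exists_superset[of "set (cols M)" "\<lambda>T. T \<subseteq> set (cols M) \<and> lin_indpt T" "{}"] that by auto
  qed
  hence S_sub: "S \<subseteq> set (cols M)" and S_li: "lin_indpt S" by (auto simp: maximal_def)
  have rank: "rank M = card S" by (rule rank_card_indpt[OF M S])
  have S_car: "S \<subseteq> carrier_vec n" using S_sub cols by blast
  have S_fin: "finite S" using S_sub finite_subset by blast
  have ann: "{c \<in> carrier_vec n. \<forall>v\<in>set (cols M). c \<bullet> v = 0} = {c \<in> carrier_vec n. \<forall>v\<in>S. c \<bullet> v = 0}"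
  proof -
    have "set (cols M) \<subseteq> span S"
    proof
      fix v assume v: "v \<in> set (cols M)"
      show "v \<in> span S"
      proof (cases "v \<in> S")
        case True
        thus ?thesis using in_own_span[of S] S_car by auto
      next
        case False
        have "lin_dep (insert v S)"
        proof (rule ccontr)
          assume "\<not> lin_dep (insert v S)"
          hence "insert v S = S" using S S_sub v unfolding maximal_def by blast
          thus False using False by blast
        qed
        thus ?thesis using lin_dep_iff_in_span[of S v] S_li S_car v cols False by auto
      qed
    qed
    moreover have "c \<bullet> v = 0" if "c \<in> carrier_vec n" "\<forall>v\<in>S. c \<bullet> v = 0" "v \<in> span S" for c v
    proof -
      have "v \<in> carrier_vec n" using that(3) S_car span_is_subset2 by auto
      have "c \<in> orthogonal_complement S" using that(1,2) by (simp add: orthogonal_complement_def)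
      hence "c \<in> orthogonal_complement (span S)" using S_car by simp
      thus ?thesis using that(3) by (simp add: orthogonal_complement_def)
    qed
    ultimately show ?thesis using S_sub by blast
  qed
  obtain C where C: "maximal C (\<lambda>T. T \<subseteq> carrier_vec n \<and> lin_indpt T)" "S \<subseteq> C" "finite C"
    using maximal_exists_superset[OF finV, of "\<lambda>T. T \<subseteq> carrier_vec n \<and> lin_indpt T" S] S_car S_li by auto
  have C_car: "C \<subseteq> carrier_vec n" and C_li: "lin_indpt C" using C(1) by (auto simp: maximal_def)
  have "basis C" by (rule max_li_is_basis) (use C(1) in simp)
  hence cardC: "card C = n" using dim_basis[of C] C(3) dim_is_n by simp
  show le: "rank M \<le> n" using rank cardC C card_mono by metis
  obtain ss ds where ss: "set ss = S" "distinct ss" and ds: "set ds = C - S" "distinct ds"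
    using S_fin C(3) finite_distinct_list[of S] finite_distinct_list[of "C - S"] by auto
  have len: "length ss = rank M" using ss rank distinct_card by fastforce
  \<comment> \<open>The independent columns come first, so that the annihilator conditions become
    conditions on a prefix.\<close>
  define P where "P = mat_of_cols n (ss @ ds)"
  have len_all: "length (ss @ ds) = n"
    using ss ds cardC C(2) distinct_card[of "ss @ ds"] by (metis Diff_disjoint Un_Diff_cancel distinct_append set_append sup.absorb2)
  have P: "P \<in> carrier_mat n n" unfolding P_def using len_all by auto
  have set_all: "set (ss @ ds) = C" using ss ds C(2) by auto
  have cols_P: "cols P = ss @ ds" unfolding P_def by (rule cols_mat_of_cols) (use set_all C_car in auto)
  have "rank P = n"
    by (rule lin_indpt_full_rank[OF P]) (use cols_P set_all C_li ss ds in auto)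
  hence "det P \<noteq> 0" using det_rank_iff[OF P] by simp
  hence "det P\<^sup>T \<noteq> 0" using det_transpose[OF P] by simp
  hence ker: "v = 0\<^sub>v n" if "v \<in> carrier_vec n" "P\<^sup>T *\<^sub>v v = 0\<^sub>v n" for v
    using det_0_iff_vec_prod_zero_field[of "P\<^sup>T" n] P that by auto
  have PT: "P\<^sup>T \<in> carrier_mat n n" using P by simp
  have inj: "inj_on (\<lambda>c. P\<^sup>T *\<^sub>v c) (carrier_vec n)"
  proof (rule inj_onI)
    fix u v :: "'a vec" assume uv: "u \<in> carrier_vec n" "v \<in> carrier_vec n" "P\<^sup>T *\<^sub>v u = P\<^sup>T *\<^sub>v v"
    have "P\<^sup>T *\<^sub>v (u - v) = P\<^sup>T *\<^sub>v u - P\<^sup>T *\<^sub>v v" by (rule mult_minus_distrib_mat_vec[OF PT uv(1,2)])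
    also have "\<dots> = 0\<^sub>v n" using uv PT by auto
    finally have "u - v = 0\<^sub>v n" using ker uv by auto
    thus "u = v" using uv by (metis carrier_vecD minus_cancel_vec minus_add_uminus_vec eq_vecI index_minus_vec(1) index_zero_vec(1) right_minus_eq)
  qed
  have surj: "(\<lambda>c. P\<^sup>T *\<^sub>v c) ` carrier_vec n = carrier_vec n"
    by (rule endo_inj_surj[OF finV _ inj]) (use PT in auto)
  have row: "(P\<^sup>T *\<^sub>v c) $ i = c \<bullet> (ss @ ds) ! i" if "c \<in> carrier_vec n" "i < n" for c i
  proof -
    have "(ss @ ds) ! i \<in> carrier_vec n" using that len_all set_all C_car by (metis nth_mem subsetD)
    moreover have "col P i = (ss @ ds) ! i" using that cols_P P cols_nth[of i P] by auto
    ultimately show ?thesis using P that by (simp add: comm_scalar_prod[of c n])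
  qed
  have "(\<lambda>c. P\<^sup>T *\<^sub>v c) ` {c \<in> carrier_vec n. \<forall>v\<in>S. c \<bullet> v = 0} = {y \<in> carrier_vec n. \<forall>i<rank M. y $ i = 0}"
  proof -
    have "(\<forall>v\<in>S. c \<bullet> v = 0) \<longleftrightarrow> (\<forall>i<rank M. (P\<^sup>T *\<^sub>v c) $ i = 0)" if "c \<in> carrier_vec n" for c
    proof -
      have "(\<forall>v\<in>S. c \<bullet> v = 0) \<longleftrightarrow> (\<forall>i<rank M. c \<bullet> ss ! i = 0)"
        unfolding ss(1)[symmetric] all_set_conv_all_nth len ..
      also have "\<dots> \<longleftrightarrow> (\<forall>i<rank M. (P\<^sup>T *\<^sub>v c) $ i = 0)"
        using row[OF that] le len by (auto simp: nth_append)
      finally show ?thesis .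
    qed
    hence "{c \<in> carrier_vec n. \<forall>v\<in>S. c \<bullet> v = 0} = {c \<in> carrier_vec n. \<forall>i<rank M. (P\<^sup>T *\<^sub>v c) $ i = 0}" by auto
    also have "(\<lambda>c. P\<^sup>T *\<^sub>v c) ` \<dots> = {y \<in> (\<lambda>c. P\<^sup>T *\<^sub>v c) ` carrier_vec n. \<forall>i<rank M. y $ i = 0}" by auto
    finally show ?thesis unfolding surj .
  qed
  moreover have "inj_on (\<lambda>c. P\<^sup>T *\<^sub>v c) {c \<in> carrier_vec n. \<forall>v\<in>S. c \<bullet> v = 0}"
    by (rule inj_on_subset[OF inj]) auto
  ultimately have "card {c \<in> carrier_vec n. \<forall>v\<in>S. c \<bullet> v = 0} = card {y \<in> carrier_vec n. \<forall>i<rank M. y $ i = (0::'a)}"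
    using card_image by fastforce
  thus "card {c \<in> carrier_vec n. \<forall>v\<in>set (cols M). c \<bullet> v = 0} = CARD('a) ^ (n - rank M)"
    unfolding ann using card_vec_prefix_zero[OF fin le] by simp
qed

section \<open>Tuples of quadratic forms\<close>

lemma bij_betw_Collect: "bij_betw h A B \<Longrightarrow> bij_betw h {a \<in> A. P (h a)} {b \<in> B. P b}"
  by (auto simp: bij_betw_def intro: inj_on_subset)

definition tuple_scale :: "'f::field \<Rightarrow> (nat \<Rightarrow> 'f) \<Rightarrow> nat \<Rightarrow> 'f" where
  "tuple_scale k a = (\<lambda>i. k * a i)"

text \<open>Tuples are padded with zeros, so that all lengths live in one type and a tuple is
  extended by updating a function.\<close>

definition tuple_space :: "nat \<Rightarrow> (nat \<Rightarrow> 'f::field) set" where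
  "tuple_space m = {a. \<forall>i\<ge>m. a i = 0}"

lemma finite_card_tuple_space:
  assumes "CARD('f::field) = 3"
  shows "finite (tuple_space m :: (nat \<Rightarrow> 'f) set)" "card (tuple_space m :: (nat \<Rightarrow> 'f) set) = 3 ^ m"
proof -
  have fin: "finite (UNIV :: 'f set)" using assms by (metis card.infinite zero_neq_numeral)
  have bij: "bij_betw (\<lambda>f i. if i < m then f i else 0) ({..<m} \<rightarrow>\<^sub>E (UNIV :: 'f set)) (tuple_space m)"
  proof (rule bij_betw_byWitness[where f' = "\<lambda>a. restrict a {..<m}"])
    show "\<forall>f\<in>{..<m} \<rightarrow>\<^sub>E UNIV. restrict (\<lambda>i. if i < m then f i else (0 :: 'f)) {..<m} = f"
    proof
      fix f assume "f \<in> {..<m} \<rightarrow>\<^sub>E (UNIV :: 'f set)"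
      thus "restrict (\<lambda>i. if i < m then f i else 0) {..<m} = f"
        by (intro ext) (simp add: restrict_def PiE_arb[of f "{..<m}"])
    qed
    show "\<forall>a\<in>tuple_space m. (\<lambda>i. if i < m then restrict a {..<m} i else (0 :: 'f)) = a"
    proof
      fix a :: "nat \<Rightarrow> 'f" assume "a \<in> tuple_space m"
      thus "(\<lambda>i. if i < m then restrict a {..<m} i else 0) = a"
        by (intro ext) (simp add: tuple_space_def)
    qed
    show "(\<lambda>f i. if i < m then f i else 0) ` ({..<m} \<rightarrow>\<^sub>E UNIV) \<subseteq> (tuple_space m :: (nat \<Rightarrow> 'f) set)"
      unfolding tuple_space_def by (intro image_subsetI CollectI allI impI) simp
    show "(\<lambda>a. restrict a {..<m}) ` tuple_space m \<subseteq> {..<m} \<rightarrow>\<^sub>E (UNIV :: 'f set)"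
      by (intro image_subsetI) simp
  qed
  have "finite ({..<m} \<rightarrow>\<^sub>E (UNIV :: 'f set))" using fin by (intro finite_PiE) auto
  thus "finite (tuple_space m :: (nat \<Rightarrow> 'f) set)" using bij bij_betw_finite by blast
  show "card (tuple_space m :: (nat \<Rightarrow> 'f) set) = 3 ^ m"
    using bij_betw_same_card[OF bij] assms by (simp add: card_PiE)
qed

lemma ternary_space_tuples:
  assumes "CARD('f::field) = 3"
  shows "ternary_space (tuple_scale :: 'f \<Rightarrow> _) (tuple_space m)"
proof -
  interpret vector_space "tuple_scale :: 'f \<Rightarrow> _"
    by unfold_locales (auto simp: tuple_scale_def fun_eq_iff algebra_simps)
  show ?thesis
    by unfold_locales
      (simp_all add: assms finite_card_tuple_space[OF assms],
       auto simp: subspace_def tuple_space_def tuple_scale_def)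
qed

lemma ternary_space_field:
  assumes "CARD('f::field) = 3"
  shows "ternary_space ((*) :: 'f \<Rightarrow> _) UNIV"
proof -
  interpret vector_space "(*) :: 'f \<Rightarrow> _"
    by unfold_locales (auto simp: algebra_simps)
  show ?thesis
    by unfold_locales (use assms in \<open>auto simp: subspace_def intro: card_ge_0_finite\<close>)
qed

text \<open>Grouped as in the classification: the square of the first variable, its mixed terms, and
  the form in the last three variables.\<close>

type_synonym 'f coeffs = "'f \<times> ('f \<times> 'f \<times> 'f) \<times> ('f \<times> 'f \<times> 'f \<times> 'f \<times> 'f \<times> 'f)"

definition form_of :: "'f::field coeffs \<Rightarrow> 'f \<times> 'f \<times> 'f \<times> 'f \<Rightarrow> 'f" where
  "form_of = (\<lambda>(k, (l1, l2, l3), (c2, c4, c5, c7, c8, c9)). qform k l1 c2 l2 c4 c5 l3 c7 c8 c9)"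

definition tuple_forms :: "nat \<Rightarrow> ('f::field \<times> 'f \<times> 'f \<times> 'f \<Rightarrow> nat \<Rightarrow> 'f) set" where
  "tuple_forms m = ternary_space.qmaps tuple_scale (tuple_space m)"

definition tuple_enumerator :: "'f::field itself \<Rightarrow> nat \<Rightarrow> 'r::comm_ring_1 \<Rightarrow> 'r" where
  "tuple_enumerator t m x =
     (\<Sum>f\<in>(tuple_forms m :: ('f \<times> 'f \<times> 'f \<times> 'f \<Rightarrow> nat \<Rightarrow> 'f) set). x ^ zero_points (\<lambda>v. f v = 0))"

context
  fixes dummy :: "'f::field itself"
  assumes card3: "CARD('f) = 3"
begin

interpretation S: ternary_space "tuple_scale :: 'f \<Rightarrow> _" "tuple_space m" for m
  by (rule ternary_space_tuples[OF card3])

interpretation F: ternary_space "(*) :: 'f \<Rightarrow> _" UNIV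
  by (rule ternary_space_field[OF card3])

lemma qform_eq_qmap: "(qform :: 'f \<Rightarrow> _) = F.qmap"
  by (intro ext) (simp add: qform_def F.qmap_def)

lemma inj_form_of: "inj (form_of :: 'f coeffs \<Rightarrow> _)"
proof (rule injI)
  fix c d :: "'f coeffs" assume eq: "form_of c = form_of d"
  obtain k l1 l2 l3 c2 c4 c5 c7 c8 c9 where c: "c = (k, (l1, l2, l3), (c2, c4, c5, c7, c8, c9))" by (metis prod.exhaust)
  obtain k' l1' l2' l3' d2 d4 d5 d7 d8 d9 where d: "d = (k', (l1', l2', l3'), (d2, d4, d5, d7, d8, d9))" by (metis prod.exhaust)
  from eq have "F.qmap k l1 c2 l2 c4 c5 l3 c7 c8 c9 = F.qmap k' l1' d2 l2' d4 d5 l3' d7 d8 d9"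
    unfolding c d form_of_def qform_eq_qmap split .
  from F.qmap_inject[OF this] show "c = d" unfolding c d by (simp only:)
qed

lemma qmap_apply:
  "S.qmap c0 c1 c2 c3 c4 c5 c6 c7 c8 c9 v i =
    qform (c0 i) (c1 i) (c2 i) (c3 i) (c4 i) (c5 i) (c6 i) (c7 i) (c8 i) (c9 i) v"
  unfolding S.qmap_def qform_def tuple_scale_def
  by (cases v rule: prod_cases4) (simp only: split plus_fun_apply)

lemma tuple_formsE:
  assumes "f \<in> (tuple_forms m :: ('f \<times> 'f \<times> 'f \<times> 'f \<Rightarrow> nat \<Rightarrow> 'f) set)"
  obtains c0 c1 c2 c3 c4 c5 c6 c7 c8 c9 where "f = S.qmap c0 c1 c2 c3 c4 c5 c6 c7 c8 c9"
    "c0 \<in> tuple_space m" "c1 \<in> tuple_space m" "c2 \<in> tuple_space m" "c3 \<in> tuple_space m" "c4 \<in> tuple_space m"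
    "c5 \<in> tuple_space m" "c6 \<in> tuple_space m" "c7 \<in> tuple_space m" "c8 \<in> tuple_space m" "c9 \<in> tuple_space m"
proof -
  obtain t where t: "t \<in> tuple_space m \<times> tuple_space m \<times> tuple_space m \<times> tuple_space m \<times> tuple_space m \<times> tuple_space m \<times> tuple_space m \<times> tuple_space m \<times> tuple_space m \<times> tuple_space m"
   "f = (\<lambda>(c5, c8, c9, c1, c7, c4, c2, c6, c3, c0). S.qmap c0 c1 c2 c3 c4 c5 c6 c7 c8 c9) t"
    using assms unfolding tuple_forms_def S.qmaps_def by (rule imageE)
  obtain c5 c8 c9 c1 c7 c4 c2 c6 c3 c0 where "t = (c5, c8, c9, c1, c7, c4, c2, c6, c3, c0)" by (metis prod.exhaust)
  thus ?thesis using t that[of c0 c1 c2 c3 c4 c5 c6 c7 c8 c9] by (simp only: mem_Sigma_iff split)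
qed

lemma tuple_forms_zero:
  assumes "f \<in> (tuple_forms m :: ('f \<times> 'f \<times> 'f \<times> 'f \<Rightarrow> nat \<Rightarrow> 'f) set)" "i \<ge> m"
  shows "f v i = 0"
proof -
  obtain c0 c1 c2 c3 c4 c5 c6 c7 c8 c9 where f: "f = S.qmap c0 c1 c2 c3 c4 c5 c6 c7 c8 c9"
    and c: "c0 \<in> tuple_space m" "c1 \<in> tuple_space m" "c2 \<in> tuple_space m" "c3 \<in> tuple_space m" "c4 \<in> tuple_space m"
    "c5 \<in> tuple_space m" "c6 \<in> tuple_space m" "c7 \<in> tuple_space m" "c8 \<in> tuple_space m" "c9 \<in> tuple_space m"
    by (rule tuple_formsE[OF assms(1)], rule that)
  have "c i = 0" if "c \<in> tuple_space m" for c :: "nat \<Rightarrow> 'f" using that assms(2) unfolding tuple_space_def by blast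
  note z = c[THEN this]
  show ?thesis unfolding f qmap_apply z by (cases v rule: prod_cases4) (simp add: qform_def)
qed

lemma bij_tuple_forms_Suc:
  "bij_betw (\<lambda>(c, f) v. (f v)(m := form_of c v)) (UNIV \<times> (tuple_forms m :: ('f \<times> 'f \<times> 'f \<times> 'f \<Rightarrow> nat \<Rightarrow> 'f) set))
     (tuple_forms (Suc m))"
  unfolding bij_betw_def
proof
  show "inj_on (\<lambda>(c, f) v. (f v)(m := form_of c v)) (UNIV \<times> (tuple_forms m :: ('f \<times> 'f \<times> 'f \<times> 'f \<Rightarrow> nat \<Rightarrow> 'f) set))"
  proof (rule inj_onI, clarify del: ext)
    fix c d and f g :: "'f \<times> 'f \<times> 'f \<times> 'f \<Rightarrow> nat \<Rightarrow> 'f"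
    assume fg: "f \<in> tuple_forms m" "g \<in> tuple_forms m"
      and eq: "(\<lambda>v. (f v)(m := form_of c v)) = (\<lambda>v. (g v)(m := form_of d v))"
    have ev: "((f v)(m := form_of c v)) i = ((g v)(m := form_of d v)) i" for v i using eq by (metis fun_cong)
    have "form_of c = form_of d" using ev[of _ m] by (auto simp: fun_eq_iff)
    hence "c = d" using inj_form_of by (simp add: inj_eq)
    moreover have "f v i = g v i" for v i
      using ev[of v i] tuple_forms_zero[OF fg(1)] tuple_forms_zero[OF fg(2)] by (cases "i = m") auto
    ultimately show "c = d \<and> f = g" by blast
  qed
  show "(\<lambda>(c, f) v. (f v)(m := form_of c v)) ` (UNIV \<times> (tuple_forms m :: ('f \<times> 'f \<times> 'f \<times> 'f \<Rightarrow> nat \<Rightarrow> 'f) set)) = tuple_forms (Suc m)"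
  proof (intro equalityI subsetI)
    fix h :: "'f \<times> 'f \<times> 'f \<times> 'f \<Rightarrow> nat \<Rightarrow> 'f"
    assume "h \<in> (\<lambda>(c, f) v. (f v)(m := form_of c v)) ` (UNIV \<times> tuple_forms m)"
    then obtain c f where h: "h = (\<lambda>v. (f v)(m := form_of c v))" and f: "f \<in> tuple_forms m" by auto
    obtain k l1 l2 l3 d2 d4 d5 d7 d8 d9 where c: "c = (k, (l1, l2, l3), (d2, d4, d5, d7, d8, d9))" by (cases c) auto
    obtain c0 c1 c2 c3 c4 c5 c6 c7 c8 c9 where f': "f = S.qmap c0 c1 c2 c3 c4 c5 c6 c7 c8 c9"
      "c0 \<in> tuple_space m" "c1 \<in> tuple_space m" "c2 \<in> tuple_space m" "c3 \<in> tuple_space m" "c4 \<in> tuple_space m"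
      "c5 \<in> tuple_space m" "c6 \<in> tuple_space m" "c7 \<in> tuple_space m" "c8 \<in> tuple_space m" "c9 \<in> tuple_space m"
      by (rule tuple_formsE[OF f], rule that)
    have "h = S.qmap (c0(m := k)) (c1(m := l1)) (c2(m := d2)) (c3(m := l2)) (c4(m := d4)) (c5(m := d5))
        (c6(m := l3)) (c7(m := d7)) (c8(m := d8)) (c9(m := d9))"
      by (intro ext) (simp add: h f'(1) qmap_apply c form_of_def)
    also have "\<dots> \<in> tuple_forms (Suc m)"
      unfolding tuple_forms_def by (intro S.qmap_in_qmaps) (use f'(2-) in \<open>auto simp: tuple_space_def\<close>)
    finally show "h \<in> tuple_forms (Suc m)" .
  next
    fix h :: "'f \<times> 'f \<times> 'f \<times> 'f \<Rightarrow> nat \<Rightarrow> 'f"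
    assume hS: "h \<in> tuple_forms (Suc m)"
    obtain c0 c1 c2 c3 c4 c5 c6 c7 c8 c9 where h: "h = S.qmap c0 c1 c2 c3 c4 c5 c6 c7 c8 c9"
      "c0 \<in> tuple_space (Suc m)" "c1 \<in> tuple_space (Suc m)" "c2 \<in> tuple_space (Suc m)" "c3 \<in> tuple_space (Suc m)"
      "c4 \<in> tuple_space (Suc m)" "c5 \<in> tuple_space (Suc m)" "c6 \<in> tuple_space (Suc m)" "c7 \<in> tuple_space (Suc m)"
      "c8 \<in> tuple_space (Suc m)" "c9 \<in> tuple_space (Suc m)"
      by (rule tuple_formsE[OF hS], rule that)
    have sp: "a(m := 0) \<in> tuple_space m" if "a \<in> tuple_space (Suc m)" for a :: "nat \<Rightarrow> 'f"
      using that by (auto simp: tuple_space_def Suc_le_eq)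
    let ?f = "S.qmap (c0(m := 0)) (c1(m := 0)) (c2(m := 0)) (c3(m := 0)) (c4(m := 0)) (c5(m := 0))
        (c6(m := 0)) (c7(m := 0)) (c8(m := 0)) (c9(m := 0))"
    let ?c = "(c0 m, (c1 m, c3 m, c6 m), (c2 m, c4 m, c5 m, c7 m, c8 m, c9 m))"
    have "?f \<in> tuple_forms m"
      unfolding tuple_forms_def by (intro S.qmap_in_qmaps sp h(2-))
    moreover have "h = (\<lambda>v. (?f v)(m := form_of ?c v))"
      by (intro ext) (simp add: h(1) qmap_apply form_of_def)
    ultimately show "h \<in> (\<lambda>(c, f) v. (f v)(m := form_of c v)) ` (UNIV \<times> tuple_forms m)"
      by (intro image_eqI[of _ _ "(?c, ?f)"]) auto
  qed
qed

lemma tuple_forms_Suc_zero_iff: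
  assumes "f \<in> (tuple_forms m :: ('f \<times> 'f \<times> 'f \<times> 'f \<Rightarrow> nat \<Rightarrow> 'f) set)"
  shows "(f v)(m := a) = 0 \<longleftrightarrow> a = 0 \<and> f v = 0"
  using tuple_forms_zero[OF assms, of m v] by (auto simp: fun_eq_iff)

lemma tuple_forms_0: "tuple_forms 0 = {\<lambda>(v :: 'f \<times> 'f \<times> 'f \<times> 'f) i. 0}"
proof -
  have "(\<lambda>v i. 0) \<in> (tuple_forms 0 :: ('f \<times> 'f \<times> 'f \<times> 'f \<Rightarrow> nat \<Rightarrow> 'f) set)"
  proof -
    have "S.qmap 0 0 0 0 0 0 0 0 0 0 = (\<lambda>v i. 0)" by (intro ext) (auto simp: qmap_apply qform_def)
    thus ?thesis unfolding tuple_forms_def using S.qmap_in_qmaps[of 0 0 0 0 0 0 0 0 0 0 0] by (simp add: tuple_space_def)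
  qed
  moreover have "f = (\<lambda>v i. 0)" if "f \<in> (tuple_forms 0 :: ('f \<times> 'f \<times> 'f \<times> 'f \<Rightarrow> nat \<Rightarrow> 'f) set)" for f
    using tuple_forms_zero[OF that] by (intro ext) simp
  ultimately show ?thesis by blast
qed

text \<open>Vanishing on V is a condition on each component separately. For V the points of a set J
  of columns, the right side will be T ^ (10 - r_J) with T = 3 ^ m.\<close>

lemma card_tuple_forms_vanishing:
  "card {f \<in> (tuple_forms m :: ('f \<times> 'f \<times> 'f \<times> 'f \<Rightarrow> nat \<Rightarrow> 'f) set). \<forall>v\<in>V. f v = 0} =
    card {c :: 'f coeffs. \<forall>v\<in>V. form_of c v = 0} ^ m"
proof (induction m)
  case 0
  have "{f \<in> (tuple_forms 0 :: ('f \<times> 'f \<times> 'f \<times> 'f \<Rightarrow> nat \<Rightarrow> 'f) set). \<forall>v\<in>V. f v = 0} = {\<lambda>v i. 0}"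
    unfolding tuple_forms_0 by (auto simp: fun_eq_iff)
  thus ?case by (simp only: power_0) simp
next
  case (Suc m)
  let ?b = "\<lambda>(c, f) v. (f v)(m := form_of c v)"
  let ?C = "{c :: 'f coeffs. \<forall>v\<in>V. form_of c v = 0}"
  let ?F = "\<lambda>m. {f \<in> (tuple_forms m :: ('f \<times> 'f \<times> 'f \<times> 'f \<Rightarrow> nat \<Rightarrow> 'f) set). \<forall>v\<in>V. f v = 0}"
  have bij: "bij_betw ?b {p \<in> UNIV \<times> tuple_forms m. \<forall>v\<in>V. ?b p v = 0} {f \<in> tuple_forms (Suc m). \<forall>v\<in>V. f v = 0}"
    using bij_betw_Collect[OF bij_tuple_forms_Suc[of m], of "\<lambda>f. \<forall>v\<in>V. f v = 0"] .
  have "{p \<in> UNIV \<times> tuple_forms m. \<forall>v\<in>V. ?b p v = 0} = ?C \<times> ?F m"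
    using tuple_forms_Suc_zero_iff by auto
  from bij_betw_same_card[OF bij, unfolded this] have "card (?F (Suc m)) = card (?C \<times> ?F m)" by (rule sym)
  thus ?case by (simp only: card_cartesian_product Suc.IH power_Suc)
qed

text \<open>The new component serves as Q. The zero form imposes no condition and reproduces the
  enumerator of m-tuples; the nonzero forms make up \<open>quadric_sum_poly\<close>.\<close>

lemma tuple_enumerator_Suc:
  "tuple_enumerator TYPE('f) (Suc m) x = tuple_enumerator TYPE('f) m x + eval2 x (3 ^ m) quadric_sum_poly"
proof -
  have wt: "S.wt m x Q = (\<Sum>f\<in>tuple_forms m. x ^ zero_points (\<lambda>v. Q v = 0 \<and> f v = 0))" for Q
    unfolding S.wt_def tuple_forms_def ..
  have "tuple_enumerator TYPE('f) (Suc m) x = (\<Sum>p\<in>(UNIV :: 'f coeffs set) \<times> tuple_forms m.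
      x ^ zero_points (\<lambda>v. (case p of (c, f) \<Rightarrow> \<lambda>v. (f v)(m := form_of c v)) v = 0))"
    unfolding tuple_enumerator_def by (rule sum.reindex_bij_betw[OF bij_tuple_forms_Suc, symmetric])
  also have "\<dots> = (\<Sum>c\<in>(UNIV :: 'f coeffs set). \<Sum>f\<in>tuple_forms m. x ^ zero_points (\<lambda>v. form_of c v = 0 \<and> f v = 0))"
    unfolding sum.cartesian_product
    by (rule sum.cong) (auto simp: tuple_forms_Suc_zero_iff)
  also have "\<dots> = (\<Sum>c\<in>UNIV. S.wt m x (form_of c))" unfolding wt ..
  also have "\<dots> = (\<Sum>(k, (l1, l2, l3), (c2, c4, c5, c7, c8, c9))\<in>UNIV. S.wq m x k l1 c2 l2 c4 c5 l3 c7 c8 c9)"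
    by (rule sum.cong) (auto simp: S.wq_def form_of_def)
  also have "\<dots> = S.wq m x 0 0 0 0 0 0 0 0 0 0 + eval2 x (of_nat (card (tuple_space m :: (nat \<Rightarrow> 'f) set))) quadric_sum_poly"
    by (rule S.sum_wq_poly)
  also have "S.wq m x 0 0 0 0 0 0 0 0 0 0 = tuple_enumerator TYPE('f) m x"
    unfolding S.wq_def wt tuple_enumerator_def by (simp add: qform_def case_prod_unfold)
  finally show ?thesis by (simp add: finite_card_tuple_space[OF card3])
qed

end

section \<open>The polynomial identity\<close>

lemma eval1_monomial: "eval1 x (replicate j 0 @ [1]) = x ^ j"
  by (induction j) simp_all

lemma eval2_map_singleton: "eval2 x t (map (\<lambda>c. [c]) cs) = eval1 t cs"
  by (induction cs) simp_all

lemma eval2_veronese_term: "eval2 x t (veronese_term jc) = x ^ fst jc * eval1 t (snd jc)"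
  by (simp add: veronese_term_def eval1_monomial eval2_map_singleton)

lemma veronese_a_coeffs:
  fixes t :: "'r::comm_ring_1"
  shows "(t - 1) * veronese_a 18 t = eval1 t [- 780, 780]"
    "(t - 1) * veronese_a 24 t = eval1 t [3510, - 8190, 4680]"
    "(t - 1) * veronese_a 26 t = eval1 t [- 29160, 42120, - 14040, 1080]"
    "(t - 1) * veronese_a 27 t = eval1 t [35360, - 53040, 18720, - 1080, 40]"
    "(t - 1) * veronese_a 28 t = eval1 t [568620, - 758160, 189540]"
    "(t - 1) * veronese_a 30 t = eval1 t [- 850824, 1412424, - 655200, 93600]"
    "(t - 1) * veronese_a 31 t = eval1 t [- 9097920, 13646880, - 5054400, 505440]"
    "(t - 1) * veronese_a 32 t = eval1 t [8102835, - 13330980, 6339060, - 1200420, 89505]"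
    "(t - 1) * veronese_a 33 t = eval1 t [28080000, - 46537920, 22276800, - 4071600, 249600, 3120]"
    "(t - 1) * veronese_a 34 t = eval1 t [47195460, - 71456580, 26156520, - 1389960, - 568620, 63180]"
    "(t - 1) * veronese_a 35 t = eval1 t [- 398792160, 676767312, - 344316960, 73022040, - 6893640, 208728, 4680]"
    "(t - 1) * veronese_a 36 t = eval1 t [782707380, - 1385857200, 778590540, - 201375720, 27967550, - 2100540, 67860, 130]"
    "(t - 1) * veronese_a 37 t = eval1 t [- 782421120, 1434438720, - 870367680, 259038000, - 45321120, 4942080, - 318240, 9360]"
    "(t - 1) * veronese_a 38 t = eval1 t [442386360, - 837135000, 543263760, - 181537200, 37872900, - 5323500, 500760, - 28860, 780]"
    "(t - 1) * veronese_a 39 t = eval1 t [- 135457920, 264064320, - 182145600, 67311360, - 16236480, 2778360, - 341640, 29120, - 1560, 40]"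
    "(t - 1) * veronese_a 40 t = eval1 t [17570358, - 35235486, 25714260, - 10395540, 2840265, - 571428, 86580, - 9750, 780, - 40, 1]"
  by (simp_all add: veronese_a_def power_numeral_reduce algebra_simps)

lemma eval2_veronese_poly:
  "eval2 x t veronese_poly = x ^ 40 + (t - 1) * (\<Sum>i = 1..40. veronese_a i t * x ^ (40 - i))"
proof -
  let ?S = "{18, 24, 26, 27, 28, 30, 31, 32, 33, 34, 35, 36, 37, 38, 39, 40} :: nat set"
  have "(\<Sum>i = 1..40. veronese_a i t * x ^ (40 - i)) = (\<Sum>i\<in>?S. veronese_a i t * x ^ (40 - i))"
    by (rule sum.mono_neutral_right) (auto simp: veronese_a_def)
  hence "(t - 1) * (\<Sum>i = 1..40. veronese_a i t * x ^ (40 - i)) = (\<Sum>i\<in>?S. ((t - 1) * veronese_a i t) * x ^ (40 - i))"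
    by (simp only: sum_distrib_left mult.assoc)
  also have "x ^ 40 + \<dots> = (\<Sum>jc\<leftarrow>veronese_coeffs. x ^ fst jc * eval1 t (snd jc))"
  proof -
    have "(\<Sum>i\<in>?S. g i) = g 18 + g 24 + g 26 + g 27 + g 28 + g 30 + g 31 + g 32 + g 33 + g 34 + g 35 + g 36 + g 37 + g 38 + g 39 + g 40" for g :: "nat \<Rightarrow> 'a"
      by (simp add: add_ac)
    note this[of "\<lambda>i. (t - 1) * veronese_a i t * x ^ (40 - i)", unfolded veronese_a_coeffs]
    thus ?thesis by (simp only:) (simp add: veronese_coeffs_def add_ac mult_ac)
  qed
  also have "\<dots> = eval2 x t veronese_poly"
    unfolding veronese_poly_def eval2_sum2 by (simp add: eval2_veronese_term comp_def)
  finally show ?thesis by simp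
qed

lemma eval2_veronese_poly_dilate:
  "eval2 x (3 * t) veronese_poly = eval2 x t veronese_poly + eval2 x t quadric_sum_poly"
  using eval2_zero2[OF veronese_poly_dilate, of x t] by (simp add: algebra_simps)

text \<open>Candidate and enumerator obey the same recursion in m. At m = 0 the factor T - 1
  vanishes, and the single empty tuple vanishes at all (81 - 1) / 2 = 40 points.\<close>

lemma tuple_enumerator_eq:
  assumes "CARD('f::field) = 3"
  shows "tuple_enumerator TYPE('f) m x = eval2 x (3 ^ m) veronese_poly"
proof (induction m)
  case 0
  have "card (UNIV :: ('f \<times> 'f \<times> 'f \<times> 'f) set) = 81" by (simp add: card_prod assms)
  moreover from this have "finite (UNIV :: ('f \<times> 'f \<times> 'f \<times> 'f) set)" by (metis card.infinite zero_neq_numeral)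
  ultimately have "card (UNIV - {(0, 0, 0, 0) :: 'f \<times> 'f \<times> 'f \<times> 'f}) = 80" by (simp add: card_Diff_singleton)
  hence "zero_points (\<lambda>v :: 'f \<times> 'f \<times> 'f \<times> 'f. True) = 40"
    unfolding zero_points_def by (simp add: set_diff_eq)
  thus ?case
    unfolding tuple_enumerator_def tuple_forms_0[OF assms] eval2_veronese_poly by (simp add: zero_fun_def)
next
  case (Suc m)
  show ?case unfolding tuple_enumerator_Suc[OF assms] Suc.IH power_Suc eval2_veronese_poly_dilate ..
qed

text \<open>The coefficient of (X - Y) ^ j Y ^ (40 - j) in the claimed polynomial. In the definition
  of W it is the sum of T ^ (10 - r_J) over all J of size j.\<close>

definition veronese_b :: "nat \<Rightarrow> 'r::comm_ring_1 \<Rightarrow> 'r" where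
  "veronese_b j t = of_nat (40 choose j) + (t - 1) * (\<Sum>i = 1..40. veronese_a i t * of_nat ((40 - i) choose j))"

lemma veronese_expand:
  fixes X Y t :: "'r::comm_ring_1"
  shows "X ^ 40 + (t - 1) * (\<Sum>i = 1..40. veronese_a i t * X ^ (40 - i) * Y ^ i) =
    (\<Sum>j\<le>40. veronese_b j t * ((X - Y) ^ j * Y ^ (40 - j)))"
proof -
  have pow: "X ^ (40 - i) * Y ^ i = (\<Sum>j\<le>40. of_nat ((40 - i) choose j) * ((X - Y) ^ j * Y ^ (40 - j)))" if "i \<le> 40" for i
  proof -
    have "X ^ (40 - i) = ((X - Y) + Y) ^ (40 - i)" by simp
    also have "\<dots> * Y ^ i = (\<Sum>j\<le>40 - i. of_nat ((40 - i) choose j) * ((X - Y) ^ j * Y ^ (40 - j)))"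
      unfolding binomial_ring sum_distrib_right
    proof (rule sum.cong[OF refl])
      fix j assume "j \<in> {..40 - i}"
      hence "40 - j = (40 - i - j) + i" using that by auto
      thus "of_nat ((40 - i) choose j) * (X - Y) ^ j * Y ^ (40 - i - j) * Y ^ i =
          of_nat ((40 - i) choose j) * ((X - Y) ^ j * Y ^ (40 - j))"
        by (simp only: power_add mult.assoc)
    qed
    also have "\<dots> = (\<Sum>j\<le>40. of_nat ((40 - i) choose j) * ((X - Y) ^ j * Y ^ (40 - j)))"
      by (rule sum.mono_neutral_left) (auto simp: binomial_eq_0)
    finally show ?thesis .
  qed
  have "(t - 1) * (\<Sum>i = 1..40. veronese_a i t * X ^ (40 - i) * Y ^ i) =
      (t - 1) * (\<Sum>i = 1..40. \<Sum>j\<le>40. veronese_a i t * of_nat ((40 - i) choose j) * ((X - Y) ^ j * Y ^ (40 - j)))"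
    by (intro arg_cong2[where f = "(*)"] sum.cong refl) (simp add: pow mult.assoc sum_distrib_left)
  also have "\<dots> = (\<Sum>j\<le>40. (t - 1) * (\<Sum>i = 1..40. veronese_a i t * of_nat ((40 - i) choose j)) * ((X - Y) ^ j * Y ^ (40 - j)))"
    by (subst sum.swap) (simp only: sum_distrib_left sum_distrib_right mult.assoc)
  finally show ?thesis
    using pow[of 0] by (simp add: veronese_b_def ring_distribs sum.distrib)
qed

section \<open>Passage from integers to arbitrary commutative rings\<close>

lemma poly_veronese_a: "poly (veronese_a i [:0, 1:]) (t :: int) = veronese_a i t"
  unfolding veronese_a_def by (simp add: mult_ac)

text \<open>The evaluation homomorphism from integer polynomials to any commutative ring; it carries
  an identity between polynomials to the given T.\<close>

definition int_poly_at :: "'r::comm_ring_1 \<Rightarrow> int poly \<Rightarrow> 'r" where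
  "int_poly_at t p = fold_coeffs (\<lambda>a b. of_int a + t * b) p 0"

lemma int_poly_at_0 [simp]: "int_poly_at t 0 = 0"
  by (simp add: int_poly_at_def)

lemma int_poly_at_pCons [simp]: "int_poly_at t (pCons a p) = of_int a + t * int_poly_at t p"
  by (cases "p = 0 \<and> a = 0") (auto simp: int_poly_at_def)

lemma int_poly_at_add [simp]: "int_poly_at t (p + q) = int_poly_at t p + int_poly_at t q"
  by (induction p q rule: poly_induct2) (simp_all add: algebra_simps)

lemma int_poly_at_smult [simp]: "int_poly_at t (Polynomial.smult c p) = of_int c * int_poly_at t p"
  by (induction p) (simp_all add: algebra_simps)

lemma int_poly_at_diff [simp]: "int_poly_at t (p - q) = int_poly_at t p - int_poly_at t q"
  using int_poly_at_add[of t "p - q" q] by (simp del: int_poly_at_add add: eq_diff_eq)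

lemma int_poly_at_mult [simp]: "int_poly_at t (p * q) = int_poly_at t p * int_poly_at t q"
  by (induction p) (simp_all add: algebra_simps)

lemma int_poly_at_1 [simp]: "int_poly_at t 1 = 1"
  by (simp add: one_pCons)

lemma int_poly_at_power [simp]: "int_poly_at t (p ^ n) = int_poly_at t p ^ n"
  by (induction n) simp_all

lemma int_poly_at_numeral [simp]: "int_poly_at t (numeral n) = numeral n"
  by (simp add: numeral_poly)

lemma int_poly_at_of_nat [simp]: "int_poly_at t (of_nat n) = of_nat n"
  by (simp add: of_nat_poly)

lemma int_poly_at_sum: "int_poly_at t (sum f S) = (\<Sum>s\<in>S. int_poly_at t (f s))"
  by (induction S rule: infinite_finite_induct) simp_all

lemma int_poly_at_monom: "int_poly_at t (monom 1 n) = t ^ n"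
  by (induction n) (simp_all add: monom_0 monom_Suc)

lemma int_poly_at_veronese_a: "int_poly_at t (veronese_a i [:0, 1:]) = veronese_a i t"
  unfolding veronese_a_def by (simp add: mult_ac)

lemma int_polyfun_eq:
  fixes a b :: "nat \<Rightarrow> int"
  assumes "\<And>y. (\<Sum>j\<le>n. a j * y ^ j) = (\<Sum>j\<le>n. b j * y ^ j)" "j \<le> n"
  shows "a j = b j"
proof -
  have "poly (\<Sum>j\<le>n. monom (a j) j) = poly (\<Sum>j\<le>n. monom (b j) j)"
    by (rule ext) (simp add: poly_sum poly_monom assms(1))
  hence "(\<Sum>j\<le>n. monom (a j) j) = (\<Sum>j\<le>n. monom (b j) j)" by (simp add: poly_eq_poly_eq_iff)
  hence "coeff (\<Sum>j\<le>n. monom (a j) j) j = coeff (\<Sum>j\<le>n. monom (b j) j) j" by simp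
  thus ?thesis using assms(2) by (simp add: coeff_sum)
qed

text \<open>A function on subsets is determined, as far as the sums over subsets of equal size are
  concerned, by its polynomial generating functions at the infinitely many points \<open>3 ^ m\<close>.\<close>

lemma subset_sum_transfer:
  fixes d :: "nat set \<Rightarrow> nat" and T :: "'r::comm_ring_1"
  assumes "\<And>m y. (\<Sum>J\<in>Pow {..<40}. (3 ^ m) ^ d J * (y :: int) ^ card J) = (\<Sum>j\<le>40. veronese_b j (3 ^ m) * y ^ j)"
    and j: "j \<le> 40"
  shows "(\<Sum>J | J \<subseteq> {..<40} \<and> card J = j. T ^ d J) = veronese_b j T"
proof -
  define p :: "int poly" where "p = (\<Sum>J | J \<subseteq> {..<40} \<and> card J = j. monom 1 (d J))"
  define q :: "int poly" where "q = of_nat (40 choose j) + ([:0, 1:] - 1) * (\<Sum>i = 1..40. veronese_a i [:0, 1:] * of_nat ((40 - i) choose j))"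
  have q: "poly q t = veronese_b j t" for t
    unfolding q_def veronese_b_def by (simp add: poly_sum poly_veronese_a of_nat_poly mult_ac)
  have "poly p (3 ^ m) = poly q (3 ^ m)" for m
  proof -
    have "(\<Sum>J | J \<subseteq> {..<40} \<and> card J = j. (3 ^ m :: int) ^ d J) = veronese_b j (3 ^ m)"
    proof (rule int_polyfun_eq[OF _ j])
      fix y :: int
      have "(\<Sum>j\<le>40. (\<Sum>J | J \<subseteq> {..<40} \<and> card J = j. (3 ^ m) ^ d J) * y ^ j) =
          (\<Sum>j\<le>40. \<Sum>J\<in>{J \<in> Pow {..<40}. card J = j}. (3 ^ m) ^ d J * y ^ card J)"
        unfolding sum_distrib_right by (intro sum.cong) auto
      also have "\<dots> = (\<Sum>J\<in>Pow {..<40}. (3 ^ m) ^ d J * y ^ card J)"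
        by (rule sum.group) (auto dest: card_mono[OF finite_lessThan])
      finally show "(\<Sum>j\<le>40. (\<Sum>J | J \<subseteq> {..<40} \<and> card J = j. (3 ^ m) ^ d J) * y ^ j) =
          (\<Sum>j\<le>40. veronese_b j (3 ^ m) * y ^ j)" by (simp add: assms(1))
    qed
    thus ?thesis unfolding q by (simp add: p_def poly_sum poly_monom)
  qed
  hence "range (\<lambda>m. 3 ^ m) \<subseteq> {x. poly (p - q) x = 0}" by auto
  moreover have "infinite (range (\<lambda>m. 3 ^ m :: int))"
    by (rule range_inj_infinite) (auto simp: inj_on_def)
  ultimately have "p - q = 0" using poly_roots_finite finite_subset by blast
  hence "int_poly_at T p = int_poly_at T q" by simp
  moreover have "int_poly_at T p = (\<Sum>J | J \<subseteq> {..<40} \<and> card J = j. T ^ d J)"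
    unfolding p_def by (simp add: int_poly_at_sum int_poly_at_monom)
  moreover have "int_poly_at T q = veronese_b j T"
    unfolding q_def veronese_b_def by (simp add: int_poly_at_sum int_poly_at_veronese_a)
  ultimately show ?thesis by simp
qed

section \<open>The Veronese matrix\<close>

definition vec_quad :: "'f::field vec \<Rightarrow> 'f \<times> 'f \<times> 'f \<times> 'f" where
  "vec_quad x = (x $ 0, x $ 1, x $ 2, x $ 3)"

definition vec_coeffs :: "'f::field vec \<Rightarrow> 'f coeffs" where
  "vec_coeffs c = (c $ 0, (c $ 1, c $ 3, c $ 6), (c $ 2, c $ 4, c $ 5, c $ 7, c $ 8, c $ 9))"

lemma less_4_cases: "i < 4 \<Longrightarrow> i = 0 \<or> i = 1 \<or> i = 2 \<or> i = (3::nat)"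
  by auto

lemma less_10_cases:
  "i < 10 \<Longrightarrow> i = 0 \<or> i = 1 \<or> i = 2 \<or> i = 3 \<or> i = 4 \<or> i = 5 \<or> i = 6 \<or> i = 7 \<or> i = 8 \<or> i = (9::nat)"
  by auto

lemma vec_quad_inj: "x \<in> carrier_vec 4 \<Longrightarrow> y \<in> carrier_vec 4 \<Longrightarrow> vec_quad x = vec_quad y \<Longrightarrow> x = y"
  by (rule eq_vecI) (auto simp: vec_quad_def dest!: less_4_cases)

lemma vec_quad_surj: "\<exists>x\<in>carrier_vec 4. vec_quad x = v"
proof -
  obtain a b c d where "v = (a, b, c, d)" by (cases v)
  hence "vec_quad (vec_of_list [a, b, c, d]) = v" by (simp add: vec_quad_def numeral_eq_Suc)
  moreover have "vec_of_list [a, b, c, d] \<in> carrier_vec 4" by (rule carrier_vecI) simp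
  ultimately show ?thesis by blast
qed

lemma bij_vec_coeffs: "bij_betw vec_coeffs (carrier_vec 10) (UNIV :: 'f::field coeffs set)"
  unfolding bij_betw_def
proof
  show "inj_on vec_coeffs (carrier_vec 10 :: 'f vec set)"
  proof (rule inj_onI)
    fix x y :: "'f vec" assume xy: "x \<in> carrier_vec 10" "y \<in> carrier_vec 10" "vec_coeffs x = vec_coeffs y"
    show "x = y"
      by (rule eq_vecI) (use xy in \<open>auto simp: vec_coeffs_def dest!: less_10_cases\<close>)
  qed
  show "vec_coeffs ` carrier_vec 10 = (UNIV :: 'f coeffs set)"
  proof (intro equalityI subsetI UNIV_I)
    fix c :: "'f coeffs"
    obtain c0 c1 c3 c6 c2 c4 c5 c7 c8 c9 where c: "c = (c0, (c1, c3, c6), (c2, c4, c5, c7, c8, c9))" by (metis prod.exhaust)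
    let ?v = "vec_of_list [c0, c1, c2, c3, c4, c5, c6, c7, c8, c9]"
    have "vec_coeffs ?v = c" unfolding c by (simp add: vec_coeffs_def numeral_eq_Suc)
    moreover have "?v \<in> carrier_vec 10" by (rule carrier_vecI) simp
    ultimately show "c \<in> vec_coeffs ` carrier_vec 10" by (metis image_eqI)
  qed
qed

text \<open>This makes codewords evaluations of quadratic forms: linear conditions on the
  coefficient vector at Veronese columns are zeros of the form.\<close>

lemma scalar_prod_veronese_vec:
  assumes "c \<in> carrier_vec 10"
  shows "c \<bullet> veronese_vec x = form_of (vec_coeffs c) (vec_quad x)"
proof -
  have "dim_vec (veronese_vec x) = 10" by (simp add: veronese_vec_def)
  moreover have "{0..<10} = {0, 1, 2, 3, 4, 5, 6, 7, 8, 9 :: nat}" by auto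
  ultimately show ?thesis
    by (simp add: scalar_prod_def veronese_vec_def form_of_def vec_coeffs_def vec_quad_def qform_def power2_eq_square
      numeral_eq_Suc algebra_simps)
qed

lemma in_proj_point: "v \<in> proj_point v"
  unfolding proj_point_def by (auto intro!: exI[of _ 1])

lemma scalar_prod_proj_point:
  fixes c :: "'f::field vec"
  assumes "proj_point u = proj_point v" "u \<in> carrier_vec n" "v \<in> carrier_vec n" "c \<in> carrier_vec n"
  shows "c \<bullet> u = 0 \<longleftrightarrow> c \<bullet> v = 0"
proof -
  have "u \<in> proj_point v" "v \<in> proj_point u" using in_proj_point[of u] in_proj_point[of v] assms(1) by simp_all
  then obtain k l where "u = k \<cdot>\<^sub>v v" "v = l \<cdot>\<^sub>v u" unfolding proj_point_def by auto
  hence "c \<bullet> u = k * (c \<bullet> v)" "c \<bullet> v = l * (c \<bullet> u)"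
    using assms(2-4) by (metis scalar_prod_smult_distrib)+
  thus ?thesis by (metis mult_zero_right)
qed

text \<open>Column j of G becomes the column whose index is the number of elements of J below
  j.\<close>

lemma set_cols_submatrix:
  assumes G: "G \<in> carrier_mat n N" and J: "J \<subseteq> {..<N}"
  shows "set (cols (submatrix G {..<n} J)) = col G ` J" "submatrix G {..<n} J \<in> carrier_mat n (card J)"
proof -
  let ?M = "submatrix G {..<n} J"
  have [simp]: "dim_row G = n" "dim_col G = N" using G by auto
  have J': "{j. j < N \<and> j \<in> J} = J" using J by auto
  have rows: "card {i. i < n \<and> i < n} = n" by simp
  show M: "?M \<in> carrier_mat n (card J)"
    by (rule carrier_matI) (simp_all add: dim_submatrix J')
  have col: "col ?M (card {a\<in>J. a < j}) = col G j" if j: "j \<in> J" for j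
  proof (rule eq_vecI)
    have lt: "card {a\<in>J. a < j} < card J"
      by (rule psubset_card_mono) (use J j finite_subset in auto)
    fix i assume "i < dim_vec (col G j)"
    hence i: "i < n" by simp
    have "{a \<in> {..<n}. a < i} = {..<i}" using i by auto
    hence "?M $$ (i, card {a\<in>J. a < j}) = G $$ (i, j)"
      using submatrix_index_card[of i G j "{..<n}" J] i j J by (simp add: subset_eq)
    thus "col ?M (card {a\<in>J. a < j}) $ i = col G j $ i"
      using i lt M j J by (auto simp: subset_eq)
  qed (use M in simp)
  have lt: "card {a\<in>J. a < j} < card J" if "j \<in> J" for j
    by (rule psubset_card_mono) (use J that finite_subset in auto)
  have sc: "set (cols ?M) = col ?M ` {..<card J}" using M by (auto simp: cols_def)
  show "set (cols ?M) = col G ` J"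
  proof (intro equalityI subsetI)
    fix v assume "v \<in> set (cols ?M)"
    then obtain k where k: "k < card J" "v = col ?M k" unfolding sc by auto
    hence "pick J k \<in> J" "card {a\<in>J. a < pick J k} = k" by (auto intro: pick_in_set_le card_pick_le)
    thus "v \<in> col G ` J" using col[of "pick J k"] k by auto
  next
    fix v assume "v \<in> col G ` J"
    then obtain j where j: "j \<in> J" "v = col G j" by blast
    show "v \<in> set (cols ?M)"
      unfolding sc j(2) col[OF j(1), symmetric] by (rule imageI) (simp add: lt[OF j(1)])
  qed
qed

lemma card_annihilator_columns:
  fixes G :: "'f::field mat"
  assumes "CARD('f) = 3" "G \<in> carrier_mat n N" "J \<subseteq> {..<N}"
  shows "card {c \<in> carrier_vec n. \<forall>j\<in>J. c \<bullet> col G j = 0} = 3 ^ (n - column_rank G J)" "column_rank G J \<le> n"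
proof -
  have fin: "finite (UNIV :: 'f set)" using assms(1) by (metis card.infinite zero_neq_numeral)
  have "dim_row G = n" using assms by auto
  moreover note S = set_cols_submatrix[OF assms(2,3)]
  ultimately show "card {c \<in> carrier_vec n. \<forall>j\<in>J. c \<bullet> col G j = 0} = 3 ^ (n - column_rank G J)" "column_rank G J \<le> n"
    using vec_space.card_annihilator[OF fin S(2)] assms(1) unfolding S(1) column_rank_def by auto
qed

section \<open>The columns of G as points and the count over sets of columns\<close>

locale veronese_code =
  fixes G :: "'f::field mat" and p :: "nat \<Rightarrow> 'f vec set"
  assumes card_f: "CARD('f) = 3" and G: "G \<in> carrier_mat 10 40"
    and p: "bij_betw p {..<40} (PG 3)" and col_p: "\<And>j. j < 40 \<Longrightarrow> proj_point (col G j) = veronese (p j)"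
begin

definition rep :: "nat \<Rightarrow> 'f vec" where
  "rep j = (SOME x. x \<in> carrier_vec 4 \<and> x \<noteq> 0\<^sub>v 4 \<and> proj_point x = p j)"

lemma rep:
  assumes "j < 40"
  shows "rep j \<in> carrier_vec 4" "rep j \<noteq> 0\<^sub>v 4" "proj_point (rep j) = p j"
proof -
  have "p j \<in> PG 3" using p assms by (auto simp: bij_betw_def)
  hence "\<exists>x. x \<in> carrier_vec 4 \<and> x \<noteq> 0\<^sub>v 4 \<and> proj_point x = p j" unfolding PG_def by auto
  from someI_ex[OF this] show "rep j \<in> carrier_vec 4" "rep j \<noteq> 0\<^sub>v 4" "proj_point (rep j) = p j"
    unfolding rep_def by auto
qed

definition pt :: "nat \<Rightarrow> 'f \<times> 'f \<times> 'f \<times> 'f" where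
  "pt j = vec_quad (rep j)"

lemma scalar_prod_col:
  assumes "j < 40" "c \<in> carrier_vec 10"
  shows "c \<bullet> col G j = 0 \<longleftrightarrow> form_of (vec_coeffs c) (pt j) = 0"
proof -
  have "proj_point (col G j) = proj_point (veronese_vec (rep j))"
    using col_p[OF assms(1)] veronese_proj_point[OF rep(1,2)[OF assms(1)]] rep(3)[OF assms(1)] by simp
  moreover have "veronese_vec (rep j) \<in> carrier_vec 10" by (rule carrier_vecI) (simp add: veronese_vec_def)
  moreover have "col G j \<in> carrier_vec 10" using G assms by auto
  ultimately have "c \<bullet> col G j = 0 \<longleftrightarrow> c \<bullet> veronese_vec (rep j) = 0"
    using scalar_prod_proj_point assms(2) by blast
  thus ?thesis unfolding scalar_prod_veronese_vec[OF assms(2)] pt_def .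
qed

lemma card_forms_vanishing:
  assumes "J \<subseteq> {..<40}"
  shows "card {c :: 'f coeffs. \<forall>v\<in>pt ` J. form_of c v = 0} = 3 ^ (10 - column_rank G J)"
proof -
  have "{c \<in> carrier_vec 10. \<forall>v\<in>pt ` J. form_of (vec_coeffs c) v = 0} = {c \<in> carrier_vec 10. \<forall>j\<in>J. c \<bullet> col G j = 0}"
    using scalar_prod_col assms by (auto simp: subset_eq)
  moreover have "bij_betw vec_coeffs {c \<in> carrier_vec 10. \<forall>v\<in>pt ` J. form_of (vec_coeffs c) v = 0}
      {c \<in> UNIV. \<forall>v\<in>pt ` J. form_of c v = 0}"
    by (rule bij_betw_Collect[OF bij_vec_coeffs])
  ultimately show ?thesis
    using bij_betw_same_card card_annihilator_columns(1)[OF card_f G assms] by fastforce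
qed

definition qscale :: "'f \<Rightarrow> 'f \<times> 'f \<times> 'f \<times> 'f \<Rightarrow> 'f \<times> 'f \<times> 'f \<times> 'f" where
  "qscale k = (\<lambda>(a, b, c, d). (k * a, k * b, k * c, k * d))"

lemma vec_quad_smult: "x \<in> carrier_vec 4 \<Longrightarrow> vec_quad (k \<cdot>\<^sub>v x) = qscale k (vec_quad x)"
  by (simp add: vec_quad_def qscale_def)

lemma vec_quad_eq_0: "x \<in> carrier_vec 4 \<Longrightarrow> vec_quad x = (0, 0, 0, 0) \<longleftrightarrow> x = 0\<^sub>v 4"
  using vec_quad_inj[of x "0\<^sub>v 4"] by (auto simp: vec_quad_def)

text \<open>Each nonzero vector is 1 or -1 times the representative of exactly one column, so the
  vectors counted are twice as many as the columns.\<close>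

lemma zero_points_eq:
  assumes S: "\<And>k v. k \<noteq> 0 \<Longrightarrow> S (qscale k v) = S v"
  shows "zero_points S = card {j \<in> {..<40}. S (pt j)}"
proof -
  have U: "(UNIV :: 'f set) = {0, 1, - 1}" "(1 :: 'f) \<noteq> - 1" using three_element_field[OF card_f] by auto
  have "bij_betw (\<lambda>(j, k). qscale k (pt j)) ({j \<in> {..<40}. S (pt j)} \<times> {1, - 1}) {v. v \<noteq> (0, 0, 0, 0) \<and> S v}"
    unfolding bij_betw_def
  proof
    show "inj_on (\<lambda>(j, k). qscale k (pt j)) ({j \<in> {..<40}. S (pt j)} \<times> {1, - 1})"
    proof (rule inj_onI)
      fix a a' assume aa: "a \<in> {j \<in> {..<40}. S (pt j)} \<times> {1, - 1}" "a' \<in> {j \<in> {..<40}. S (pt j)} \<times> {1, - 1}"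
        "(case a of (j, k) \<Rightarrow> qscale k (pt j)) = (case a' of (j, k) \<Rightarrow> qscale k (pt j))"
      obtain j k j' k' where a: "a = (j, k)" "a' = (j', k')" by (metis prod.exhaust)
      have j: "j < 40" "j' < 40" and k: "k \<noteq> 0" "k' \<noteq> 0" and eq: "qscale k (pt j) = qscale k' (pt j')"
        using aa unfolding a by auto
      have eq: "k \<cdot>\<^sub>v rep j = k' \<cdot>\<^sub>v rep j'"
        by (rule vec_quad_inj) (use eq rep[OF j(1)] rep[OF j(2)] in \<open>auto simp: vec_quad_smult pt_def\<close>)
      hence "proj_point (rep j) = proj_point (rep j')" using proj_point_smult k by metis
      hence "p j = p j'" using rep j by simp
      hence jj: "j = j'" using p j by (auto simp: bij_betw_def inj_on_def)
      obtain i where i: "i < 4" "rep j $ i \<noteq> 0"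
      proof (rule ccontr)
        assume "\<not> thesis"
        hence "rep j = 0\<^sub>v 4" using rep(1)[OF j(1)] that by (intro eq_vecI) auto
        thus False using rep(2)[OF j(1)] by simp
      qed
      have "(k \<cdot>\<^sub>v rep j) $ i = (k' \<cdot>\<^sub>v rep j) $ i" using eq jj by simp
      hence "k = k'" using i rep(1)[OF j(1)] by simp
      thus "a = a'" unfolding a using jj by simp
    qed
    show "(\<lambda>(j, k). qscale k (pt j)) ` ({j \<in> {..<40}. S (pt j)} \<times> {1, - 1}) = {v. v \<noteq> (0, 0, 0, 0) \<and> S v}"
    proof (intro equalityI subsetI)
      fix v assume "v \<in> (\<lambda>(j, k). qscale k (pt j)) ` ({j \<in> {..<40}. S (pt j)} \<times> {1, - 1})"
      then obtain a where a: "a \<in> {j \<in> {..<40}. S (pt j)} \<times> {1, - 1}" "v = (case a of (j, k) \<Rightarrow> qscale k (pt j))"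
        by blast
      obtain j k where "a = (j, k)" by (cases a)
      hence jk: "j < 40" "S (pt j)" "k \<noteq> 0" "v = qscale k (pt j)" using a by auto
      have "v = vec_quad (k \<cdot>\<^sub>v rep j)" using jk rep(1) by (simp add: vec_quad_smult pt_def)
      moreover have "k \<cdot>\<^sub>v rep j \<noteq> 0\<^sub>v 4"
      proof
        assume "k \<cdot>\<^sub>v rep j = 0\<^sub>v 4"
        moreover have "(1 / k) \<cdot>\<^sub>v 0\<^sub>v 4 = (0\<^sub>v 4 :: 'f vec)" by (rule eq_vecI) auto
        ultimately have "(1 / k) \<cdot>\<^sub>v (k \<cdot>\<^sub>v rep j) = 0\<^sub>v 4" by simp
        thus False using jk rep(2)[OF jk(1)] by (simp add: smult_smult_assoc)
      qed
      ultimately have "v \<noteq> (0, 0, 0, 0)" using vec_quad_eq_0[of "k \<cdot>\<^sub>v rep j"] rep(1)[OF jk(1)] by simp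
      thus "v \<in> {v. v \<noteq> (0, 0, 0, 0) \<and> S v}" using jk S by simp
    next
      fix v assume v: "v \<in> {v. v \<noteq> (0, 0, 0, 0) \<and> S v}"
      obtain x where x: "x \<in> carrier_vec 4" "vec_quad x = v" using vec_quad_surj by blast
      hence "x \<noteq> 0\<^sub>v 4" using v vec_quad_eq_0 by auto
      hence "proj_point x \<in> PG 3" unfolding PG_def using x by auto
      hence "proj_point x \<in> p ` {..<40}" using p by (simp add: bij_betw_def)
      then obtain j where j: "j < 40" "p j = proj_point x" by (metis imageE lessThan_iff)
      have "x \<in> proj_point (rep j)" using in_proj_point[of x] j rep by simp
      then obtain k where k: "x = k \<cdot>\<^sub>v rep j" unfolding proj_point_def by auto
      have "k \<noteq> 0" using k \<open>x \<noteq> 0\<^sub>v 4\<close> rep(1)[OF j(1)] by auto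
      hence k': "k \<in> {1, - 1}" using U(1) by blast
      have vk: "v = qscale k (pt j)" using x k rep(1)[OF j(1)] by (simp add: vec_quad_smult pt_def)
      hence "S (pt j)" using v S[OF \<open>k \<noteq> 0\<close>] by simp
      thus "v \<in> (\<lambda>(j, k). qscale k (pt j)) ` ({j \<in> {..<40}. S (pt j)} \<times> {1, - 1})"
        using j k' vk by (intro image_eqI[of _ _ "(j, k)"]) auto
    qed
  qed
  from bij_betw_same_card[OF this] have "card {v. v \<noteq> (0, 0, 0, 0) \<and> S v} = card {j \<in> {..<40}. S (pt j)} * 2"
    using U(2) by (simp add: card_cartesian_product)
  thus ?thesis unfolding zero_points_def by simp
qed

lemma tuple_form_qscale:
  assumes "f \<in> (tuple_forms m :: ('f \<times> 'f \<times> 'f \<times> 'f \<Rightarrow> nat \<Rightarrow> 'f) set)" "k \<noteq> 0"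
  shows "f (qscale k v) = 0 \<longleftrightarrow> f v = 0"
proof -
  have "f (qscale k v) i = k * k * f v i" for i
  proof -
    obtain a b c d where v: "v = (a, b, c, d)" by (cases v)
    show ?thesis
      by (rule tuple_formsE[OF card_f assms(1)])
        (simp add: qmap_apply[OF card_f] v qscale_def qform_def algebra_simps)
  qed
  thus ?thesis using assms(2) by (auto simp: fun_eq_iff)
qed

text \<open>Double counting of pairs of a tuple and a set J of common zeros: for fixed J there are T
  ^ (10 - r_J) tuples, and for a tuple with zero set Z the sum of y ^ |J| over the subsets of Z is
  (y + 1) ^ |Z|. This is W at X = y + 1 and Y = 1.\<close>

lemma subset_enumerator:
  "(\<Sum>J\<in>Pow {..<40}. (3 ^ m) ^ (10 - column_rank G J) * (y :: int) ^ card J) = (\<Sum>j\<le>40. veronese_b j (3 ^ m) * y ^ j)"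
proof -
  let ?F = "tuple_forms m :: ('f \<times> 'f \<times> 'f \<times> 'f \<Rightarrow> nat \<Rightarrow> 'f) set"
  have fin: "finite ?F"
    unfolding tuple_forms_def by (rule ternary_space.finite_qmaps[OF ternary_space_tuples[OF card_f]])
  have "(\<Sum>J\<in>Pow {..<40}. (3 ^ m) ^ (10 - column_rank G J) * y ^ card J) =
      (\<Sum>J\<in>Pow {..<40}. \<Sum>f | f \<in> ?F \<and> (\<forall>v\<in>pt ` J. f v = 0). y ^ card J)"
  proof (rule sum.cong[OF refl])
    fix J assume "J \<in> Pow {..<40 :: nat}"
    hence "card {f \<in> ?F. \<forall>v\<in>pt ` J. f v = 0} = (3 ^ (10 - column_rank G J)) ^ m"
      unfolding card_tuple_forms_vanishing[OF card_f] using card_forms_vanishing by simp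
    thus "(3 ^ m) ^ (10 - column_rank G J) * y ^ card J = (\<Sum>f | f \<in> ?F \<and> (\<forall>v\<in>pt ` J. f v = 0). y ^ card J)"
      by (simp add: power_mult[symmetric] mult.commute)
  qed
  also have "\<dots> = (\<Sum>f\<in>?F. \<Sum>J | J \<in> Pow {..<40} \<and> (\<forall>v\<in>pt ` J. f v = 0). y ^ card J)"
    by (rule sum.swap_restrict) (use fin in auto)
  also have "\<dots> = (\<Sum>f\<in>?F. (y + 1) ^ zero_points (\<lambda>v. f v = 0))"
  proof (rule sum.cong[OF refl])
    fix f assume f: "f \<in> ?F"
    let ?Z = "{j \<in> {..<40}. f (pt j) = 0}"
    have "{J. J \<in> Pow {..<40} \<and> (\<forall>v\<in>pt ` J. f v = 0)} = Pow ?Z" by auto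
    moreover have "(y + 1) ^ card ?Z = (\<Sum>J\<in>Pow ?Z. y ^ card J)"
      using prod_add[of ?Z "\<lambda>_. y" "\<lambda>_. 1"] by simp
    moreover have "zero_points (\<lambda>v. f v = 0) = card ?Z"
      by (rule zero_points_eq) (rule tuple_form_qscale[OF f])
    ultimately show "(\<Sum>J | J \<in> Pow {..<40} \<and> (\<forall>v\<in>pt ` J. f v = 0). y ^ card J) = (y + 1) ^ zero_points (\<lambda>v. f v = 0)"
      by (simp only:)
  qed
  also have "\<dots> = eval2 (y + 1) (3 ^ m) veronese_poly"
    using tuple_enumerator_eq[OF card_f, of m "y + 1"] unfolding tuple_enumerator_def by simp
  also have "\<dots> = (\<Sum>j\<le>40. veronese_b j (3 ^ m) * y ^ j)"
    using veronese_expand[of "y + 1" "3 ^ m" 1] by (simp add: eval2_veronese_poly)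
  finally show ?thesis .
qed

text \<open>The identity for j = 40, transferred to T = 0: the only J is the set of all columns, and
  0 ^ (10 - r) = 1 forces the exponent to be 0.\<close>

lemma column_rank_full: "column_rank G {..<40} = 10"
proof -
  let ?d = "10 - column_rank G {..<40}"
  have "(\<Sum>J | J \<subseteq> {..<40} \<and> card J = 40. (0 :: int) ^ (10 - column_rank G J)) = veronese_b 40 0"
    by (rule subset_sum_transfer[OF subset_enumerator]) simp
  moreover have "{J. J \<subseteq> {..<40 :: nat} \<and> card J = 40} = {{..<40}}"
    using card_subset_eq[of "{..<40 :: nat}"] by auto
  moreover have "veronese_b 40 (0 :: int) = 1"
    unfolding veronese_b_def by (simp add: binomial_eq_0)
  ultimately have "(0 :: int) ^ ?d = 1" by simp
  hence "?d = 0" by (metis power_0_left zero_neq_one)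
  thus ?thesis using card_annihilator_columns(2)[OF card_f G subset_refl] by simp
qed

text \<open>By full column rank only the zero form vanishes at all points, so the ten rows of G are
  independent.\<close>

lemma code_dim_eq: "code_dim 40 (code_of G) = 10"
proof -
  interpret vec_space "TYPE('f)" 40 .
  have GT: "G\<^sup>T \<in> carrier_mat 40 10" using G by simp
  let ?K = "{c \<in> carrier_vec 10. \<forall>j\<in>{..<40}. c \<bullet> col G j = 0}"
  have "card ?K = 1"
    using card_annihilator_columns(1)[OF card_f G subset_refl] column_rank_full by simp
  then obtain z where z: "?K = {z}" by (rule card_1_singletonE)
  have "0\<^sub>v 10 \<in> ?K" using G by auto
  hence "?K = {0\<^sub>v 10}" unfolding z by simp
  hence ker: "c = 0\<^sub>v 10" if "c \<in> carrier_vec 10" "\<forall>j<40. c \<bullet> col G j = 0" for c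
    using that by blast
  have "G\<^sup>T *\<^sub>v c \<noteq> 0\<^sub>v 40" if c: "c \<in> carrier_vec 10" "c \<noteq> 0\<^sub>v 10" for c
  proof
    assume 0: "G\<^sup>T *\<^sub>v c = 0\<^sub>v 40"
    have "c \<bullet> col G j = 0" if "j < 40" for j
    proof -
      have "(G\<^sup>T *\<^sub>v c) $ j = col G j \<bullet> c" using G that by simp
      also have "\<dots> = c \<bullet> col G j" by (rule comm_scalar_prod[of _ 10]) (use G c that in auto)
      finally show ?thesis using 0 that by simp
    qed
    thus False using ker[OF c(1)] c(2) by blast
  qed
  note inj = this
  \<comment> \<open>Independence is a property of a set of vectors, so the rows must also be
    distinct: equal rows i and j would put the difference of two unit vectors into the
    kernel.\<close>
  have dist: "distinct (cols G\<^sup>T)"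
  proof (rule ccontr)
    assume "\<not> distinct (cols G\<^sup>T)"
    then obtain i j where ij: "i < 10" "j < 10" "i \<noteq> j" "col G\<^sup>T i = col G\<^sup>T j"
      using GT by (auto simp: distinct_conv_nth)
    let ?c = "unit_vec 10 i - unit_vec 10 j :: 'f vec"
    have "G\<^sup>T *\<^sub>v ?c = G\<^sup>T *\<^sub>v unit_vec 10 i - G\<^sup>T *\<^sub>v unit_vec 10 j"
      by (rule mult_minus_distrib_mat_vec[OF GT]) auto
    also have "G\<^sup>T *\<^sub>v unit_vec 10 i = col G\<^sup>T i"
      by (rule eq_vecI) (use GT ij(1) in \<open>auto simp: scalar_prod_right_unit\<close>)
    also have "G\<^sup>T *\<^sub>v unit_vec 10 j = col G\<^sup>T j"
      by (rule eq_vecI) (use GT ij(2) in \<open>auto simp: scalar_prod_right_unit\<close>)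
    also have "col G\<^sup>T i - col G\<^sup>T j = 0\<^sub>v 40"
      unfolding ij(4) by (rule minus_cancel_vec) (rule carrier_vecI, use GT in simp)
    finally have "?c = 0\<^sub>v 10" using inj[of ?c] by auto
    hence "?c $ i = 0" using ij by simp
    thus False using ij by simp
  qed
  have "lin_indpt (set (cols G\<^sup>T))"
    using lin_depE[OF GT _ dist] inj by blast
  hence "rank G\<^sup>T = 10" using lin_indpt_full_rank[OF GT dist] by simp
  thus ?thesis
    using G unfolding code_dim_def code_of_def rank_def by (simp add: row_space_def)
qed

lemma ext_weight_enumerator_eq:
  fixes X Y T :: "'a::comm_ring_1"
  shows "ext_weight_enumerator G X Y T = X ^ 40 + (T - 1) * (\<Sum>i = 1..40. veronese_a i T * X ^ (40 - i) * Y ^ i)"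
proof -
  have "ext_weight_enumerator G X Y T =
      (\<Sum>J\<in>Pow {..<40}. T ^ (10 - column_rank G J) * (X - Y) ^ card J * Y ^ (40 - card J))"
    using G unfolding ext_weight_enumerator_def by simp
  also have "\<dots> = (\<Sum>j\<le>40. \<Sum>J\<in>{J \<in> Pow {..<40}. card J = j}. T ^ (10 - column_rank G J) * (X - Y) ^ card J * Y ^ (40 - card J))"
    by (rule sum.group[symmetric]) (auto dest: card_mono[OF finite_lessThan])
  also have "\<dots> = (\<Sum>j\<le>40. (\<Sum>J | J \<subseteq> {..<40} \<and> card J = j. T ^ (10 - column_rank G J)) * ((X - Y) ^ j * Y ^ (40 - j)))"
    unfolding sum_distrib_right by (intro sum.cong refl) (auto simp: mult.assoc)
  also have "\<dots> = (\<Sum>j\<le>40. veronese_b j T * ((X - Y) ^ j * Y ^ (40 - j)))"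
    by (intro sum.cong refl arg_cong2[where f = "(*)"] subset_sum_transfer[OF subset_enumerator]) auto
  finally show ?thesis unfolding veronese_expand .
qed

end

theorem theorem9p1:
  fixes G :: "'f::field mat" and X Y T :: "'a::comm_ring_1"
  assumes "CARD('f) = 3"
    and "G \<in> carrier_mat 10 40"
    and "veronese_matrix G"
  shows "code_dim 40 (code_of G) = 10 \<and>
    ext_weight_enumerator G X Y T =
      X ^ 40 + (T - 1) * (\<Sum>i = 1..40. veronese_a i T * X ^ (40 - i) * Y ^ i)"
proof -
  obtain p where "bij_betw p {..<40} (PG 3)" "\<forall>j<40. proj_point (col G j) = veronese (p j)"
    using assms(2,3) unfolding veronese_matrix_def by auto
  then interpret veronese_code G p
    using assms by unfold_locales auto
  show ?thesis using code_dim_eq ext_weight_enumerator_eq by blast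
qed

end
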